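(* Let $T$ be a principal ideal domain and $S\subset T\setminus\{0\}$ a set of representatives for the action of $T^\times$ on $T\setminus\{0\}$ by multiplication. Then there is a bijection between the set of nondegenerate $G_T$-orbits on $V_T=T^2\otimes{\rm Sym}^2T^3$ and the set of equivalence classes of triples $(R,I,\delta)$, where $R$ is a nondegenerate cubic ring over $T$, $I$ is an ideal of $R$ having rank $3$ as a $T$-module, and $\delta$ is an invertible element of $R\otimes{\rm Frac}(T)$ such that $I^2\subseteq(\delta)$ and $N_S(I)^2=N(\delta)$. Here $(R,I,\delta)$ and $(R',I',\delta')$ are equivalent if there exist a ring isomorphism $\phi:R\to R'$ and $\kappa\in R'\otimes{\rm Frac}(T)$ with $I'=\kappa\,\phi(I)$ and $\delta'=\kappa^2\phi(\delta)$.
   Context: $V_T$ is the space of pairs $(A,B)$ of $3\times3$ symmetric matrices with entries in $T$. ${\rm GL}_2(T)\times{\rm GL}_3(T)$ acts by: $g_2=\begin{pmatrix}r&s\\t&u\end{pmatrix}$ sends $(A,B)\mapsto(rA-sB,-tA+uB)$, and $g_3$ sends $(A,B)\mapsto(g_3Ag_3^t,g_3Bg_3^t)$. $G_T$ is the quotient of ${\rm GL}_2(T)\times{\rm GL}_3(T)$ by the subgroup $\{(\lambda^{-2}I_2,\lambda I_3):\lambda\in T^\times\}$, which acts trivially. The discriminant of $(A,B)$ is ${\rm Disc}(A,B)={\rm Disc}(f)$ where $f(x,y)=\det(Ax-By)=ax^3+bx^2y+cxy^2+dy^3$ and ${\rm Disc}(f)=b^2c^2-4ac^3-4b^3d-27a^2d^2+18abcd$;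 $(A,B)$ is nondegenerate if ${\rm Disc}(A,B)\neq0$. A cubic ring over $T$ is a commutative ring with unit that is free of rank $3$ as a $T$-module; it is nondegenerate if its discriminant is nonzero. $N(\delta)$ is the norm from $R\otimes{\rm Frac}(T)$ to ${\rm Frac}(T)$, and $N_S(I)$ is the unique element of $S$ generating the ideal norm of $I$ as a $T$-ideal (the determinant of a $T$-linear map taking a $T$-basis of $R$ to a $T$-basis of $I$, up to units).
   Formalization: The set S is additionally required to satisfy: every nonzero t in T divides some nonzero m with m³ in S (true for standard choices of S); for arbitrary S the claim fails, e.g. T the 7-adic numbers, S={3}. *)

theory Defs
  imports
    "HOL-Analysis.Determinants"
    "HOL-Computational_Algebra.Polynomial_Factorial"
    "HOL-Algebra.Module"
    "HOL-Algebra.Ring_Divisibility"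
    "HOL-Algebra.Ideal_Product"
    "HOL-Algebra.Group_Action"
    "HOL-Algebra.Algebraic_Closure_Type"
begin

section \<open>Pairs of ternary quadratic forms\<close>

type_synonym 'a sym_pair = "('a ^ 3 ^ 3) \<times> ('a ^ 3 ^ 3)"

definition V_space :: "'a::idom sym_pair set" where
  "V_space = {(A, B). transpose A = A \<and> transpose B = B}"

text \<open>The binary cubic form \<open>det (A x - B y)\<close>, as an element of \<open>T[x][y]\<close>: the inner polynomial
  variable is \<open>x\<close>, the outer one is \<open>y\<close>.\<close>

definition det_form :: "'a::idom sym_pair \<Rightarrow> 'a poly poly" where
  "det_form = (\<lambda>(A, B). det (\<chi> i j. [: [:0, A $ i $ j:], [:- (B $ i $ j):] :]))"

definition cubic_form_disc :: "'a::idom poly poly \<Rightarrow> 'a" where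
  "cubic_form_disc f =
     (let a = poly.coeff (poly.coeff f 0) 3; b = poly.coeff (poly.coeff f 1) 2;
          c = poly.coeff (poly.coeff f 2) 1; d = poly.coeff (poly.coeff f 3) 0
      in b\<^sup>2 * c\<^sup>2 - 4 * a * c ^ 3 - 4 * b ^ 3 * d - 27 * a\<^sup>2 * d\<^sup>2 + 18 * a * b * c * d)"

definition pair_disc :: "'a::idom sym_pair \<Rightarrow> 'a" where
  "pair_disc v = cubic_form_disc (det_form v)"

definition nondegenerate_pairs :: "'a::idom sym_pair set" where
  "nondegenerate_pairs = {v \<in> V_space. pair_disc v \<noteq> 0}"

definition scale_mat :: "'a::idom \<Rightarrow> 'a ^ 3 ^ 3 \<Rightarrow> 'a ^ 3 ^ 3" where
  "scale_mat c A = (\<chi> i j. c * A $ i $ j)"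

definition pair_act :: "('a::idom ^ 2 ^ 2) \<times> ('a ^ 3 ^ 3) \<Rightarrow> 'a sym_pair \<Rightarrow> 'a sym_pair" where
  "pair_act = (\<lambda>(g, h) (A, B).
     let A' = h ** A ** transpose h; B' = h ** B ** transpose h
     in (scale_mat (g $ 1 $ 1) A' - scale_mat (g $ 1 $ 2) B',
         - scale_mat (g $ 2 $ 1) A' + scale_mat (g $ 2 $ 2) B'))"

definition GL :: "('a::idom ^ 'n ^ 'n) monoid" where
  "GL = \<lparr>carrier = {g. invertible g}, mult = (**), one = mat 1\<rparr>"

text \<open>In \<open>T\<close> the inverse of a unit \<open>l\<close> is the \<open>m\<close> with \<open>l * m = 1\<close>; thus \<open>mat (m\<^sup>2)\<close> is
  the scalar matrix of the inverse square of \<open>l\<close>.\<close>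

definition trivial_subgroup :: "(('a::idom ^ 2 ^ 2) \<times> ('a ^ 3 ^ 3)) set" where
  "trivial_subgroup = {(mat (m\<^sup>2), mat l) | l m. l * m = 1}"

definition G_group :: "(('a::idom ^ 2 ^ 2) \<times> ('a ^ 3 ^ 3)) set monoid" where
  "G_group = (GL \<times>\<times> GL) Mod trivial_subgroup"

text \<open>All members of a coset act in the same way, so the image below is a singleton.\<close>

definition G_act ::
    "(('a::idom ^ 2 ^ 2) \<times> ('a ^ 3 ^ 3)) set \<Rightarrow> 'a sym_pair \<Rightarrow> 'a sym_pair" where
  "G_act P v = the_elem ((\<lambda>g. pair_act g v) ` P)"

section \<open>Algebras that are free of rank three\<close>

text \<open>A base ring is a type \<open>'k\<close>, turned into a ring record by \<^const>\<open>ring_of_type_algebra\<close>; an algebra over it is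
  a \<open>('k, 'c) module\<close> record with carrier in \<open>'c\<close>.\<close>

definition lincomb :: "('k, 'c) module \<Rightarrow> (3 \<Rightarrow> 'c) \<Rightarrow> 'k ^ 3 \<Rightarrow> 'c" where
  "lincomb R b u = (\<Oplus>\<^bsub>R\<^esub>i\<in>UNIV. (u $ i) \<odot>\<^bsub>R\<^esub> b i)"

definition is_basis :: "('k, 'c) module \<Rightarrow> 'c set \<Rightarrow> (3 \<Rightarrow> 'c) \<Rightarrow> bool" where
  "is_basis R M b \<longleftrightarrow> range b \<subseteq> M \<and> bij_betw (lincomb R b) UNIV M"

definition coords :: "('k, 'c) module \<Rightarrow> (3 \<Rightarrow> 'c) \<Rightarrow> 'c \<Rightarrow> 'k ^ 3" where
  "coords R b x = inv_into UNIV (lincomb R b) x"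

definition cubic_ring :: "('k::comm_ring_1, 'c) module \<Rightarrow> bool" where
  "cubic_ring R \<longleftrightarrow>
     Module.algebra (ring_of_type_algebra :: 'k ring) R \<and> (\<exists>b. is_basis R (carrier R) b)"

definition mult_matrix :: "('k, 'c) module \<Rightarrow> (3 \<Rightarrow> 'c) \<Rightarrow> 'c \<Rightarrow> 'k ^ 3 ^ 3" where
  "mult_matrix R b x = (\<chi> i j. coords R b (x \<otimes>\<^bsub>R\<^esub> b j) $ i)"

definition basis_disc :: "('k::comm_ring_1, 'c) module \<Rightarrow> (3 \<Rightarrow> 'c) \<Rightarrow> 'k" where
  "basis_disc R b = det (\<chi> i j. trace (mult_matrix R b (b i \<otimes>\<^bsub>R\<^esub> b j)))"

text \<open>A change of basis multiplies the discriminant by the square of a unit, so it does not matter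
  which basis is taken here.\<close>

definition nondegenerate_cubic_ring :: "('k::comm_ring_1, 'c) module \<Rightarrow> bool" where
  "nondegenerate_cubic_ring R \<longleftrightarrow>
     cubic_ring R \<and> (\<exists>b. is_basis R (carrier R) b \<and> basis_disc R b \<noteq> 0)"

definition alg_norm :: "('k::comm_ring_1, 'c) module \<Rightarrow> 'c \<Rightarrow> 'k" where
  "alg_norm R x = (THE d. \<exists>b. is_basis R (carrier R) b \<and> d = det (mult_matrix R b x))"

definition alg_iso :: "('k, 'c) module \<Rightarrow> ('k, 'c) module \<Rightarrow> ('c \<Rightarrow> 'c) \<Rightarrow> bool" where
  "alg_iso R R' \<phi> \<longleftrightarrow>
     \<phi> \<in> ring_iso R R' \<and> (\<forall>t. \<forall>x\<in>carrier R. \<phi> (t \<odot>\<^bsub>R\<^esub> x) = t \<odot>\<^bsub>R'\<^esub> \<phi> x)"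

section \<open>Extension of scalars to the fraction field\<close>

text \<open>\<open>R \<otimes> Frac(T)\<close> is built as the localization of \<open>R\<close> at \<open>T - {0}\<close>: the pair \<open>(r, t)\<close> stands for
  \<open>r \<otimes> 1/t\<close>. As \<open>R\<close> is torsion-free, cross-multiplication is an equivalence relation.\<close>

definition frac_rel :: "('a::idom, 'c) module \<Rightarrow> (('c \<times> 'a) \<times> ('c \<times> 'a)) set" where
  "frac_rel R = {((r, t), (r', t')). r \<in> carrier R \<and> r' \<in> carrier R \<and> t \<noteq> 0 \<and> t' \<noteq> 0 \<and>
                                     t' \<odot>\<^bsub>R\<^esub> r = t \<odot>\<^bsub>R\<^esub> r'}"

definition frac_of :: "('a::idom, 'c) module \<Rightarrow> 'c \<Rightarrow> 'a \<Rightarrow> ('c \<times> 'a) set" where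
  "frac_of R r t = frac_rel R `` {(r, t)}"

definition frac_alg :: "('a::idom, 'c) module \<Rightarrow> ('a fract, ('c \<times> 'a) set) module" where
  "frac_alg R = \<lparr>carrier = (carrier R \<times> {t. t \<noteq> 0}) // frac_rel R,
     mult = (\<lambda>P Q. \<Union>(r, t)\<in>P. \<Union>(r', t')\<in>Q. frac_of R (r \<otimes>\<^bsub>R\<^esub> r') (t * t')),
     one = frac_of R \<one>\<^bsub>R\<^esub> 1,
     ring.zero = frac_of R \<zero>\<^bsub>R\<^esub> 1,
     add = (\<lambda>P Q. \<Union>(r, t)\<in>P. \<Union>(r', t')\<in>Q.
              frac_of R (t' \<odot>\<^bsub>R\<^esub> r \<oplus>\<^bsub>R\<^esub> t \<odot>\<^bsub>R\<^esub> r') (t * t')),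
     module.smult = (\<lambda>k P. \<Union>(a, s)\<in>{(a, s). s \<noteq> 0 \<and> Fraction_Field.Fract a s = k}. \<Union>(r, t)\<in>P.
              frac_of R (a \<odot>\<^bsub>R\<^esub> r) (s * t))\<rparr>"

definition frac_emb :: "('a::idom, 'c) module \<Rightarrow> 'c \<Rightarrow> ('c \<times> 'a) set" where
  "frac_emb R r = frac_of R r 1"

definition frac_map ::
    "('a::idom, 'c) module \<Rightarrow> ('c \<Rightarrow> 'c) \<Rightarrow> ('c \<times> 'a) set \<Rightarrow> ('c \<times> 'a) set" where
  "frac_map R' \<phi> P = (\<Union>(r, t)\<in>P. frac_of R' (\<phi> r) t)"

section \<open>Triples\<close>

definition unit_orbit_reps :: "'a::idom set \<Rightarrow> bool" where
  "unit_orbit_reps S \<longleftrightarrow>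
     S \<subseteq> - {0} \<and> (\<forall>x. x \<noteq> 0 \<longrightarrow> (\<exists>!s. s \<in> S \<and> (\<exists>u. u dvd 1 \<and> s = u * x)))"

text \<open>A normalization of the representatives. It holds for every \<open>S\<close> if all units of \<open>T\<close> are cubes
  (as in the integers), and for every \<open>S\<close> that contains \<open>1\<close> and is closed under multiplication.
  The choice of \<open>S\<close> does matter in general. If \<open>T\<close> is a field, then \<open>S = {s}\<close> and every triple has
  \<open>I = R\<close> and \<open>N(\<delta>) = s\<^sup>2\<close>, hence \<open>N(s/\<delta>) = s\<close>: only those \<open>R\<close> occur for which \<open>s\<close> is a norm. Over the
  7-adic numbers there are finitely many classes of triples, and strictly fewer of them for \<open>S = {3}\<close>
  than for \<open>S = {1}\<close>, because 3 is not a norm from the field generated by the cube root of 7.\<close>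

definition has_cofinal_cubes :: "'a::idom set \<Rightarrow> bool" where
  "has_cofinal_cubes S \<longleftrightarrow> (\<forall>t. t \<noteq> 0 \<longrightarrow> (\<exists>m. m \<noteq> 0 \<and> t dvd m \<and> m ^ 3 \<in> S))"

text \<open>\<open>c\<close> is a basis of \<open>I\<close> and \<open>b\<close> one of \<open>R\<close>; the determinant is that of the \<open>T\<close>-linear map
  sending \<open>b\<close> to \<open>c\<close>. Mutual divisibility says that it generates the same ideal of \<open>T\<close> as \<open>s\<close>.\<close>

definition ideal_norm_rep :: "'a::idom set \<Rightarrow> ('a, 'c) module \<Rightarrow> 'c set \<Rightarrow> 'a" where
  "ideal_norm_rep S R I =
     (THE s. s \<in> S \<and>
        (\<exists>b c. is_basis R (carrier R) b \<and> is_basis R I c \<and>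
           (let d = det (\<chi> i j. coords R b (c j) $ i) in s dvd d \<and> d dvd s)))"

text \<open>The carriers of all the rings considered lie in one type \<open>'c\<close>. As soon as \<open>T\<^sup>3\<close> embeds in \<open>'c\<close>,
  every cubic ring over \<open>T\<close> has an isomorphic copy there, and no equivalence class is missed.\<close>

type_synonym ('a, 'c) triple = "('a, 'c) module \<times> 'c set \<times> ('c \<times> 'a) set"

definition triples :: "'a::idom set \<Rightarrow> ('a, 'c) triple set" where
  "triples S = {(R, I, \<delta>).
     nondegenerate_cubic_ring R \<and>
     ideal I R \<and> (\<exists>c. is_basis R I c) \<and>
     \<delta> \<in> Units (frac_alg R) \<and>
     frac_emb R ` (I \<cdot>\<^bsub>R\<^esub> I) \<subseteq> (\<lambda>r. \<delta> \<otimes>\<^bsub>frac_alg R\<^esub> frac_emb R r) ` carrier R \<and>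
     (to_fract (ideal_norm_rep S R I))\<^sup>2 = alg_norm (frac_alg R) \<delta>}"

definition triple_equiv :: "'a::idom set \<Rightarrow> (('a, 'c) triple \<times> ('a, 'c) triple) set" where
  "triple_equiv S = {((R, I, \<delta>), (R', I', \<delta>')).
     (R, I, \<delta>) \<in> triples S \<and> (R', I', \<delta>') \<in> triples S \<and>
     (\<exists>\<phi> \<kappa>. alg_iso R R' \<phi> \<and> \<kappa> \<in> carrier (frac_alg R') \<and>
        frac_emb R' ` I' = (\<lambda>x. \<kappa> \<otimes>\<^bsub>frac_alg R'\<^esub> frac_emb R' (\<phi> x)) ` I \<and>
        \<delta>' = \<kappa> \<otimes>\<^bsub>frac_alg R'\<^esub> \<kappa> \<otimes>\<^bsub>frac_alg R'\<^esub> frac_map R' \<phi> \<delta>)}"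

end

theory Submission
  imports Defs
begin

text \<open>Let \<open>\<alpha>\<close> be a basis of \<open>I\<close> and \<open>1, \<omega>, \<theta>\<close> one of \<open>R\<close>. Write
  \<open>\<alpha>\<^sub>i \<alpha>\<^sub>j = \<delta> (C\<^sub>i\<^sub>j + B\<^sub>i\<^sub>j \<omega> + A\<^sub>i\<^sub>j \<theta>)\<close>; the triple corresponds to the orbit of \<open>(A, B)\<close>. The form
  \<open>det (A x - B y)\<close> is \<open>N(I)\<^sup>2 / N(\<delta>)\<close> times the index form of \<open>R\<close>, so up to the square of a unit the pair
  determines \<open>R\<close>. It then determines \<open>C\<close>, because the difference of two solutions is annihilated by
  the pencil \<open>A x - B y\<close>, and \<open>C\<close>, \<open>B\<close>, \<open>A\<close> determine \<open>(I, \<delta>)\<close> up to \<open>(\<kappa> I, \<kappa>\<^sup>2 \<delta>)\<close>.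
  Conversely, given \<open>(A, B)\<close>, the ring of its form acts on \<open>T\<^sup>3\<close> through \<open>- B adj A\<close> and
  \<open>- A adj B\<close>. Over the fraction field this module is free of rank one, which gives \<open>I\<close> and \<open>\<delta>\<close>
  with \<open>N(\<delta>) = n\<^sup>2\<close>, where \<open>n = N(I)\<close>. Scaling by \<open>\<kappa> = m \<delta> / n\<close> turns the norm of \<open>I\<close> into \<open>m\<^sup>3\<close>, and
  cofinality of cubes allows this to be an element of \<open>S\<close> with \<open>\<kappa> I\<close> integral.\<close>

text \<open>Both directions live in a fixed \<open>T^3\<close> with the product
  \<open>df_mult f\<close>; module records and localizations enter only through
  \<open>coordinates\<close>, which also serves for the extension to the fraction field. Triples and
  pairs are matched by the relation \<open>represents\<close>, in which the bases of the lattice and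
  of the ring are existentially quantified: the pairs of one triple then form exactly one orbit, and
  nothing needs a canonical choice. Freeness of rank one is not automatic over a product of fields,
  since a factor might act by zero. The traces of the two matrices agree with those of the regular
  representation, so the nondegenerate trace form makes the action faithful, and in dimension three
  an element with zero annihilator is a generator. The choice of \<kappa> rests on N(\<delta> / n) =
  n^2 / n^3 = 1 / n: thus N(\<kappa>) = m^3 / n cancels the uncontrolled norm n of the lattice. The
  condition with \<open>S\<close> sees the determinant of a basis only up to a unit u, so the form
  of the pair is known only up to u^2. This is why forms, and with them \<omega> and \<theta>, get
  rescaled in the uniqueness part.\<close>

no_notation fps_nth (infixl \<open>$\<close> 75)

section \<open>Matrices of size three\<close>

definition adj3 :: "'k::comm_ring_1 ^ 3 ^ 3 \<Rightarrow> 'k ^ 3 ^ 3" where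
  "adj3 A = vector
     [vector [A$2$2 * A$3$3 - A$2$3 * A$3$2, A$1$3 * A$3$2 - A$1$2 * A$3$3, A$1$2 * A$2$3 - A$1$3 * A$2$2],
      vector [A$2$3 * A$3$1 - A$2$1 * A$3$3, A$1$1 * A$3$3 - A$1$3 * A$3$1, A$1$3 * A$2$1 - A$1$1 * A$2$3],
      vector [A$2$1 * A$3$2 - A$2$2 * A$3$1, A$1$2 * A$3$1 - A$1$1 * A$3$2, A$1$1 * A$2$2 - A$1$2 * A$2$1]]"

text \<open>The adjugate is quadratic; this is its polarization, the mixed term in the adjugate of
  \<open>A x + B y\<close>.\<close>

definition mix3 :: "'k::comm_ring_1 ^ 3 ^ 3 \<Rightarrow> 'k ^ 3 ^ 3 \<Rightarrow> 'k ^ 3 ^ 3" where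
  "mix3 A B = adj3 (A + B) - adj3 A - adj3 B"

lemmas mat3_simps = vec_eq_iff forall_3 matrix_matrix_mult_def matrix_vector_mult_def
  vector_matrix_mult_def sum_3 mat_def transpose_def trace_def

lemma adj3_right: "A ** adj3 A = mat (det A)"
  by (simp add: mat3_simps adj3_def det_3 algebra_simps)

lemma adj3_left: "adj3 A ** A = mat (det A)"
  by (simp add: mat3_simps adj3_def det_3 algebra_simps)

lemma adj3_mult: "adj3 (A ** B) = adj3 B ** adj3 A"
  by (simp add: mat3_simps adj3_def algebra_simps)

text \<open>Coefficient of x^2 y in (A x + B y) adj(A x + B y) = det(A x + B y). The next lemma is
  the coefficient of x y^2. Stating them separately avoids matrices of polynomials.\<close>

lemma mix3_adj3: "A ** mix3 A B + B ** adj3 A = mat (trace (adj3 A ** B))"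
  by (simp add: mat3_simps mix3_def adj3_def algebra_simps)

lemma adj3_mix3: "A ** adj3 B + B ** mix3 A B = mat (trace (A ** adj3 B))"
  by (simp add: mat3_simps mix3_def adj3_def algebra_simps)

lemma mat_mult_commute: "mat c ** A = A ** mat c" for A :: "'k::comm_ring_1 ^ 3 ^ 3"
  by (simp add: mat3_simps algebra_simps)

lemma mat_mat: "mat c ** mat d = (mat (c * d) :: 'k::comm_ring_1 ^ 3 ^ 3)"
  by (simp add: mat3_simps algebra_simps)

lemma trace_mat_mult: "trace (mat c ** A) = c * trace A" for A :: "'k::comm_ring_1 ^ 3 ^ 3"
  by (simp add: mat3_simps algebra_simps)

lemma vector_matrix_cancel:
  fixes u v :: "'k::idom ^ 3"
  assumes "det \<alpha> \<noteq> 0" "u v* \<alpha> = v v* \<alpha>"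
  shows "u = v"
proof -
  have "u v* (\<alpha> ** adj3 \<alpha>) = v v* (\<alpha> ** adj3 \<alpha>)"
    using assms(2) by (simp flip: vector_matrix_mul_assoc)
  moreover have "x v* mat c = c *s x" for x :: "'k ^ 3" and c
    by (simp add: mat3_simps)
  ultimately show ?thesis
    using assms(1) by (simp add: adj3_right vec_eq_iff)
qed

lemma row_matrix_mult: "(h ** \<alpha>) $ i = (h $ i) v* \<alpha>"
  by (simp add: vec_eq_iff matrix_matrix_mult_def vector_matrix_mult_def mult.commute)

lemma matrix_mult_cancel_right:
  fixes P Q :: "'k::idom ^ 3 ^ 3"
  assumes "det \<alpha> \<noteq> 0" "P ** \<alpha> = Q ** \<alpha>"
  shows "P = Q"
proof -
  have "P $ i = Q $ i" for i
    using assms vector_matrix_cancel row_matrix_mult by metis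
  then show ?thesis by (simp add: vec_eq_iff)
qed

lemma invertible_iff_det_unit:
  fixes A :: "'k::comm_ring_1 ^ 3 ^ 3"
  shows "invertible A \<longleftrightarrow> det A dvd 1"
proof
  assume "invertible A"
  then obtain B where "A ** B = mat 1" by (auto simp: invertible_def)
  then have "det A * det B = 1" by (simp flip: det_mul)
  then show "det A dvd 1" by (metis dvdI)
next
  assume "det A dvd 1"
  then obtain u where u: "1 = det A * u" by (auto elim: dvdE)
  have "A ** (adj3 A ** mat u) = mat 1"
    using u by (simp add: matrix_mul_assoc adj3_right mat_mat)
  moreover have "(adj3 A ** mat u) ** A = adj3 A ** A ** mat u"
    by (simp add: mat_mult_commute flip: matrix_mul_assoc)
  then have "(adj3 A ** mat u) ** A = mat 1"
    using u by (simp add: adj3_left mat_mat)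
  ultimately show "invertible A" by (auto simp: invertible_def)
qed

lemma invertible_mult':
  fixes A B :: "'k::comm_ring_1 ^ 'n ^ 'n"
  assumes "invertible A" "invertible B"
  shows "invertible (A ** B)"
proof -
  obtain A' B' where "A ** A' = mat 1" "A' ** A = mat 1" "B ** B' = mat 1" "B' ** B = mat 1"
    using assms by (auto simp: invertible_def)
  then have "(A ** B) ** (B' ** A') = mat 1" "(B' ** A') ** (A ** B) = mat 1"
    by (metis matrix_mul_assoc matrix_mul_rid)+
  then show ?thesis by (auto simp: invertible_def)
qed

section \<open>The cubic ring of a binary cubic form\<close>

type_synonym 'k cubic_form = "'k \<times> 'k \<times> 'k \<times> 'k"

text \<open>A vector \<open>x\<close> stands for \<open>x\<^sub>1 + x\<^sub>2 \<omega> + x\<^sub>3 \<theta>\<close>, where \<open>\<omega>\<^sup>2 = - a c + b \<omega> - a \<theta>\<close>,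
  \<open>\<theta>\<^sup>2 = - b d + d \<omega> - c \<theta>\<close> and \<open>\<omega> \<theta> = - a d\<close>. This is the Delone-Faddeev ring of the form with
  \<open>\<omega>\<close> and \<open>\<theta>\<close> replaced by their negatives, so that \<open>det (A x - B y)\<close> comes out without a sign.\<close>

definition df_mult :: "'k::comm_ring_1 cubic_form \<Rightarrow> 'k ^ 3 \<Rightarrow> 'k ^ 3 \<Rightarrow> 'k ^ 3" where
  "df_mult = (\<lambda>(a, b, c, d) x y. vector
     [x$1 * y$1 - a * c * x$2 * y$2 - a * d * (x$2 * y$3 + x$3 * y$2) - b * d * x$3 * y$3,
      x$1 * y$2 + x$2 * y$1 + b * x$2 * y$2 + d * x$3 * y$3,
      x$1 * y$3 + x$3 * y$1 - a * x$2 * y$2 - c * x$3 * y$3])"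

definition df_mat :: "'k::comm_ring_1 cubic_form \<Rightarrow> 'k ^ 3 \<Rightarrow> 'k ^ 3 ^ 3" where
  "df_mat f x = (\<chi> i j. df_mult f x (axis j 1) $ i)"

definition df_norm :: "'k::comm_ring_1 cubic_form \<Rightarrow> 'k ^ 3 \<Rightarrow> 'k" where
  "df_norm f x = det (df_mat f x)"

definition df_disc :: "'k::comm_ring_1 cubic_form \<Rightarrow> 'k" where
  "df_disc = (\<lambda>(a, b, c, d).
     b\<^sup>2 * c\<^sup>2 - 4 * a * c ^ 3 - 4 * b ^ 3 * d - 27 * a\<^sup>2 * d\<^sup>2 + 18 * a * b * c * d)"

abbreviation vone :: "'k::comm_ring_1 ^ 3" where "vone \<equiv> axis 1 1"

lemma axis3_simps [simp]:
  "axis 1 c $ (1::3) = c" "axis 1 c $ (2::3) = 0" "axis 1 c $ (3::3) = 0"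
  "axis 2 c $ (1::3) = 0" "axis 2 c $ (2::3) = c" "axis 2 c $ (3::3) = 0"
  "axis 3 c $ (1::3) = 0" "axis 3 c $ (2::3) = 0" "axis 3 c $ (3::3) = c"
  by (simp_all add: axis_def)

lemma df_mult_commute: "df_mult f x y = df_mult f y x"
  by (cases f) (simp add: df_mult_def vec_eq_iff forall_3 algebra_simps)

lemma df_mult_assoc: "df_mult f (df_mult f x y) z = df_mult f x (df_mult f y z)"
  by (cases f) (simp add: df_mult_def vec_eq_iff forall_3 algebra_simps)

lemma df_mult_left_commute: "df_mult f x (df_mult f y z) = df_mult f y (df_mult f x z)"
  by (metis df_mult_assoc df_mult_commute)

lemmas df_mult_ac = df_mult_assoc df_mult_commute df_mult_left_commute

lemma df_mult_one [simp]: "df_mult f vone x = x" "df_mult f x vone = x"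
  by (cases f, simp add: df_mult_def vec_eq_iff forall_3)+

lemma df_mult_zero [simp]: "df_mult f 0 x = 0" "df_mult f x 0 = 0"
  by (cases f, simp add: df_mult_def vec_eq_iff forall_3)+

lemma df_mult_add:
  "df_mult f (x + y) z = df_mult f x z + df_mult f y z"
  "df_mult f z (x + y) = df_mult f z x + df_mult f z y"
  by (cases f, simp add: df_mult_def vec_eq_iff forall_3 algebra_simps)+

lemma df_mult_diff:
  "df_mult f (x - y) z = df_mult f x z - df_mult f y z"
  "df_mult f z (x - y) = df_mult f z x - df_mult f z y"
  by (cases f, simp add: df_mult_def vec_eq_iff forall_3 algebra_simps)+

lemma df_mult_scale:
  "df_mult f (k *s x) y = k *s df_mult f x y"
  "df_mult f x (k *s y) = k *s df_mult f x y"
  by (cases f, simp add: df_mult_def vec_eq_iff forall_3 algebra_simps)+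

lemma df_mat_vector: "df_mat f x *v y = df_mult f x y"
  by (cases f) (simp add: df_mat_def df_mult_def mat3_simps algebra_simps)

lemma df_mat_mult: "df_mat f (df_mult f x y) = df_mat f x ** df_mat f y"
  by (cases f) (simp add: df_mat_def df_mult_def mat3_simps algebra_simps)

lemma df_mat_one [simp]: "df_mat f vone = mat 1"
  by (simp add: df_mat_def) (simp add: axis_def mat_def vec_eq_iff)

lemma df_norm_mult: "df_norm f (df_mult f x y) = df_norm f x * df_norm f y"
  by (simp add: df_norm_def df_mat_mult det_mul)

lemma df_norm_one [simp]: "df_norm f vone = 1"
  by (simp add: df_norm_def)

lemma df_norm_scale: "df_norm f (k *s x) = k ^ 3 * df_norm f x"
  by (cases f) (simp add: df_norm_def df_mat_def df_mult_def det_3 power3_eq_cube algebra_simps)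

lemma df_inverse:
  fixes x :: "'k::field ^ 3"
  assumes "df_norm f x \<noteq> 0"
  obtains y where "df_mult f x y = vone"
proof -
  have "df_mult f x (adj3 (df_mat f x) *v ((1 / df_norm f x) *s vone)) = vone"
    using assms
    by (simp add: adj3_right matrix_vector_mul_assoc df_norm_def flip: df_mat_vector)
      (simp add: mat3_simps)
  then show ?thesis using that by blast
qed

lemma df_norm_unit: "df_mult f x y = vone \<Longrightarrow> df_norm f x * df_norm f y = 1"
  by (metis df_norm_mult df_norm_one)

lemma df_mult_cancel:
  assumes "df_mult f d q = vone" "df_mult f d x = df_mult f d y"
  shows "x = y"
  by (metis assms df_mult_assoc df_mult_commute df_mult_one(1))

section \<open>The binary cubic form of a pair of matrices\<close>

text \<open>The coefficients of \<open>det (A x - B y)\<close>.\<close>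

definition pair_form :: "'k::comm_ring_1 ^ 3 ^ 3 \<Rightarrow> 'k ^ 3 ^ 3 \<Rightarrow> 'k cubic_form" where
  "pair_form A B = (det A, - trace (adj3 A ** B), trace (A ** adj3 B), - det B)"

definition form_scale :: "'k::comm_ring_1 \<Rightarrow> 'k cubic_form \<Rightarrow> 'k cubic_form" where
  "form_scale k = (\<lambda>(a, b, c, d). (k * a, k * b, k * c, k * d))"

lemma form_scale_scale: "form_scale k (form_scale l f) = form_scale (k * l) f"
  by (cases f) (simp add: form_scale_def)

lemma form_scale_1 [simp]: "form_scale 1 f = f"
  by (cases f) (simp add: form_scale_def)

lemma df_disc_scale: "df_disc (form_scale k f) = k ^ 4 * df_disc f"
  by (cases f) (simp add: df_disc_def form_scale_def power_mult_distrib algebra_simps power2_eq_square power3_eq_cube power4_eq_xxxx)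

lemma pair_disc_eq: "pair_disc (A, B) = df_disc (pair_form A B)"
proof -
  define g where "g = pair_form A B"
  obtain a b c d where g: "g = (a, b, c, d)" by (cases g)
  \<comment> \<open>The outer list runs over powers of y, the inner ones over powers of x; the
    leading zeros put \<open>a\<close> at x^3, \<open>b\<close> at x^2 y, \<open>c\<close> at x y^2
    and \<open>d\<close> at y^3.\<close>
  have "det_form (A, B) = [: [:0, 0, 0, a:], [:0, 0, b:], [:0, c:], [:d:] :]"
    using g unfolding g_def
    by (simp add: det_form_def pair_form_def det_3 adj3_def trace_def matrix_matrix_mult_def sum_3 algebra_simps)
  then show ?thesis
    unfolding pair_disc_def cubic_form_disc_def g_def[symmetric] g df_disc_def
    by (simp add: eval_nat_numeral Let_def)
qed

text \<open>Coefficientwise form of det(h (A x - B y)) = det h det(A x - B y). Only the two mixed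
  coefficients take work: \<open>adj3 h\<close> has to be brought next to \<open>h\<close>.\<close>

lemma pair_form_mult_left: "pair_form (h ** A) (h ** B) = form_scale (det h) (pair_form A B)"
proof -
  have "trace (adj3 (h ** A) ** (h ** B)) = det h * trace (adj3 A ** B)"
  proof -
    have "adj3 (h ** A) ** (h ** B) = adj3 A ** (adj3 h ** h) ** B"
      by (simp add: adj3_mult matrix_mul_assoc)
    also have "\<dots> = mat (det h) ** (adj3 A ** B)"
      by (simp add: adj3_left matrix_mul_assoc mat_mult_commute)
    finally show ?thesis by (simp add: trace_mat_mult)
  qed
  moreover have "trace ((h ** A) ** adj3 (h ** B)) = det h * trace (A ** adj3 B)"
  proof -
    have "trace ((h ** A) ** adj3 (h ** B)) = trace (h ** (A ** adj3 B ** adj3 h))"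
      by (simp add: adj3_mult matrix_mul_assoc)
    also have "\<dots> = trace (A ** adj3 B ** (adj3 h ** h))"
      by (subst trace_mul_sym) (simp add: matrix_mul_assoc)
    also have "\<dots> = trace (mat (det h) ** (A ** adj3 B))"
      by (simp add: adj3_left mat_mult_commute)
    finally show ?thesis by (simp add: trace_mat_mult)
  qed
  ultimately show ?thesis
    by (simp add: pair_form_def form_scale_def det_mul)
qed

lemma pair_form_mult_right: "pair_form (A ** h) (B ** h) = form_scale (det h) (pair_form A B)"
proof -
  have "trace (adj3 (A ** h) ** (B ** h)) = det h * trace (adj3 A ** B)"
  proof -
    have "trace (adj3 (A ** h) ** (B ** h)) = trace (adj3 h ** (adj3 A ** B ** h))"
      by (simp add: adj3_mult matrix_mul_assoc)
    also have "\<dots> = trace (adj3 A ** B ** (h ** adj3 h))"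
      by (subst trace_mul_sym) (simp add: matrix_mul_assoc)
    also have "\<dots> = trace (mat (det h) ** (adj3 A ** B))"
      by (simp add: adj3_right mat_mult_commute)
    finally show ?thesis by (simp add: trace_mat_mult)
  qed
  moreover have "trace ((A ** h) ** adj3 (B ** h)) = det h * trace (A ** adj3 B)"
  proof -
    have "(A ** h) ** adj3 (B ** h) = A ** (h ** adj3 h) ** adj3 B"
      by (simp add: adj3_mult matrix_mul_assoc)
    also have "\<dots> = mat (det h) ** (A ** adj3 B)"
      by (simp add: adj3_right matrix_mul_assoc mat_mult_commute)
    finally show ?thesis by (simp add: trace_mat_mult)
  qed
  ultimately show ?thesis
    by (simp add: pair_form_def form_scale_def det_mul)
qed

section \<open>Pairs of forms from multiplication tables\<close>

lemma vector_matrix_rows: "x v* \<alpha> = x$1 *s \<alpha>$1 + x$2 *s \<alpha>$2 + x$3 *s \<alpha>$3" for \<alpha> :: "'k::comm_ring_1 ^ 3 ^ 3"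
  by (simp add: mat3_simps mult.commute)

lemma df_mult_rows:
  fixes x y :: "'k::comm_ring_1 ^ 3"
  shows "df_mult f (x v* \<alpha>) y = x$1 *s df_mult f (\<alpha>$1) y + x$2 *s df_mult f (\<alpha>$2) y + x$3 *s df_mult f (\<alpha>$3) y"
  by (simp add: vector_matrix_rows df_mult_add df_mult_scale)

text \<open>The coefficients of \<open>\<theta>\<close> and of \<open>\<omega>\<close> in the products of \<open>1, \<omega>, \<theta>\<close>.\<close>

definition pencil3 :: "'k::comm_ring_1 cubic_form \<Rightarrow> 'k ^ 3 ^ 3" where
  "pencil3 = (\<lambda>(a, b, c, d). vector [vector [0, 0, 1], vector [0, - a, 0], vector [1, 0, - c]])"

definition pencil2 :: "'k::comm_ring_1 cubic_form \<Rightarrow> 'k ^ 3 ^ 3" where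
  "pencil2 = (\<lambda>(a, b, c, d). vector [vector [0, 1, 0], vector [1, b, 0], vector [0, 0, d]])"

lemma pair_form_pencil: "pair_form (pencil3 f) (pencil2 f) = f"
  by (cases f) (simp add: pair_form_def pencil3_def pencil2_def det_3 adj3_def trace_def
      matrix_matrix_mult_def sum_3)

text \<open>The coefficient of \<theta> (or \<omega>) in q x y is bilinear in x and y. Its matrix is
  that for q = 1, a pencil matrix, with the multiplication by q carried out on the first argument.
  Hence both coefficients get the same factor \<open>transpose (df_mat f q)\<close>.\<close>

lemma pencil_eq:
  fixes \<alpha> :: "'k::comm_ring_1 ^ 3 ^ 3"
  shows "(\<chi> i j. df_mult f q (df_mult f (\<alpha>$i) (\<alpha>$j)) $ 3)
           = \<alpha> ** (transpose (df_mat f q) ** pencil3 f) ** transpose \<alpha>"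
    and "(\<chi> i j. df_mult f q (df_mult f (\<alpha>$i) (\<alpha>$j)) $ 2)
           = \<alpha> ** (transpose (df_mat f q) ** pencil2 f) ** transpose \<alpha>"
proof -
  obtain a b c d where f: "f = (a, b, c, d)" by (cases f)
  show "(\<chi> i j. df_mult f q (df_mult f (\<alpha>$i) (\<alpha>$j)) $ 3)
           = \<alpha> ** (transpose (df_mat f q) ** pencil3 f) ** transpose \<alpha>"
    unfolding f vec_eq_iff
    by (intro allI) (simp add: df_mult_def df_mat_def pencil3_def matrix_matrix_mult_def
        transpose_def sum_3 algebra_simps)
  show "(\<chi> i j. df_mult f q (df_mult f (\<alpha>$i) (\<alpha>$j)) $ 2)
           = \<alpha> ** (transpose (df_mat f q) ** pencil2 f) ** transpose \<alpha>"
    unfolding f vec_eq_iff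
    by (intro allI) (simp add: df_mult_def df_mat_def pencil2_def matrix_matrix_mult_def
        transpose_def sum_3 algebra_simps)
qed

text \<open>The matrices hold the coefficients of \<open>1\<close>, \<open>\<omega>\<close> and \<open>\<theta>\<close>, in this order; the paper's pair \<open>(A, B)\<close>
  thus consists of the last two in reverse.\<close>

definition table :: "'k ^ 3 ^ 3 \<Rightarrow> 'k ^ 3 ^ 3 \<Rightarrow> 'k ^ 3 ^ 3 \<Rightarrow> 3 \<Rightarrow> 3 \<Rightarrow> 'k::zero ^ 3" where
  "table C B A i j = vector [C$i$j, B$i$j, A$i$j]"

lemma table_nth [simp]:
  "table C B A i j $ 1 = C$i$j" "table C B A i j $ 2 = B$i$j" "table C B A i j $ 3 = A$i$j"
  by (simp_all add: table_def)

definition has_table ::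
  "'k::comm_ring_1 cubic_form \<Rightarrow> 'k ^ 3 ^ 3 \<Rightarrow> 'k ^ 3 \<Rightarrow> 'k ^ 3 ^ 3 \<Rightarrow> 'k ^ 3 ^ 3 \<Rightarrow> 'k ^ 3 ^ 3 \<Rightarrow> bool" where
  "has_table f \<alpha> d C B A \<longleftrightarrow> (\<forall>i j. df_mult f (\<alpha>$i) (\<alpha>$j) = df_mult f d (table C B A i j))"

lemma has_table_inverse:
  assumes "has_table f \<alpha> d C B A" "df_mult f d q = vone"
  shows "df_mult f q (df_mult f (\<alpha>$i) (\<alpha>$j)) = table C B A i j"
proof -
  have "df_mult f q (df_mult f (\<alpha>$i) (\<alpha>$j)) = df_mult f (df_mult f d q) (table C B A i j)"
    using assms(1) by (simp add: has_table_def df_mult_ac)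
  then show ?thesis by (simp add: assms(2))
qed

text \<open>\<open>A\<close> and \<open>B\<close> arise from the two pencil matrices by the same
  left and right factors, and the form of the pencil matrices is \<open>f\<close> itself, so only
  determinants of the factors remain. Here q plays the role of 1 / \<delta>.\<close>

lemma pair_form_table_inverse:
  fixes \<alpha> :: "'k::comm_ring_1 ^ 3 ^ 3"
  assumes "\<And>i j. df_mult f q (df_mult f (\<alpha>$i) (\<alpha>$j)) = table C B A i j"
  shows "pair_form A B = form_scale (df_norm f q * (det \<alpha>)\<^sup>2) f"
proof -
  let ?L = "transpose (df_mat f q)"
  have "A = \<alpha> ** (?L ** pencil3 f) ** transpose \<alpha>" "B = \<alpha> ** (?L ** pencil2 f) ** transpose \<alpha>"
    using pencil_eq[of f q \<alpha>] assms by (simp_all add: vec_eq_iff)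
  then show ?thesis
    by (simp add: pair_form_mult_left pair_form_mult_right pair_form_pencil form_scale_scale
        det_transpose df_norm_def power2_eq_square ac_simps)
qed

lemma pair_form_table:
  fixes f :: "'k::comm_ring_1 cubic_form"
  assumes "has_table f \<alpha> d C B A" "df_mult f d q = vone"
  shows "form_scale (df_norm f d) (pair_form A B) = form_scale ((det \<alpha>)\<^sup>2) f"
  unfolding pair_form_table_inverse[OF has_table_inverse[OF assms]]
  by (simp add: form_scale_scale df_norm_unit[OF assms(2)] flip: mult.assoc)

text \<open>The rows \<open>P x + Q y\<close> annihilate the pencil \<open>A x - B y\<close>; multiplying by its adjugate shows that
  they are annihilated by the cubic form.\<close>

lemma pencil_kernel:
  fixes P Q :: "'k::idom ^ 3 ^ 3"
  assumes "P ** A = 0" "Q ** B = 0" "P ** B = Q ** A" "pair_form A B \<noteq> (0, 0, 0, 0)"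
  shows "P = 0 \<and> Q = 0"
proof -
  obtain a b c d where f: "pair_form A B = (a, b, c, d)" by (cases "pair_form A B")
  have a: "mat a = A ** adj3 A" and d: "mat (- d) = B ** adj3 B"
    and b: "mat (- b) = A ** mix3 A B + B ** adj3 A" and c: "mat c = A ** adj3 B + B ** mix3 A B"
    using f by (auto simp: pair_form_def adj3_right mix3_adj3 adj3_mix3)
  have z: "(0 :: 'k ^ 3 ^ 3) ** U = 0" for U :: "'k ^ 3 ^ 3" by (simp add: mat3_simps)
  have aP: "P ** mat a = 0" and dQ: "Q ** mat (- d) = 0"
    unfolding a d by (simp_all add: matrix_mul_assoc assms z)
  have bP: "P ** mat (- b) = Q ** mat a"
    unfolding a b by (simp add: matrix_add_ldistrib matrix_mul_assoc assms z)
  have bQ: "Q ** mat (- b) = Q ** A ** mix3 A B"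
    unfolding b by (simp add: matrix_add_ldistrib matrix_mul_assoc assms z)
  have cP: "P ** mat c = Q ** mat (- b)"
    unfolding bQ unfolding c by (simp add: matrix_add_ldistrib matrix_mul_assoc assms z)
  have dP: "P ** mat (- d) = Q ** mat c"
    unfolding c d by (simp add: matrix_add_ldistrib matrix_mul_assoc assms z)
  have nz: "U ** mat k = 0 \<Longrightarrow> k \<noteq> 0 \<Longrightarrow> U = 0" for U :: "'k ^ 3 ^ 3" and k
    by (simp add: mat3_simps)
  have m0: "U ** mat 0 = 0" for U :: "'k ^ 3 ^ 3" by (simp add: mat3_simps)
  \<comment> \<open>The relations above link \<open>P\<close> and \<open>Q\<close> across
    consecutive coefficients: the first nonzero coefficient kills \<open>P\<close>, and the next
    relation then kills \<open>Q\<close>.\<close>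
  consider "a \<noteq> 0" | "a = 0" "b \<noteq> 0" | "a = 0" "b = 0" "c \<noteq> 0" | "a = 0" "b = 0" "c = 0" "d \<noteq> 0"
    using assms(4) f by auto
  then show ?thesis
  proof cases
    case 1
    then show ?thesis using aP bP nz[of P a] nz[of Q a] z by metis
  next
    case 2
    then show ?thesis using bP cP nz[of P "- b"] nz[of Q "- b"] z m0 by (metis neg_equal_0_iff_equal)
  next
    case 3
    then show ?thesis using cP dP nz[of P c] nz[of Q c] z m0 by (metis neg_equal_0_iff_equal)
  next
    case 4
    then show ?thesis using dP dQ nz[of P "- d"] nz[of Q "- d"] z m0 by (metis neg_equal_0_iff_equal)
  qed
qed

section \<open>Recovering the lattice from the pair\<close>

lemma mat_mult_nth: "(mat c ** A) $ i $ j = c * A $ i $ j" for A :: "'k::comm_ring_1 ^ 3 ^ 3"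
  using exhaust_3[of i] by (auto simp: matrix_matrix_mult_def mat_def sum_3)

text \<open>\<open>W\<close> and \<open>Z\<close> are the matrices of multiplication by \<omega> and
  \<theta> in the basis formed by the rows of \<alpha>. The products (\<omega> \<alpha>_i)
  \<alpha>_j can be computed by combining rows of the table or by multiplying its entries by
  \<omega>; comparing coefficients of \<theta> and \<omega>, and likewise for \<theta>, gives the
  four relations.\<close>

lemma table_action:
  fixes \<alpha> :: "'k::field ^ 3 ^ 3"
  assumes "has_table (a, b, c, d) \<alpha> \<delta> C B A" "df_mult (a, b, c, d) \<delta> q = vone" "det \<alpha> \<noteq> 0"
  obtains W Z where "W ** A = mat (- a) ** B" "W ** B = C + mat b ** B"
    "Z ** B = mat d ** A" "Z ** A = C - mat c ** A"
proof -
  define f where "f = (a, b, c, d)"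
  obtain \<beta> where \<beta>: "\<alpha> ** \<beta> = mat 1" "\<beta> ** \<alpha> = mat 1"
    using assms(3) invertible_det_nz[of \<alpha>] by (auto simp: invertible_def)
  define M where "M t = \<alpha> ** transpose (df_mat f t) ** \<beta>" for t
  have row: "(M t $ i) v* \<alpha> = df_mult f t (\<alpha>$i)" for t i
  proof -
    have "M t ** \<alpha> = \<alpha> ** transpose (df_mat f t)"
      by (simp add: M_def \<beta> flip: matrix_mul_assoc)
    then have "(M t $ i) v* \<alpha> = (\<alpha>$i) v* transpose (df_mat f t)"
      by (metis row_matrix_mult)
    also have "\<dots> = df_mat f t *v (\<alpha>$i)" by simp
    finally show ?thesis by (simp add: df_mat_vector)
  qed
  have act: "df_mult f t (table C B A i j) = M t $ i $ 1 *s table C B A 1 j + M t $ i $ 2 *s table C B A 2 j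
      + M t $ i $ 3 *s table C B A 3 j" for t i j
  proof -
    note h = has_table_inverse[OF assms(1,2), folded f_def]
    have "df_mult f t (table C B A i j) = df_mult f q (df_mult f (df_mult f t (\<alpha>$i)) (\<alpha>$j))"
      by (simp add: df_mult_ac flip: h)
    also have "df_mult f t (\<alpha>$i) = (M t $ i) v* \<alpha>" by (simp add: row)
    finally show ?thesis by (simp add: df_mult_rows df_mult_add df_mult_scale h)
  qed
  have A: "M (axis 2 1) ** A = mat (- a) ** B" "M (axis 2 1) ** B = C + mat b ** B"
    "M (axis 3 1) ** B = mat d ** A" "M (axis 3 1) ** A = C - mat c ** A"
    using act[of "axis 2 1", unfolded vec_eq_iff forall_3] act[of "axis 3 1", unfolded vec_eq_iff forall_3]
    by (simp_all add: vec_eq_iff mat_mult_nth f_def df_mult_def) (simp_all add: matrix_matrix_mult_def sum_3)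
  then show thesis by (rule that)
qed

lemma table_unique:
  fixes f :: "'k::field cubic_form"
  assumes t: "has_table f \<alpha> \<delta> C B A" "df_mult f \<delta> q = vone" "det \<alpha> \<noteq> 0"
    and t': "has_table f \<alpha>' \<delta>' C' B A" "df_mult f \<delta>' q' = vone" "det \<alpha>' \<noteq> 0"
    and nz: "pair_form A B \<noteq> (0, 0, 0, 0)"
  obtains \<gamma> where "\<And>i. \<alpha>' $ i = df_mult f \<gamma> (\<alpha> $ i)" "\<delta>' = df_mult f \<gamma> (df_mult f \<gamma> \<delta>)"
proof -
  obtain a b c d where f: "f = (a, b, c, d)" by (cases f)
  obtain W Z where w: "W ** A = mat (- a) ** B" "W ** B = C + mat b ** B"
    "Z ** B = mat d ** A" "Z ** A = C - mat c ** A"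
    using table_action[OF t[unfolded f]] by blast
  obtain W' Z' where w': "W' ** A = mat (- a) ** B" "W' ** B = C' + mat b ** B"
    "Z' ** B = mat d ** A" "Z' ** A = C' - mat c ** A"
    using table_action[OF t'[unfolded f]] by blast
  have sub: "(T - Y) ** U = T ** U - Y ** U" for T Y U :: "'k ^ 3 ^ 3"
    by (simp add: mat3_simps algebra_simps)
  \<comment> \<open>Both (W - W') B and (Z - Z') A equal C - C', which is the compatibility required
    by \<open>pencil_kernel\<close>. Once the actions agree, so do \<open>C\<close> and
    \<open>C'\<close>.\<close>
  have "W - W' = 0 \<and> Z - Z' = 0"
    by (rule pencil_kernel[OF _ _ _ nz]) (simp_all add: sub w w')
  then have C: "C' = C" using w w' by simp
  have eq: "df_mult f q (df_mult f (\<alpha>$i) (\<alpha>$j)) = df_mult f q' (df_mult f (\<alpha>'$i) (\<alpha>'$j))" for i j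
    using has_table_inverse[OF t(1,2)] has_table_inverse[OF t'(1,2)] C by simp
  obtain \<beta> where \<beta>: "\<beta> ** \<alpha> = mat 1"
    using t(3) invertible_det_nz[of \<alpha>] by (auto simp: invertible_def)
  \<comment> \<open>\<open>x\<close> holds the coordinates of 1 in the first basis. The factor
    sought sends 1 to itself and the rows of \<alpha> to those of \<alpha>', so it must be the same
    combination of the rows of \<alpha>'. Putting 1 into one slot of \<open>eq\<close>, then into
    both, gives \<open>e1\<close> and \<open>e2\<close>.\<close>
  define x where "x = vone v* \<beta>"
  have x: "x v* \<alpha> = vone" by (simp add: x_def \<beta> vector_matrix_mul_assoc)
  define g where "g = x v* \<alpha>'"
  have e1: "df_mult f q (\<alpha>$j) = df_mult f q' (df_mult f g (\<alpha>'$j))" for j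
  proof -
    have "df_mult f q (df_mult f (x v* \<alpha>) (\<alpha>$j)) = df_mult f q' (df_mult f (x v* \<alpha>') (\<alpha>'$j))"
      by (simp add: df_mult_rows df_mult_add df_mult_scale eq)
    then show ?thesis by (simp add: x g_def)
  qed
  have e2: "q = df_mult f q' (df_mult f g g)"
  proof -
    have "df_mult f q (df_mult f (x v* \<alpha>) vone) = df_mult f (df_mult f q' g) (df_mult f (x v* \<alpha>') vone)"
      using e1 by (simp only: df_mult_rows) (simp add: df_mult_add df_mult_scale df_mult_assoc)
    then show ?thesis by (simp add: x g_def df_mult_assoc)
  qed
  have "\<alpha>' $ j = df_mult f g (\<alpha> $ j)" for j
  proof -
    have "df_mult f g (\<alpha> $ j) = df_mult f (df_mult f g \<delta>) (df_mult f q (\<alpha> $ j))"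
      using t(2) by (metis df_mult_assoc df_mult_commute df_mult_one(1))
    also have "\<dots> = df_mult f \<delta> (df_mult f (df_mult f q' (df_mult f g g)) (\<alpha>' $ j))"
      unfolding e1 by (simp add: df_mult_ac)
    also have "\<dots> = \<alpha>' $ j"
      unfolding e2[symmetric] by (simp add: t(2) flip: df_mult_assoc)
    finally show ?thesis ..
  qed
  moreover have "\<delta>' = df_mult f g (df_mult f g \<delta>)"
  proof -
    have "df_mult f g (df_mult f g \<delta>) = df_mult f (df_mult f \<delta>' q') (df_mult f \<delta> (df_mult f g g))"
      by (simp add: t'(2) df_mult_ac)
    also have "\<dots> = df_mult f \<delta>' (df_mult f \<delta> (df_mult f q' (df_mult f g g)))"
      by (simp add: df_mult_ac)
    also have "\<dots> = \<delta>'" by (simp add: t(2) flip: e2)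
    finally show ?thesis ..
  qed
  ultimately show thesis by (rule that)
qed

section \<open>Generators of modules over nondegenerate cubic algebras\<close>

definition df_trace :: "'k::comm_ring_1 cubic_form \<Rightarrow> 'k ^ 3 \<Rightarrow> 'k" where
  "df_trace f x = trace (df_mat f x)"

definition df_gram :: "'k::comm_ring_1 cubic_form \<Rightarrow> 'k ^ 3 ^ 3" where
  "df_gram f = (\<chi> i j. df_trace f (df_mult f (axis i 1) (axis j 1)))"

lemma df_trace_eq: "df_trace (a, b, c, d) x = 3 * x$1 + b * x$2 - c * x$3"
  by (simp add: df_trace_def df_mat_def trace_def sum_3 df_mult_def algebra_simps)

lemma df_trace_mult: "df_trace f (df_mult f x y) = (\<Sum>i\<in>UNIV. x $ i * (df_gram f *v y) $ i)"
proof -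
  obtain a b c d where f: "f = (a, b, c, d)" by (cases f)
  show ?thesis
    unfolding f by (simp add: df_trace_eq df_gram_def df_mult_def matrix_vector_mult_def sum_3 algebra_simps)
qed

text \<open>Turns nondegeneracy of the form over a field into invertibility of the matrix of the
  trace form.\<close>

lemma det_df_gram: "det (df_gram f) = df_disc f"
proof -
  obtain a b c d where f: "f = (a, b, c, d)" by (cases f)
  show ?thesis
    unfolding f by (simp add: df_gram_def df_trace_eq df_mult_def df_disc_def det_3 algebra_simps eval_nat_numeral)
qed

lemma adj3_char: "adj3 M = M ** M - mat (trace M) ** M + mat (trace (adj3 M))"
  by (simp add: mat3_simps adj3_def algebra_simps)

lemma trace_square: "trace (M ** M) = (trace M)\<^sup>2 - 2 * trace (adj3 M)" for M :: "'k::comm_ring_1 ^ 3 ^ 3"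
  by (simp add: mat3_simps adj3_def algebra_simps power2_eq_square)

text \<open>Cayley-Hamilton for multiplication by x, evaluated at 1. It is kept in the factored form
  x adj(x) = N(x), where the adjugate is itself a polynomial in x.\<close>

lemma df_char:
  "df_mult f x (df_mult f x x - df_trace f x *s x + trace (adj3 (df_mat f x)) *s vone)
     = df_norm f x *s vone"
proof -
  let ?M = "df_mat f x"
  have m: "mat k *v v = k *s v" for k and v :: "'a ^ 3"
    by (simp add: mat3_simps)
  have "adj3 ?M *v vone = df_mult f x x - df_trace f x *s x + trace (adj3 ?M) *s vone"
    by (subst adj3_char) (simp add: matrix_vector_mult_diff_rdistrib matrix_vector_mult_add_rdistrib
        m df_trace_def df_mat_vector flip: matrix_vector_mul_assoc)
  moreover have "?M *v (adj3 ?M *v vone) = df_norm f x *s vone"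
    by (simp add: matrix_vector_mul_assoc adj3_right m df_norm_def)
  ultimately show ?thesis by (simp add: df_mat_vector)
qed

lemma df_mat_zero: "df_mat f 0 = 0"
  by (simp add: df_mat_def vec_eq_iff)

text \<open>For z nonzero with z^2 = 0 the characteristic identity shrinks to s z = N(z).
  Multiplying by z kills N(z), hence s vanishes, and the square of the trace is tr(z^2) + 2 s = 0.
  No division occurs, so every characteristic is covered.\<close>

lemma df_trace_nilpotent:
  fixes z :: "'k::field ^ 3"
  assumes z: "df_mult f z z = 0"
  shows "df_trace f z = 0"
proof (cases "z = 0")
  case True
  then show ?thesis by (simp add: df_trace_def df_mat_zero trace_def)
next
  case False
  define s where "s = trace (adj3 (df_mat f z))"
  have *: "s *s z = df_norm f z *s vone"
    using df_char[of f z] by (simp add: z s_def df_mult_add df_mult_diff df_mult_scale)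
  then have "df_mult f z (s *s z) = df_norm f z *s z"
    by (simp add: df_mult_scale)
  then have "df_norm f z = 0"
    using False by (simp add: df_mult_scale z)
  with * have "s = 0" using False by simp
  then have "(df_trace f z)\<^sup>2 = 0"
    using trace_square[of "df_mat f z"]
    by (simp add: s_def df_trace_def df_mat_zero trace_def z flip: df_mat_mult)
  then show ?thesis by simp
qed

lemma df_trace_nondegenerate:
  fixes x :: "'k::field ^ 3"
  assumes "df_disc f \<noteq> 0" "\<And>y. df_trace f (df_mult f y x) = 0"
  shows "x = 0"
proof -
  have "(df_gram f *v x) $ i = 0" for i
    using assms(2)[of "axis i 1"] by (simp add: df_trace_mult axis_def if_distrib[of "\<lambda>x. x * _"] cong: if_cong)
  then have "df_gram f *v x = 0" by (simp add: vec_eq_iff)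
  then have "(adj3 (df_gram f) ** df_gram f) *v x = 0"
    by (simp flip: matrix_vector_mul_assoc)
  then show ?thesis
    using assms(1) by (simp add: adj3_left det_df_gram) (simp add: mat3_simps)
qed

text \<open>Every multiple of x squares to zero as well, so x is orthogonal to the whole algebra
  under the trace form.\<close>

lemma df_reduced:
  fixes x :: "'k::field ^ 3"
  assumes "df_disc f \<noteq> 0" "df_mult f x x = 0"
  shows "x = 0"
proof (rule df_trace_nondegenerate[OF assms(1)])
  fix y
  have "df_mult f (df_mult f y x) (df_mult f y x) = df_mult f (df_mult f y y) (df_mult f x x)"
    by (simp add: df_mult_ac)
  then show "df_trace f (df_mult f y x) = 0"
    by (simp add: assms(2) df_trace_nilpotent)
qed

text \<open>In the characteristic identity x^3 - t x^2 + s x - n = 0 the lowest nonzero coefficient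
  can be divided out; reducedness removes the powers of x that are left over. Then x y is an
  idempotent that fixes x, as needed for the search for a generator.\<close>

lemma df_von_neumann_regular:
  fixes x :: "'k::field ^ 3"
  assumes disc: "df_disc f \<noteq> 0"
  obtains y where "df_mult f (df_mult f x x) y = x"
proof -
  define t s n where "t = df_trace f x" and "s = trace (adj3 (df_mat f x))" and "n = df_norm f x"
  have ch: "df_mult f x (df_mult f x x - t *s x + s *s vone) = n *s vone"
    unfolding t_def s_def n_def by (rule df_char)
  consider "n \<noteq> 0" | "n = 0" "s \<noteq> 0" | "n = 0" "s = 0" "t \<noteq> 0" | "n = 0" "s = 0" "t = 0" by blast
  then have "\<exists>y. df_mult f (df_mult f x x) y = x"
  proof cases
    case 1
    then obtain y where "df_mult f x y = vone"
      using df_inverse n_def by metis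
    then show ?thesis by (metis df_mult_assoc df_mult_one(2))
  next
    case 2
    have e: "df_mult f (df_mult f x x) (x - t *s vone) = (- s) *s x"
      using ch 2 by (simp add: df_mult_add df_mult_diff df_mult_scale df_mult_ac eq_neg_iff_add_eq_0)
    have "df_mult f (df_mult f x x) ((- (1 / s)) *s (x - t *s vone)) = (- (1 / s)) *s ((- s) *s x)"
      unfolding df_mult_scale e ..
    also have "\<dots> = x" using 2 by (simp add: vec_eq_iff)
    finally show ?thesis by blast
  next
    case 3
    define w where "w = df_mult f x (x - t *s vone)"
    have "df_mult f x w = 0"
      using ch 3 by (simp add: w_def df_mult_diff df_mult_scale)
    moreover have "df_mult f w w = df_mult f (df_mult f x w) (x - t *s vone)"
      unfolding w_def by (simp only: df_mult_ac)
    ultimately have "df_mult f w w = 0" by simp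
    then have "w = 0" by (rule df_reduced[OF disc])
    then have "df_mult f x x = t *s x"
      by (simp add: w_def df_mult_diff df_mult_scale)
    then have "df_mult f (df_mult f x x) ((1 / t) *s vone) = x"
      using 3 by (simp add: df_mult_scale vec_eq_iff)
    then show ?thesis by blast
  next
    case 4
    have "df_mult f (df_mult f x x) (df_mult f x x) = df_mult f x (df_mult f x (df_mult f x x))"
      by (simp add: df_mult_assoc)
    also have "\<dots> = 0" using ch 4 by simp
    finally have "df_mult f x x = 0" by (rule df_reduced[OF disc])
    then have "x = 0" by (rule df_reduced[OF disc])
    then show ?thesis by simp
  qed
  then show thesis using that by blast
qed

section \<open>Row vectors as a module on which \<omega> and \<theta> act by matrices\<close>

definition act :: "'k::comm_ring_1 ^ 3 ^ 3 \<Rightarrow> 'k ^ 3 ^ 3 \<Rightarrow> 'k ^ 3 \<Rightarrow> 'k ^ 3 \<Rightarrow> 'k ^ 3" where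
  "act W Z x g = x$1 *s g + x$2 *s (g v* W) + x$3 *s (g v* Z)"

definition df_action :: "'k::comm_ring_1 cubic_form \<Rightarrow> 'k ^ 3 ^ 3 \<Rightarrow> 'k ^ 3 ^ 3 \<Rightarrow> bool" where
  "df_action f W Z \<longleftrightarrow> (\<forall>x y g. act W Z (df_mult f x y) g = act W Z x (act W Z y g))"

lemma vector_matrix_linear:
  fixes x y :: "'k::comm_ring_1 ^ 3"
  shows "(x + y) v* M = x v* M + y v* M" "(k *s x) v* M = k *s (x v* M)" "(x - y) v* M = x v* M - y v* M"
    "x v* (M + M') = x v* M + x v* M'" "x v* (M - M') = x v* M - x v* M'" "x v* (mat k ** M) = k *s (x v* M)"
    "x v* mat k = k *s x" "0 v* M = 0"
  by (simp_all add: mat3_simps algebra_simps)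

lemma df_actionI:
  assumes "W ** W = mat (- (a * c)) + mat b ** W - mat a ** Z"
    "Z ** Z = mat (- (b * d)) + mat d ** W - mat c ** Z"
    "W ** Z = mat (- (a * d))" "Z ** W = mat (- (a * d))"
  shows "df_action (a, b, c, d) W Z"
proof -
  have r: "(g v* W) v* W = (- (a * c)) *s g + b *s (g v* W) - a *s (g v* Z)"
    "(g v* Z) v* Z = (- (b * d)) *s g + d *s (g v* W) - c *s (g v* Z)"
    "(g v* W) v* Z = (- (a * d)) *s g" "(g v* Z) v* W = (- (a * d)) *s g" for g
    by (simp_all only: vector_matrix_mul_assoc assms vector_matrix_linear)
  have "act W Z (df_mult (a, b, c, d) x y) g = act W Z x (act W Z y g)" for x y g
    by (simp only: act_def vector_matrix_linear r) (simp add: df_mult_def vec_eq_iff algebra_simps)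
  then show ?thesis by (simp add: df_action_def)
qed

lemma act_linear:
  "act W Z x (g + h) = act W Z x g + act W Z x h" "act W Z (x + y) g = act W Z x g + act W Z y g"
  "act W Z (k *s x) g = k *s act W Z x g" "act W Z x 0 = 0" "act W Z 0 g = 0"
  by (simp_all add: act_def vector_matrix_linear) (simp_all add: vec_eq_iff algebra_simps)

lemma act_trace:
  "(\<Sum>i\<in>UNIV. act W Z z (axis i 1) $ i) = 3 * z$1 + trace W * z$2 + trace Z * z$3"
  by (simp add: act_def sum_3 vector_matrix_mult_def trace_def algebra_simps)

text \<open>With these traces of \<open>W\<close> and \<open>Z\<close>, every element has the same
  trace on the module as on the algebra. If x acts as zero, so does each y x, and the trace form
  annihilates x.\<close>

lemma act_faithful:
  fixes W :: "'k::field ^ 3 ^ 3"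
  assumes act: "df_action (a, b, c, d) W Z" and tr: "trace W = b" "trace Z = - c"
    and disc: "df_disc (a, b, c, d) \<noteq> 0" and x: "\<And>g. act W Z x g = 0"
  shows "x = 0"
proof (rule df_trace_nondegenerate[OF disc])
  fix y
  let ?z = "df_mult (a, b, c, d) y x"
  have "0 = (\<Sum>i\<in>UNIV. act W Z ?z (axis i 1) $ i)"
    using act x by (simp add: df_action_def act_linear)
  also have "\<dots> = df_trace (a, b, c, d) ?z"
    by (simp add: act_trace df_trace_eq tr)
  finally show "df_trace (a, b, c, d) ?z = 0" ..
qed

text \<open>Take \<open>g\<close> with the smallest annihilator. If this contains \<open>x \<noteq> 0\<close>, it contains an idempotent
  \<open>e \<noteq> 0\<close>, and \<open>g + e w\<close> has a smaller annihilator as soon as \<open>e w \<noteq> 0\<close>. This argument, unlike a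
  Zariski density argument, also covers finite fields.\<close>

lemma generator_exists:
  fixes W :: "'k::field ^ 3 ^ 3"
  assumes act: "df_action (a, b, c, d) W Z" and tr: "trace W = b" "trace Z = - c"
    and disc: "df_disc (a, b, c, d) \<noteq> 0"
  obtains g where "\<And>x. act W Z x g = 0 \<Longrightarrow> x = 0"
proof -
  define f where "f = (a, b, c, d)"
  have hom: "act W Z (df_mult f x y) g = act W Z x (act W Z y g)" for x y g
    using act by (simp add: df_action_def f_def)
  define Ann where "Ann g = {x. act W Z x g = 0}" for g
  have sub: "vec.subspace (Ann g)" for g
    by (simp add: vec.subspace_def Ann_def act_linear)
  obtain g where g: "\<And>h. vec.dim (Ann g) \<le> vec.dim (Ann h)"
    using ex_has_least_nat[of "\<lambda>_. True" _ "\<lambda>g. vec.dim (Ann g)"] by auto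
  have "x = 0" if "act W Z x g = 0" for x
  proof (rule ccontr)
    assume "x \<noteq> 0"
    obtain y where y: "df_mult f (df_mult f x x) y = x"
      using df_von_neumann_regular disc f_def by metis
    define e where "e = df_mult f x y"
    have ex: "df_mult f e x = x" using y by (simp add: e_def df_mult_ac)
    then have "e \<noteq> 0" using \<open>x \<noteq> 0\<close> by auto
    have ee: "df_mult f e e = e" using ex by (metis df_mult_assoc e_def)
    have eg: "act W Z e g = 0"
      using that by (simp add: e_def df_mult_commute[of f x] hom act_linear)
    obtain w where w: "act W Z e w \<noteq> 0"
      using act_faithful[OF act tr disc] \<open>e \<noteq> 0\<close> by blast
    define h where "h = g + act W Z e w"
    have "Ann h \<subseteq> Ann g"
    proof
      fix z assume "z \<in> Ann h"
      then have z: "act W Z z g + act W Z (df_mult f z e) w = 0"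
        by (simp add: Ann_def h_def act_linear hom)
      \<comment> \<open>Applying e separates the summands: it kills z g and, being idempotent, fixes
        z e w. So z e w = 0, and then z g = 0.\<close>
      then have "act W Z e (act W Z z g + act W Z (df_mult f z e) w) = 0"
        by (simp add: act_linear)
      then have "act W Z z (act W Z e g) + act W Z (df_mult f z e) w = 0"
        by (simp add: act_linear ee df_mult_left_commute[of f e z] df_mult_commute[of f e z] flip: hom)
      then show "z \<in> Ann g" using z eg by (simp add: act_linear Ann_def)
    qed
    moreover have "e \<in> Ann g" "e \<notin> Ann h"
      using eg w by (auto simp: Ann_def h_def act_linear ee simp flip: hom)
    ultimately have "Ann h \<subset> Ann g" by blast
    then have "vec.dim (Ann h) < vec.dim (Ann g)"
      using sub by (metis vec.dim_psubset vec.span_eq_iff)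
    with g show False by (simp add: leD)
  qed
  then show thesis by (rule that)
qed

section \<open>From a pair of matrices to a multiplication table\<close>

lemma matrix_mult_linear:
  fixes M N :: "'k::comm_ring_1 ^ 3 ^ 3"
  shows "(- M) ** N = - (M ** N)" "M ** (- N) = - (M ** N)"
    "(M + M') ** N = M ** N + M' ** N" "M ** (N + N') = M ** N + M ** N'"
    "(M - M') ** N = M ** N - M' ** N" "M ** (N - N') = M ** N - M ** N'"
  by (simp_all add: mat3_simps algebra_simps)

lemma adj3_mix3': "adj3 B ** A + mix3 A B ** B = mat (trace (A ** adj3 B))"
  by (simp add: mat3_simps mix3_def adj3_def algebra_simps)

lemma mat_uminus: "mat (- k) = - (mat k :: 'k::comm_ring_1 ^ 3 ^ 3)"
  by (simp add: vec_eq_iff mat_def)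

lemma adj3_transpose: "transpose (adj3 A) = adj3 (transpose A)"
  by (simp add: mat3_simps adj3_def algebra_simps)

lemma transpose_uminus: "transpose (- A) = - transpose A" and
  transpose_diff: "transpose (A - B) = transpose A - transpose B"
  by (simp_all add: transpose_def vec_eq_iff)

text \<open>The formulas come from solving the relations of \<open>table_action\<close> as if
  \<open>A\<close> and \<open>B\<close> were invertible: W A = - a B gives W = - B adj A, Z B = d A
  gives Z = - A adj B, and C = W B - b B becomes A mix(A, B) B. The results are polynomial, so they
  make sense for singular matrices too.\<close>

context
  fixes A B :: "'k::comm_ring_1 ^ 3 ^ 3" and a b c d :: 'k and W Z C :: "'k ^ 3 ^ 3"
  assumes form: "pair_form A B = (a, b, c, d)"
  defines "W \<equiv> - (B ** adj3 A)" and "Z \<equiv> - (A ** adj3 B)" and "C \<equiv> A ** mix3 A B ** B"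
begin

lemma pair_actions:
  shows "W ** A = mat (- a) ** B" "W ** B = C + mat b ** B" "Z ** B = mat d ** A" "Z ** A = C - mat c ** A"
proof -
  have a: "adj3 A ** A = mat a" and d: "adj3 B ** B = mat (- d)"
    and b: "A ** mix3 A B + B ** adj3 A = mat (- b)" and c: "adj3 B ** A + mix3 A B ** B = mat c"
    using form by (auto simp: pair_form_def adj3_left mix3_adj3 adj3_mix3')
  show "W ** A = mat (- a) ** B" "Z ** B = mat d ** A"
    by (simp_all add: W_def Z_def matrix_mult_linear mat_uminus mat_mult_commute a d flip: matrix_mul_assoc)
  have "B ** adj3 A = - (A ** mix3 A B) + mat (- b)"
    unfolding b[symmetric] by simp
  then show "W ** B = C + mat b ** B"
    by (simp add: W_def C_def matrix_mult_linear mat_uminus)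
  have "A ** (adj3 B ** A) = A ** mat c - C"
    unfolding c[symmetric] by (simp add: C_def matrix_mult_linear matrix_mul_assoc)
  then show "Z ** A = C - mat c ** A"
    by (simp add: Z_def matrix_mult_linear mat_mult_commute flip: matrix_mul_assoc)
qed

text \<open>\<open>W\<close> ends in \<open>adj3 A\<close> and \<open>Z\<close> in
  \<open>adj3 B\<close>. Multiplying \<open>pair_actions\<close> on the right by these adjugates
  expresses each product without ever cancelling \<open>A\<close> or \<open>B\<close>.\<close>

lemma pair_action_products:
  shows "W ** W = mat (- (a * c)) + mat b ** W - mat a ** Z"
    "Z ** Z = mat (- (b * d)) + mat d ** W - mat c ** Z"
    "W ** Z = mat (- (a * d))" "Z ** W = mat (- (a * d))"
proof -
  have a: "A ** adj3 A = mat a" and d: "B ** adj3 B = mat (- d)"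
    using form by (auto simp: pair_form_def adj3_right)
  have W: "M ** W = - (M ** B ** adj3 A)" and Z: "M ** Z = - (M ** A ** adj3 B)" for M :: "'k ^ 3 ^ 3"
    by (simp_all add: W_def Z_def matrix_mult_linear matrix_mul_assoc)
  have CA: "C ** adj3 A = mat a ** Z + mat (a * c)"
  proof -
    have "C = Z ** A + mat c ** A" using pair_actions(4) by simp
    then have "C ** adj3 A = Z ** mat a + mat c ** mat a"
      by (simp add: matrix_mult_linear a flip: matrix_mul_assoc)
    then show ?thesis by (simp add: mat_mult_commute[of a] mat_mat mult.commute)
  qed
  have CB: "C ** adj3 B = mat (- d) ** W + mat (b * d)"
  proof -
    have "C = W ** B - mat b ** B" using pair_actions(2) by simp
    then have "C ** adj3 B = W ** mat (- d) - mat b ** mat (- d)"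
      by (simp add: matrix_mult_linear d flip: matrix_mul_assoc)
    then show ?thesis by (simp add: mat_mult_commute[of d] mat_mat mat_uminus matrix_mult_linear)
  qed
  have "W ** W = - (C ** adj3 A) - mat b ** (B ** adj3 A)"
    unfolding W[of W] by (simp add: pair_actions(2) matrix_mult_linear matrix_mul_assoc)
  also have "mat b ** (B ** adj3 A) = - (mat b ** W)"
    by (simp add: W_def matrix_mult_linear)
  finally show "W ** W = mat (- (a * c)) + mat b ** W - mat a ** Z"
    by (simp add: CA mat_uminus)
  have "Z ** Z = - (C ** adj3 B) + mat c ** (A ** adj3 B)"
    unfolding Z[of Z] by (simp add: pair_actions(4) matrix_mult_linear matrix_mul_assoc)
  also have "mat c ** (A ** adj3 B) = - (mat c ** Z)"
    by (simp add: Z_def matrix_mult_linear)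
  finally show "Z ** Z = mat (- (b * d)) + mat d ** W - mat c ** Z"
    by (simp add: CB mat_uminus matrix_mult_linear)
  show "W ** Z = mat (- (a * d))"
    by (subst Z) (simp add: pair_actions(1) d mat_mat mat_uminus matrix_mult_linear flip: matrix_mul_assoc)
  show "Z ** W = mat (- (a * d))"
    by (subst W) (simp add: pair_actions(3) a mat_mat mat_uminus matrix_mult_linear mult.commute flip: matrix_mul_assoc)
qed

lemma pair_action_df: "df_action (a, b, c, d) W Z"
  by (rule df_actionI[OF pair_action_products])

text \<open>These are the traces of \<omega> and \<theta> in the regular representation, as required
  for faithfulness.\<close>

lemma pair_action_trace: "trace W = b" "trace Z = - c"
proof -
  have "trace (- M) = - trace M" for M :: "'k ^ 3 ^ 3" by (simp add: trace_def sum_negf)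
  then show "trace W = b" "trace Z = - c"
    using form trace_mul_sym[of B "adj3 A"] by (auto simp: W_def Z_def pair_form_def)
qed

text \<open>The coefficients of 1 in \<omega> (C + B \<omega> + A \<theta>) and \<theta> (C + B
  \<omega> + A \<theta>). Together with \<open>pair_actions\<close>, all three coordinates of the
  table are compatible with the action.\<close>

lemma pair_table_products:
  "W ** C = mat (- (a * c)) ** B + mat (- (a * d)) ** A"
  "Z ** C = mat (- (a * d)) ** B + mat (- (b * d)) ** A"
proof -
  have C: "C = W ** B - mat b ** B" "C = Z ** A + mat c ** A"
    using pair_actions by simp_all
  have "W ** C = W ** W ** B - mat b ** W ** B"
    by (simp add: C(1) matrix_mult_linear matrix_mul_assoc mat_mult_commute[of b W])
  also have "\<dots> = mat (- (a * c)) ** B - mat a ** (Z ** B)"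
    by (simp add: pair_action_products matrix_mult_linear matrix_mul_assoc)
  finally show "W ** C = mat (- (a * c)) ** B + mat (- (a * d)) ** A"
    by (simp add: pair_actions(3) matrix_mul_assoc mat_mat mat_uminus matrix_mult_linear)
  have "Z ** C = Z ** Z ** A + mat c ** Z ** A"
    by (simp add: C(2) matrix_mult_linear matrix_mul_assoc mat_mult_commute[of c Z])
  also have "\<dots> = mat (- (b * d)) ** A + mat d ** (W ** A)"
    by (simp add: pair_action_products matrix_mult_linear matrix_mul_assoc)
  finally show "Z ** C = mat (- (a * d)) ** B + mat (- (b * d)) ** A"
    by (simp add: pair_actions(1) matrix_mul_assoc mat_mat mat_uminus matrix_mult_linear mult.commute)
qed

text \<open>Not visible in the definition of \<open>C\<close>, but clear from C = - B adj(A) B - b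
  B.\<close>

lemma pair_table_symmetric:
  assumes "transpose A = A" "transpose B = B"
  shows "transpose C = C"
proof -
  have "C = W ** B - mat b ** B" using pair_actions(2) by simp
  then show ?thesis
    using assms by (simp add: W_def matrix_mult_linear transpose_diff transpose_uminus
        matrix_transpose_mul adj3_transpose matrix_mul_assoc transpose_mat mat_mult_commute)
qed

end

text \<open>A generator g of the module identifies it with the algebra. The table is then a
  symmetric map bilinear over the algebra, hence multiplication followed by a fixed factor q, and
  \<delta> is the inverse of q.\<close>

lemma table_exists:
  fixes A B :: "'k::field ^ 3 ^ 3"
  assumes sym: "transpose A = A" "transpose B = B" and disc: "df_disc (pair_form A B) \<noteq> 0"
  defines "f \<equiv> pair_form A B"
  obtains \<alpha> \<delta> where "has_table f \<alpha> \<delta> (A ** mix3 A B ** B) B A" "det \<alpha> \<noteq> 0" "df_norm f \<delta> = (det \<alpha>)\<^sup>2"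
    "\<And>i. df_mult f (axis 2 1) (\<alpha> $ i) = (- (B ** adj3 A)) $ i v* \<alpha>"
    "\<And>i. df_mult f (axis 3 1) (\<alpha> $ i) = (- (A ** adj3 B)) $ i v* \<alpha>"
proof -
  obtain a b c d where form: "pair_form A B = (a, b, c, d)" by (cases "pair_form A B")
  then have f: "f = (a, b, c, d)" by (simp add: f_def)
  define W Z C where "W = - (B ** adj3 A)" and "Z = - (A ** adj3 B)" and "C = A ** mix3 A B ** B"
  note defs = W_def[symmetric] Z_def[symmetric] C_def[symmetric]
  note act = pair_actions[OF form, unfolded defs] and df = pair_action_df[OF form, unfolded defs]
    and tr = pair_action_trace[OF form, unfolded defs] and tab = pair_table_products[OF form, unfolded defs]
    and Csym = pair_table_symmetric[OF form sym, unfolded defs]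
  obtain g where g: "\<And>x. act W Z x g = 0 \<Longrightarrow> x = 0"
    using generator_exists[OF df tr] disc form by metis
  \<comment> \<open>The rows are g, \<omega> g and \<theta> g, so \<open>x v* N\<close> is x g. The
    rows of the inverse matrix \<alpha> are therefore the algebra elements that carry g to the
    standard basis vectors.\<close>
  define N :: "'k ^ 3 ^ 3" where "N = vector [g, g v* W, g v* Z]"
  have N: "x v* N = act W Z x g" for x
    by (simp add: N_def act_def vector_matrix_rows)
  have "inj ((*v) (transpose N))"
  proof (rule injI)
    fix x y assume "transpose N *v x = transpose N *v y"
    then have "(x - y) v* N = 0" by (simp add: vector_matrix_linear)
    then show "x = y" using g N by fastforce
  qed
  then obtain R where "R ** transpose N = mat 1"
    using matrix_left_invertible_injective by blast
  then have "det R * det N = 1" by (metis det_I det_mul det_transpose)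
  then have "det N \<noteq> 0" by auto
  then obtain \<alpha> where \<alpha>: "N ** \<alpha> = mat 1" "\<alpha> ** N = mat 1"
    using invertible_det_nz[of N] by (auto simp: invertible_def)
  have det\<alpha>: "det \<alpha> \<noteq> 0"
    using \<alpha>(1) by (metis det_I det_mul mult_zero_right zero_neq_one)
  have ax: "act W Z (\<alpha> $ i) g = axis i 1" for i
  proof -
    have "act W Z (\<alpha> $ i) g = (\<alpha> ** N) $ i" by (simp add: row_matrix_mult N)
    then show ?thesis by (simp add: \<alpha>(2) mat_def axis_def vec_eq_iff)
  qed
  have hom: "act W Z (df_mult f x y) h = act W Z x (act W Z y h)" for x y h
    using df by (simp add: df_action_def f)
  have act_axis: "act W Z (axis 2 1) h = h v* W" "act W Z (axis 3 1) h = h v* Z" for h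
    by (simp_all add: act_def)
  have rows: "(axis i 1 v* M) v* \<alpha> = M $ i v* \<alpha>" for i and M :: "'k ^ 3 ^ 3"
  proof -
    have "axis i 1 v* M = M $ i"
      by (simp add: vector_matrix_mult_def axis_def vec_eq_iff if_distrib[of "\<lambda>x. x * _"] cong: if_cong)
    then show ?thesis by simp
  qed
  have cancel: "x = y v* \<alpha>" if "act W Z x g = y" for x y
    using that by (simp flip: N) (metis \<alpha>(1) vector_matrix_mul_assoc vector_matrix_mul_rid)
  have mul: "df_mult f (axis 2 1) (\<alpha> $ i) = W $ i v* \<alpha>" "df_mult f (axis 3 1) (\<alpha> $ i) = Z $ i v* \<alpha>" for i
    using cancel[of "df_mult f (axis 2 1) (\<alpha> $ i)"] cancel[of "df_mult f (axis 3 1) (\<alpha> $ i)"]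
    by (simp_all add: hom ax act_axis rows)
  \<comment> \<open>\<open>Q\<close> is the bilinear map with table (C, B, A). As it commutes with
    \<omega> and \<theta> in the first argument and is symmetric, Q(x g, y g) = x y Q(g, g).\<close>
  define dot where "dot x y = (\<Sum>k\<in>UNIV. x $ k * y $ k)" for x y :: "'k ^ 3"
  define Q :: "'k ^ 3 \<Rightarrow> 'k ^ 3 \<Rightarrow> 'k ^ 3" where "Q x y = vector [dot (x v* C) y, dot (x v* B) y, dot (x v* A) y]" for x y
  have dot: "dot (x + x') y = dot x y + dot x' y" "dot (x - x') y = dot x y - dot x' y"
    "dot (k *s x) y = k * dot x y" for x x' y k
    by (simp_all add: dot_def sum_3 algebra_simps)
  have dot_sym: "dot (x v* M) y = dot (y v* M) x" if "transpose M = M" for M x y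
  proof -
    have "M $ i $ j = M $ j $ i" for i j
      using that[unfolded vec_eq_iff] by (simp add: transpose_def)
    then show ?thesis
      by (simp add: dot_def sum_3 vector_matrix_mult_def algebra_simps)
  qed
  have Q_sym: "Q x y = Q y x" for x y
    using dot_sym sym Csym by (simp add: Q_def)
  have Qact: "Q (act W Z z x) y = df_mult f z (Q x y)" for x y z
  proof -
    have "Q (x v* W) y = df_mult f (axis 2 1) (Q x y)" "Q (x v* Z) y = df_mult f (axis 3 1) (Q x y)"
      by (simp_all only: Q_def vector_matrix_mul_assoc act tab vector_matrix_linear dot)
        (simp_all add: f df_mult_def vec_eq_iff forall_3)
    moreover have "Q (x + x') y = Q x y + Q x' y" "Q (k *s x) y = k *s Q x y" for x x' k
      by (simp_all add: Q_def vector_matrix_linear dot vec_eq_iff forall_3)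
    ultimately have "Q (act W Z z x) y = z$1 *s df_mult f vone (Q x y) + z$2 *s df_mult f (axis 2 1) (Q x y)
        + z$3 *s df_mult f (axis 3 1) (Q x y)"
      by (simp add: act_def)
    also have "\<dots> = df_mult f (z$1 *s vone + z$2 *s axis 2 1 + z$3 *s axis 3 1) (Q x y)"
      by (simp only: df_mult_add df_mult_scale)
    also have "z$1 *s vone + z$2 *s axis 2 1 + z$3 *s axis 3 1 = z"
      by (simp add: vec_eq_iff forall_3)
    finally show ?thesis .
  qed
  define q where "q = Q g g"
  have tabq: "df_mult f q (df_mult f (\<alpha>$i) (\<alpha>$j)) = table C B A i j" for i j
  proof -
    have "table C B A i j = Q (axis i 1) (axis j 1)"
      by (simp add: vec_eq_iff forall_3 Q_def dot_def vector_matrix_mult_def axis_def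
          if_distrib[of "\<lambda>x. x * _"] if_distrib[of "\<lambda>x. _ * x"] cong: if_cong)
    also have "\<dots> = df_mult f (\<alpha>$i) (df_mult f (\<alpha>$j) q)"
      unfolding ax[symmetric] Qact by (subst Q_sym) (simp add: Qact q_def)
    finally show ?thesis by (simp add: df_mult_ac)
  qed
  \<comment> \<open>The form of the table is f times N(q) det(\<alpha>)^2, but f was taken to be the
    form of the pair. The factor is therefore 1, which gives both the invertibility of q and the
    norm of \<delta>.\<close>
  have "f = form_scale (df_norm f q * (det \<alpha>)\<^sup>2) f"
    using pair_form_table_inverse[OF tabq] by (simp add: f_def)
  moreover have "f \<noteq> (0, 0, 0, 0)" using disc by (auto simp: f_def[symmetric] df_disc_def)
  ultimately have nq: "df_norm f q * (det \<alpha>)\<^sup>2 = 1"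
    unfolding f form_scale_def by auto
  then obtain \<delta> where \<delta>: "df_mult f q \<delta> = vone"
    using df_inverse[of f q] by (metis mult_zero_left zero_neq_one)
  have "has_table f \<alpha> \<delta> C B A"
    unfolding has_table_def
  proof (intro allI)
    fix i j
    have "df_mult f \<delta> (table C B A i j) = df_mult f (df_mult f q \<delta>) (df_mult f (\<alpha>$i) (\<alpha>$j))"
      by (simp add: df_mult_ac flip: tabq)
    then show "df_mult f (\<alpha>$i) (\<alpha>$j) = df_mult f \<delta> (table C B A i j)" by (simp add: \<delta>)
  qed
  moreover have "df_norm f \<delta> = (det \<alpha>)\<^sup>2"
    using nq df_norm_unit[OF \<delta>] by (metis mult.commute mult.left_commute mult_1)
  ultimately show thesis
    using that det\<alpha> mul unfolding W_def Z_def C_def by blast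
qed

section \<open>Normalized bases\<close>

definition cubic_product :: "('k::comm_ring_1 ^ 3 \<Rightarrow> 'k ^ 3 \<Rightarrow> 'k ^ 3) \<Rightarrow> bool" where
  "cubic_product \<mu> \<longleftrightarrow> (\<forall>x y z. \<mu> (x + y) z = \<mu> x z + \<mu> y z) \<and> (\<forall>k x y. \<mu> (k *s x) y = k *s \<mu> x y) \<and>
     (\<forall>x y. \<mu> x y = \<mu> y x) \<and> (\<forall>x y z. \<mu> (\<mu> x y) z = \<mu> x (\<mu> y z)) \<and> (\<forall>x. \<mu> vone x = x)"

lemma cubic_product_df: "cubic_product (df_mult f)"
  by (simp add: cubic_product_def df_mult_add df_mult_scale df_mult_assoc df_mult_commute[of f])

lemma cubic_product_transport:
  assumes "cubic_product \<mu>" "G ** G' = mat 1" "G' ** G = mat 1" "G *v vone = vone"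
  shows "cubic_product (\<lambda>x y. G' *v \<mu> (G *v x) (G *v y))"
proof -
  have "G *v (G' *v x) = x" "G' *v (G *v x) = x" for x
    using assms(2,3) by (simp_all add: matrix_vector_mul_assoc)
  moreover have "M *v (k *s x) = k *s (M *v x)" for M :: "'a ^ 3 ^ 3" and k x
    by (simp add: mat3_simps algebra_simps)
  moreover have "\<mu> (x + y) z = \<mu> x z + \<mu> y z" "\<mu> (k *s x) y = k *s \<mu> x y"
    "\<mu> vone x = x" "\<mu> (\<mu> x y) z = \<mu> x (\<mu> y z)" for x y z k
    using assms(1) unfolding cubic_product_def by metis+
  moreover have "\<mu> x y = \<mu> y x" for x y
    using assms(1) unfolding cubic_product_def by metis
  ultimately show ?thesis
    unfolding cubic_product_def using assms(4)
    by (intro conjI allI) (simp_all only: matrix_vector_right_distrib, metis)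
qed

text \<open>Associativity forces the constant coefficients of the multiplication table.\<close>

lemma cubic_product_normalized:
  assumes \<mu>: "cubic_product \<mu>" and "\<mu> (axis 2 1) (axis 3 1) $ 2 = 0" "\<mu> (axis 2 1) (axis 3 1) $ 3 = 0"
  obtains f where "\<mu> = df_mult f"
proof -
  have add: "\<mu> (x + y) z = \<mu> x z + \<mu> y z" "\<mu> z (x + y) = \<mu> z x + \<mu> z y"
    and scale: "\<mu> (k *s x) y = k *s \<mu> x y" "\<mu> y (k *s x) = k *s \<mu> y x"
    and one: "\<mu> vone x = x" "\<mu> x vone = x" and comm: "\<mu> x y = \<mu> y x"
    and assoc: "\<mu> (\<mu> x y) z = \<mu> x (\<mu> y z)" for x y z k
    using \<mu> unfolding cubic_product_def by metis+
  have basis: "x = x$1 *s vone + x$2 *s axis 2 1 + x$3 *s axis 3 1" for x :: "'a ^ 3"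
    by (simp add: vec_eq_iff forall_3)
  have vec: "x = vector [x$1, x$2, x$3]" for x :: "'a ^ 3"
    by (simp add: vec_eq_iff forall_3)
  obtain m b a where 22: "\<mu> (axis 2 1) (axis 2 1) = vector [m, b, - a]"
    using vec by (metis minus_minus)
  obtain l d c where 33: "\<mu> (axis 3 1) (axis 3 1) = vector [l, d, - c]"
    using vec by (metis minus_minus)
  obtain n where 23: "\<mu> (axis 2 1) (axis 3 1) = n *s vone"
  proof
    show "\<mu> (axis 2 1) (axis 3 1) = \<mu> (axis 2 1) (axis 3 1) $ 1 *s vone"
      using assms(2,3) by (simp add: vec_eq_iff forall_3)
  qed
  have bil: "\<mu> x y = (x$1 * y$1 + n * (x$2 * y$3 + x$3 * y$2)) *s vone
      + (x$1 * y$2 + x$2 * y$1) *s axis 2 1 + (x$1 * y$3 + x$3 * y$1) *s axis 3 1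
      + (x$2 * y$2) *s vector [m, b, - a] + (x$3 * y$3) *s vector [l, d, - c]" for x y
    by (subst basis[of x], subst basis[of y])
      (simp add: add scale one 22 33 23 comm[of "axis 3 1" "axis 2 1"], simp add: vec_eq_iff algebra_simps)
  have "\<mu> (\<mu> (axis 2 1) (axis 2 1)) (axis 3 1) = \<mu> (axis 2 1) (n *s vone)"
    by (simp add: assoc 23)
  then have "n = - (a * d)" "m = - (a * c)"
    unfolding 22 bil vec_eq_iff forall_3 by (simp_all add: eq_neg_iff_add_eq_0)
  moreover have "\<mu> (\<mu> (axis 3 1) (axis 3 1)) (axis 2 1) = \<mu> (axis 3 1) (n *s vone)"
    by (simp add: assoc 23 comm[of "axis 3 1" "axis 2 1"])
  then have "l = - (b * d)"
    unfolding 33 bil vec_eq_iff forall_3 by (simp add: eq_neg_iff_add_eq_0 mult.commute)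
  ultimately have "\<mu> = df_mult (a, b, c, d)"
    by (intro ext, subst bil) (simp add: df_mult_def vec_eq_iff forall_3 algebra_simps)
  then show thesis by (rule that)
qed

text \<open>If \<omega> \<theta> = n + s \<omega> + t \<theta>, then (\<omega> - t) (\<theta> - s)
  is the constant n + s t. The translation changes only the first coordinate, and this is recorded
  because it means that \<open>A\<close> and \<open>B\<close> stay the same.\<close>

lemma cubic_product_normalize:
  fixes \<mu> :: "'k::comm_ring_1 ^ 3 \<Rightarrow> 'k ^ 3 \<Rightarrow> 'k ^ 3"
  assumes \<mu>: "cubic_product \<mu>"
  obtains U f where "invertible U" "U *v vone = vone" "\<And>x. (U *v x) $ 2 = x $ 2" "\<And>x. (U *v x) $ 3 = x $ 3"
    "\<And>x y. U *v \<mu> x y = df_mult f (U *v x) (U *v y)"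
proof -
  define s t where "s = \<mu> (axis 2 1) (axis 3 1) $ 2" and "t = \<mu> (axis 2 1) (axis 3 1) $ 3"
  define U U' :: "'k ^ 3 ^ 3" where "U = vector [vector [1, t, s], vector [0, 1, 0], vector [0, 0, 1]]"
    and "U' = vector [vector [1, - t, - s], vector [0, 1, 0], vector [0, 0, 1]]"
  have UU: "U ** U' = mat 1" "U' ** U = mat 1"
    by (simp_all add: U_def U'_def mat3_simps)
  have Unth: "(U *v x) $ 1 = x $ 1 + t * x $ 2 + s * x $ 3" "(U *v x) $ 2 = x $ 2" "(U *v x) $ 3 = x $ 3" for x
    by (simp_all add: U_def mat3_simps)
  have U1: "U *v vone = vone" and U'1: "U' *v vone = vone"
    by (simp_all add: U_def U'_def mat3_simps)
  define \<nu> where "\<nu> x y = U *v \<mu> (U' *v x) (U' *v y)" for x y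
  have \<nu>: "cubic_product \<nu>"
    unfolding \<nu>_def[abs_def] by (rule cubic_product_transport[OF \<mu> UU(2,1) U'1])
  have add: "\<mu> (x + y) z = \<mu> x z + \<mu> y z" "\<mu> z (x + y) = \<mu> z x + \<mu> z y"
    and scale: "\<mu> (k *s x) y = k *s \<mu> x y" "\<mu> y (k *s x) = k *s \<mu> y x"
    and one: "\<mu> vone x = x" "\<mu> x vone = x" for x y z k
    using \<mu> unfolding cubic_product_def by metis+
  have "U' *v axis 2 1 = axis 2 1 + (- t) *s vone" "U' *v axis 3 1 = axis 3 1 + (- s) *s vone"
    by (simp_all add: U'_def mat3_simps)
  then have 23: "\<mu> (U' *v axis 2 1) (U' *v axis 3 1)
      = \<mu> (axis 2 1) (axis 3 1) + (- s) *s axis 2 1 + (- t) *s (axis 3 1 + (- s) *s vone)"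
    by (simp only: add scale one) (simp add: vec_eq_iff algebra_simps)
  have "\<nu> (axis 2 1) (axis 3 1) $ 2 = 0" "\<nu> (axis 2 1) (axis 3 1) $ 3 = 0"
    unfolding \<nu>_def 23 Unth by (simp_all add: s_def t_def)
  then obtain f where f: "\<nu> = df_mult f"
    by (rule cubic_product_normalized[OF \<nu>])
  have "U *v \<mu> x y = df_mult f (U *v x) (U *v y)" for x y
    unfolding f[symmetric] \<nu>_def by (simp add: matrix_vector_mul_assoc UU)
  moreover have "invertible U" using UU by (auto simp: invertible_def)
  ultimately show thesis using that U1 Unth by blast
qed

section \<open>Passage to the fraction field\<close>

definition vfract :: "'a::idom ^ 3 \<Rightarrow> 'a fract ^ 3" where
  "vfract x = (\<chi> i. to_fract (x $ i))"

definition mfract :: "'a::idom ^ 3 ^ 3 \<Rightarrow> 'a fract ^ 3 ^ 3" where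
  "mfract M = (\<chi> i. vfract (M $ i))"

definition ffract :: "'a::idom cubic_form \<Rightarrow> 'a fract cubic_form" where
  "ffract = (\<lambda>(a, b, c, d). (to_fract a, to_fract b, to_fract c, to_fract d))"

lemma vfract_nth [simp]: "vfract x $ i = to_fract (x $ i)"
  by (simp add: vfract_def)

lemma mfract_nth [simp]: "mfract M $ i = vfract (M $ i)"
  by (simp add: mfract_def)

lemma vfract_inj [simp]: "vfract x = vfract y \<longleftrightarrow> x = y"
  by (simp add: vec_eq_iff)

lemma ffract_inj [simp]: "ffract f = ffract g \<longleftrightarrow> f = g"
  by (cases f, cases g) (simp add: ffract_def)

lemma to_fract_sum: "to_fract (\<Sum>i\<in>I. g i) = (\<Sum>i\<in>I. to_fract (g i))"
  by (induction I rule: infinite_finite_induct) auto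

lemma to_fract_power: "to_fract (x ^ n) = to_fract x ^ n"
  by (induction n) auto

lemma vfract_simps [simp]:
  "vfract (x + y) = vfract x + vfract y" "vfract (x - y) = vfract x - vfract y"
  "vfract (k *s x) = to_fract k *s vfract x" "vfract (axis i k) = axis i (to_fract k)" "vfract 0 = 0"
  by (simp_all add: vec_eq_iff axis_def)

lemma mfract_simps [simp]:
  "mfract (M + N) = mfract M + mfract N" "mfract (M - N) = mfract M - mfract N" "mfract (- M) = - mfract M"
  "mfract (transpose M) = transpose (mfract M)" "mfract (mat k) = mat (to_fract k)"
  by (simp_all add: vec_eq_iff transpose_def mat_def)

lemma mfract_mult: "mfract (M ** N) = mfract M ** mfract N"
  by (simp add: vec_eq_iff matrix_matrix_mult_def to_fract_sum)

lemma vfract_vector_matrix: "vfract (x v* M) = vfract x v* mfract M"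
  by (simp add: vec_eq_iff vector_matrix_mult_def to_fract_sum)

lemma vfract_matrix_vector: "vfract (M *v x) = mfract M *v vfract x"
  by (simp add: vec_eq_iff matrix_vector_mult_def to_fract_sum)

lemma det_mfract: "det (mfract M) = to_fract (det M)"
  by (simp add: det_3)

lemma mfract_adj3: "mfract (adj3 M) = adj3 (mfract M)"
  by (simp add: vec_eq_iff forall_3 adj3_def)

lemma mfract_mix3: "mfract (mix3 M N) = mix3 (mfract M) (mfract N)"
  by (simp add: mix3_def mfract_adj3)

lemma trace_mfract: "trace (mfract M) = to_fract (trace M)"
  by (simp add: trace_def sum_3)

lemma vfract_df_mult: "vfract (df_mult f x y) = df_mult (ffract f) (vfract x) (vfract y)"
  by (cases f) (simp add: vec_eq_iff forall_3 df_mult_def ffract_def)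

lemma pair_form_mfract: "pair_form (mfract A) (mfract B) = ffract (pair_form A B)"
  by (simp add: pair_form_def ffract_def det_mfract trace_mfract flip: mfract_adj3 mfract_mult)

lemma form_scale_ffract: "form_scale (to_fract k) (ffract f) = ffract (form_scale k f)"
  by (cases f) (simp add: form_scale_def ffract_def)

lemma to_fract_numeral: "to_fract (numeral n) = numeral n"
  by (induction n) (simp_all only: numeral.simps to_fract_add to_fract_1)

lemma df_disc_ffract: "df_disc (ffract f) = to_fract (df_disc f)"
  by (cases f) (simp add: df_disc_def ffract_def to_fract_power to_fract_numeral)

lemma vfract_table: "vfract (table C B A i j) = table (mfract C) (mfract B) (mfract A) i j"
  by (simp add: vec_eq_iff forall_3)

lemma common_denominator:
  fixes z :: "'a::idom fract ^ 3"
  obtains t x where "t \<noteq> 0" "to_fract t *s z = vfract x"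
proof -
  have "\<exists>a s. s \<noteq> 0 \<and> w = to_fract a / to_fract s" for w :: "'a fract"
    by (cases w rule: Fract_cases) (auto simp: Fract_conv_to_fract)
  then have "\<forall>i. \<exists>a s. s \<noteq> 0 \<and> z $ i = to_fract a / to_fract s" by blast
  then obtain a s where s: "\<And>i. s i \<noteq> 0" "\<And>i. z $ i = to_fract (a i) / to_fract (s i)"
    by metis
  have "to_fract (s 1 * s 2 * s 3) *s z
      = vfract (vector [a 1 * s 2 * s 3, a 2 * s 1 * s 3, a 3 * s 1 * s 2])"
    using s(1) by (simp add: vec_eq_iff forall_3 s(2) field_simps)
  then show thesis using that[of "s 1 * s 2 * s 3"] s(1) by simp
qed

lemma common_denominator_matrix:
  fixes Z :: "'a::idom fract ^ 3 ^ 3"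
  obtains t M where "t \<noteq> 0" "\<And>i. to_fract t *s (Z $ i) = vfract (M $ i)"
proof -
  have "\<forall>i. \<exists>s x. s \<noteq> 0 \<and> to_fract s *s (Z $ i) = vfract x"
    using common_denominator by metis
  then obtain s x where s: "\<And>i. s i \<noteq> 0" "\<And>i. to_fract (s i) *s (Z $ i) = vfract (x i)"
    by metis
  define M :: "'a ^ 3 ^ 3" where "M = vector [(s 2 * s 3) *s x 1, (s 1 * s 3) *s x 2, (s 1 * s 2) *s x 3]"
  have "to_fract (x i $ k) = to_fract (s i) * Z $ i $ k" for i k
    using s(2)[of i] by (simp add: vec_eq_iff)
  then have "to_fract (s 1 * s 2 * s 3) *s (Z $ i) = vfract (M $ i)" for i
    using exhaust_3[of i] by (auto simp: M_def vec_eq_iff ac_simps)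
  then show thesis using that[of "s 1 * s 2 * s 3"] s(1) by simp
qed

section \<open>Isomorphisms between cubic rings and their base change\<close>

definition df_iso :: "'k::comm_ring_1 cubic_form \<Rightarrow> 'k cubic_form \<Rightarrow> 'k ^ 3 ^ 3 \<Rightarrow> bool" where
  "df_iso f f' H \<longleftrightarrow> invertible H \<and> H *v vone = vone \<and>
     (\<forall>x y. H *v df_mult f x y = df_mult f' (H *v x) (H *v y))"

lemma df_isoD:
  assumes "df_iso f f' H"
  shows "H *v df_mult f x y = df_mult f' (H *v x) (H *v y)" "H *v vone = vone" "invertible H"
  using assms by (simp_all add: df_iso_def)

lemma df_iso_comp: "df_iso f f' H \<Longrightarrow> df_iso f' f'' H' \<Longrightarrow> df_iso f f'' (H' ** H)"
  by (simp add: df_iso_def invertible_mult' flip: matrix_vector_mul_assoc)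

lemma df_iso_inverse:
  assumes "df_iso f f' H" "H ** H' = mat 1" "H' ** H = mat 1"
  shows "df_iso f' f H'"
proof -
  have i: "H *v (H' *v x) = x" "H' *v (H *v x) = x" for x
    using assms(2,3) by (simp_all add: matrix_vector_mul_assoc)
  have "H' *v df_mult f' x y = df_mult f (H' *v x) (H' *v y)" for x y
    by (metis df_isoD(1)[OF assms(1)] i)
  moreover have "H' *v vone = vone" by (metis df_isoD(2)[OF assms(1)] i(2))
  ultimately show ?thesis using assms(2,3) by (auto simp: df_iso_def invertible_def)
qed

lemma matrix_vector_scale: "M *v (k *s x) = k *s (M *v x)" for M :: "'k::comm_ring_1 ^ 3 ^ 3"
  by (simp add: mat3_simps algebra_simps)

lemma df_iso_fract:
  assumes "df_iso f f' H"
  shows "df_iso (ffract f) (ffract f') (mfract H)"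
proof -
  obtain H' where "H ** H' = mat 1" "H' ** H = mat 1"
    using df_isoD(3)[OF assms] by (auto simp: invertible_def)
  then have "mfract H ** mfract H' = mat 1" "mfract H' ** mfract H = mat 1"
    by (simp_all flip: mfract_mult)
  moreover have "mfract H *v vone = vone"
    using vfract_matrix_vector[of H vone] df_isoD(2)[OF assms] by simp
  moreover have "mfract H *v df_mult (ffract f) x y = df_mult (ffract f') (mfract H *v x) (mfract H *v y)" for x y
  proof -
    obtain s x' where s: "s \<noteq> 0" "to_fract s *s x = vfract x'" using common_denominator .
    obtain t y' where t: "t \<noteq> 0" "to_fract t *s y = vfract y'" using common_denominator .
    have "mfract H *v df_mult (ffract f) (vfract x') (vfract y')
        = df_mult (ffract f') (mfract H *v vfract x') (mfract H *v vfract y')"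
      by (simp add: df_isoD(1)[OF assms] flip: vfract_df_mult vfract_matrix_vector)
    then show ?thesis
      using s(1) t(1) by (simp add: df_mult_scale matrix_vector_scale flip: s(2) t(2))
  qed
  ultimately show ?thesis by (auto simp: df_iso_def invertible_def)
qed

lemma df_iso_norm:
  assumes "df_iso f f' H"
  shows "df_norm f' (H *v x) = df_norm f x"
proof -
  obtain H' where H': "H ** H' = mat 1"
    using df_isoD(3)[OF assms] by (auto simp: invertible_def)
  have "df_mat f' (H *v x) ** H = H ** df_mat f x"
    by (simp add: matrix_eq df_mat_vector df_isoD(1)[OF assms] flip: matrix_vector_mul_assoc)
  then have e: "det (df_mat f' (H *v x)) * det H = det H * det (df_mat f x)"
    by (metis det_mul)
  have one: "det H * det H' = 1" by (simp add: H' flip: det_mul)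
  have "det (df_mat f' (H *v x)) = det (df_mat f' (H *v x)) * det H * det H'"
    by (simp add: one mult.assoc)
  also have "\<dots> = det (df_mat f x) * (det H * det H')"
    unfolding e by (simp only: ac_simps)
  finally show ?thesis by (simp add: df_norm_def one)
qed

section \<open>Lattices in cubic algebras\<close>

definition row_module :: "'a::comm_ring_1 ^ 3 ^ 3 \<Rightarrow> ('a ^ 3) set" where
  "row_module \<alpha> = range (\<lambda>u. u v* \<alpha>)"

text \<open>The columns of \<open>G\<close> are a basis of the ring that starts with \<open>1\<close>, in the coordinates of \<open>f\<close>.\<close>

definition represents ::
  "'a::idom cubic_form \<Rightarrow> ('a ^ 3) set \<Rightarrow> 'a fract ^ 3 \<Rightarrow> 'a ^ 3 ^ 3 \<Rightarrow> 'a ^ 3 ^ 3 \<Rightarrow> bool" where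
  "represents f L \<delta> A B \<longleftrightarrow> (\<exists>G \<alpha> C. invertible G \<and> G *v vone = vone \<and> det \<alpha> \<noteq> 0 \<and> L = row_module \<alpha> \<and>
     (\<forall>i j. df_mult (ffract f) (vfract (\<alpha>$i)) (vfract (\<alpha>$j))
              = df_mult (ffract f) \<delta> (vfract (G *v table C B A i j))))"

text \<open>The norm condition is imposed up to the unit \<open>u\<close>: it is all that the choice of \<open>S\<close> leaves over
  for the determinant of a basis.\<close>

definition admissible :: "'a::idom cubic_form \<Rightarrow> ('a ^ 3) set \<Rightarrow> 'a fract ^ 3 \<Rightarrow> bool" where
  "admissible f L \<delta> \<longleftrightarrow> df_disc f \<noteq> 0 \<and> (\<exists>\<alpha> u. det \<alpha> \<noteq> 0 \<and> L = row_module \<alpha> \<and> u dvd 1 \<and>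
     df_norm (ffract f) \<delta> = (to_fract (u * det \<alpha>))\<^sup>2 \<and>
     (\<forall>i j. \<exists>z. df_mult (ffract f) (vfract (\<alpha>$i)) (vfract (\<alpha>$j)) = df_mult (ffract f) \<delta> (vfract z)))"

definition coord_equiv ::
  "'a::idom cubic_form \<Rightarrow> ('a ^ 3) set \<Rightarrow> 'a fract ^ 3 \<Rightarrow> 'a cubic_form \<Rightarrow> ('a ^ 3) set \<Rightarrow> 'a fract ^ 3 \<Rightarrow> bool" where
  "coord_equiv f L \<delta> f' L' \<delta>' \<longleftrightarrow> (\<exists>H \<kappa>. df_iso f f' H \<and>
     vfract ` L' = (\<lambda>x. df_mult (ffract f') \<kappa> (vfract (H *v x))) ` L \<and>
     \<delta>' = df_mult (ffract f') (df_mult (ffract f') \<kappa> \<kappa>) (mfract H *v \<delta>))"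

lemma row_module_basis_unique:
  fixes \<alpha> \<beta> :: "'a::idom ^ 3 ^ 3"
  assumes "row_module \<alpha> = row_module \<beta>" "det \<alpha> \<noteq> 0"
  obtains h where "invertible h" "\<beta> = h ** \<alpha>"
proof -
  have span: "\<exists>h. M = h ** N" if "\<And>i. M $ i \<in> row_module N" for M N :: "'a ^ 3 ^ 3"
  proof -
    have "\<forall>i. \<exists>u. M $ i = u v* N"
      using that unfolding row_module_def by blast
    then obtain h where "\<And>i. M $ i = h i v* N" by metis
    then have "M $ i = ((\<chi> i. h i) ** N) $ i" for i by (simp add: row_matrix_mult)
    then have "M = (\<chi> i. h i) ** N" using vec_eq_iff by blast
    then show ?thesis ..
  qed
  have row: "M $ i \<in> row_module M" for M :: "'a ^ 3 ^ 3" and i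
    unfolding row_module_def using row_matrix_mult[of "mat 1" M i] by auto
  have "\<And>i. \<beta> $ i \<in> row_module \<alpha>" "\<And>i. \<alpha> $ i \<in> row_module \<beta>"
    using row[of \<beta>] row[of \<alpha>] by (simp_all add: assms(1))
  then obtain h k where h: "\<beta> = h ** \<alpha>" and k: "\<alpha> = k ** \<beta>"
    using span[of \<beta> \<alpha>] span[of \<alpha> \<beta>] by blast
  have "(k ** h) ** \<alpha> = mat 1 ** \<alpha>" using h k by (simp flip: matrix_mul_assoc)
  then have "k ** h = mat 1" using matrix_mult_cancel_right assms(2) by blast
  then have "det h * det k = 1" by (metis det_I det_mul mult.commute)
  then have "invertible h" by (metis dvdI invertible_iff_det_unit)
  then show thesis using h that by blast
qed

lemma row_module_change: "invertible h \<Longrightarrow> row_module (h ** \<alpha>) = row_module \<alpha>"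
proof -
  assume "invertible h"
  then obtain k where k: "k ** h = mat 1" by (auto simp: invertible_def)
  have "u v* \<alpha> = (u v* k) v* (h ** \<alpha>)" for u
    by (simp add: vector_matrix_mul_assoc matrix_mul_assoc k)
  then show ?thesis
    by (auto simp: row_module_def image_iff simp flip: vector_matrix_mul_assoc)
qed

lemma row_module_image:
  fixes H \<alpha> :: "'k::comm_ring_1 ^ 3 ^ 3"
  shows "(*v) H ` row_module \<alpha> = row_module (\<alpha> ** transpose H)"
proof -
  have "H *v (u v* \<alpha>) = u v* (\<alpha> ** transpose H)" for u
    by (metis transpose_matrix_vector transpose_transpose vector_matrix_mul_assoc)
  then show ?thesis by (simp add: row_module_def image_image)
qed

lemma row_mult_transpose: "(\<alpha> ** transpose H) $ i = H *v (\<alpha> $ i)" for H :: "'k::comm_ring_1 ^ 3 ^ 3"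
  by (simp add: row_matrix_mult)

lemma table_change:
  fixes \<alpha> h :: "'k::comm_ring_1 ^ 3 ^ 3"
  assumes "\<And>i j. df_mult f (\<alpha>$i) (\<alpha>$j) = df_mult f d (G *v table C B A i j)"
  shows "df_mult f ((h ** \<alpha>)$i) ((h ** \<alpha>)$j)
    = df_mult f d (G *v table (h ** C ** transpose h) (h ** B ** transpose h) (h ** A ** transpose h) i j)"
proof -
  have "df_mult f ((h ** \<alpha>)$i) ((h ** \<alpha>)$j) =
     (\<Sum>k\<in>UNIV. \<Sum>l\<in>UNIV. (h$i$k * h$j$l) *s df_mult f d (G *v table C B A k l))"
    by (simp add: row_matrix_mult vector_matrix_rows df_mult_add df_mult_scale assms sum_3)
       (simp add: vec_eq_iff algebra_simps)
  also have "\<dots> = df_mult f d (G *v (\<Sum>k\<in>UNIV. \<Sum>l\<in>UNIV. (h$i$k * h$j$l) *s table C B A k l))"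
    by (simp add: sum_3 df_mult_add df_mult_scale matrix_vector_right_distrib matrix_vector_scale)
  also have "(\<Sum>k\<in>UNIV. \<Sum>l\<in>UNIV. (h$i$k * h$j$l) *s table C B A k l)
     = table (h ** C ** transpose h) (h ** B ** transpose h) (h ** A ** transpose h) i j"
    by (simp add: vec_eq_iff forall_3 sum_3 matrix_matrix_mult_def transpose_def algebra_simps)
  finally show ?thesis .
qed

lemma coord_equiv_trans:
  assumes "coord_equiv f L \<delta> f' L' \<delta>'" "coord_equiv f' L' \<delta>' f'' L'' \<delta>''"
  shows "coord_equiv f L \<delta> f'' L'' \<delta>''"
proof -
  obtain H \<kappa> where H: "df_iso f f' H" and L': "vfract ` L' = (\<lambda>x. df_mult (ffract f') \<kappa> (vfract (H *v x))) ` L"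
    and \<delta>': "\<delta>' = df_mult (ffract f') (df_mult (ffract f') \<kappa> \<kappa>) (mfract H *v \<delta>)"
    using assms(1) unfolding coord_equiv_def by blast
  obtain H' \<kappa>' where H': "df_iso f' f'' H'"
    and L'': "vfract ` L'' = (\<lambda>x. df_mult (ffract f'') \<kappa>' (vfract (H' *v x))) ` L'"
    and \<delta>'': "\<delta>'' = df_mult (ffract f'') (df_mult (ffract f'') \<kappa>' \<kappa>') (mfract H' *v \<delta>')"
    using assms(2) unfolding coord_equiv_def by blast
  note K = df_isoD(1)[OF df_iso_fract[OF H']]
  let ?k = "df_mult (ffract f'') \<kappa>' (mfract H' *v \<kappa>)"
  have "vfract ` L'' = (\<lambda>y. df_mult (ffract f'') \<kappa>' (mfract H' *v y)) ` vfract ` L'"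
    by (simp add: L'' image_image vfract_matrix_vector)
  also have "\<dots> = (\<lambda>x. df_mult (ffract f'') ?k (vfract ((H' ** H) *v x))) ` L"
    by (simp add: L' image_image K df_mult_assoc vfract_matrix_vector mfract_mult flip: matrix_vector_mul_assoc)
  finally have "vfract ` L'' = (\<lambda>x. df_mult (ffract f'') ?k (vfract ((H' ** H) *v x))) ` L" .
  moreover have "\<delta>'' = df_mult (ffract f'') (df_mult (ffract f'') ?k ?k) (mfract (H' ** H) *v \<delta>)"
    by (simp add: \<delta>'' \<delta>' K mfract_mult df_mult_ac flip: matrix_vector_mul_assoc)
  ultimately show ?thesis
    using df_iso_comp[OF H H'] unfolding coord_equiv_def by blast
qed

lemma coord_equiv_iso:
  assumes "df_iso f f' H"
  shows "coord_equiv f L \<delta> f' ((*v) H ` L) (mfract H *v \<delta>)"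
  unfolding coord_equiv_def
  by (rule exI[of _ H], rule exI[of _ vone]) (simp add: assms image_image)

section \<open>Representing pairs by triples in coordinates\<close>

lemma admissible_unit:
  fixes f :: "'a::idom cubic_form"
  assumes "admissible f L \<delta>"
  obtains q where "df_mult (ffract f) \<delta> q = vone"
proof -
  obtain \<alpha> :: "'a ^ 3 ^ 3" and u where "det \<alpha> \<noteq> 0" "u dvd 1"
    "df_norm (ffract f) \<delta> = (to_fract (u * det \<alpha>))\<^sup>2"
    using assms unfolding admissible_def by blast
  then have "df_norm (ffract f) \<delta> \<noteq> 0" by auto
  then show thesis using df_inverse that by blast
qed

text \<open>The norm condition replaces N(\<delta>) by (u det \<alpha>)^2 in
  \<open>pair_form_table\<close>; cancelling the square of det \<alpha> leaves an identity over
  T.\<close>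

lemma form_of_table:
  assumes "has_table (ffract f) (mfract \<alpha>) \<delta> C (mfract B) (mfract A)" "det \<alpha> \<noteq> 0"
    "u dvd 1" "df_norm (ffract f) \<delta> = (to_fract (u * det \<alpha>))\<^sup>2"
  shows "form_scale (u\<^sup>2) (pair_form A B) = f"
proof -
  have "df_norm (ffract f) \<delta> \<noteq> 0" using assms by auto
  then obtain q where q: "df_mult (ffract f) \<delta> q = vone" by (rule df_inverse)
  have "form_scale ((to_fract (u * det \<alpha>))\<^sup>2) (ffract (pair_form A B)) = form_scale ((to_fract (det \<alpha>))\<^sup>2) (ffract f)"
    using pair_form_table[OF assms(1) q] by (simp only: assms(4) pair_form_mfract det_mfract)
  then have "form_scale ((u * det \<alpha>)\<^sup>2) (pair_form A B) = form_scale ((det \<alpha>)\<^sup>2) f"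
    by (simp only: form_scale_ffract ffract_inj flip: to_fract_power)
  then have "form_scale ((det \<alpha>)\<^sup>2) (form_scale (u\<^sup>2) (pair_form A B)) = form_scale ((det \<alpha>)\<^sup>2) f"
    by (simp add: form_scale_scale power_mult_distrib mult.commute)
  then show ?thesis
    using assms(2) by (cases f, cases "pair_form A B") (simp add: form_scale_def)
qed

lemma admissible_represents:
  assumes "admissible f L \<delta>"
  obtains A B where "(A, B) \<in> nondegenerate_pairs" "represents f L \<delta> A B"
proof -
  obtain \<alpha> u where \<alpha>: "det \<alpha> \<noteq> 0" "L = row_module \<alpha>" and u: "u dvd 1"
    and n: "df_norm (ffract f) \<delta> = (to_fract (u * det \<alpha>))\<^sup>2"
    and z: "\<forall>i j. \<exists>z. df_mult (ffract f) (vfract (\<alpha>$i)) (vfract (\<alpha>$j)) = df_mult (ffract f) \<delta> (vfract z)"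
    and disc: "df_disc f \<noteq> 0"
    using assms unfolding admissible_def by blast
  obtain q where q: "df_mult (ffract f) \<delta> q = vone" using admissible_unit[OF assms] .
  obtain z where z: "\<And>i j. df_mult (ffract f) (vfract (\<alpha>$i)) (vfract (\<alpha>$j)) = df_mult (ffract f) \<delta> (vfract (z i j))"
    using z by metis
  have sym: "z i j = z j i" for i j
    using df_mult_cancel[OF q] z by (metis df_mult_commute vfract_inj)
  define C B A where "C = (\<chi> i j. z i j $ 1)" and "B = (\<chi> i j. z i j $ 2)" and "A = (\<chi> i j. z i j $ 3)"
  have zt: "z i j = table C B A i j" for i j
    by (simp add: vec_eq_iff forall_3 C_def B_def A_def)
  have "has_table (ffract f) (mfract \<alpha>) \<delta> (mfract C) (mfract B) (mfract A)"
    by (simp add: has_table_def z zt vfract_table)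
  then have "form_scale (u\<^sup>2) (pair_form A B) = f"
    using form_of_table \<alpha> u n by blast
  then have "df_disc (pair_form A B) \<noteq> 0"
    using disc df_disc_scale by (metis mult_zero_right)
  moreover have "transpose A = A" "transpose B = B"
    using sym by (simp_all add: A_def B_def transpose_def vec_eq_iff)
  ultimately have "(A, B) \<in> nondegenerate_pairs"
    by (simp add: nondegenerate_pairs_def V_space_def pair_disc_eq)
  moreover have "represents f L \<delta> A B"
    unfolding represents_def
    by (rule exI[of _ "mat 1"], rule exI[of _ \<alpha>], rule exI[of _ C])
      (use \<alpha> z zt in \<open>auto simp: invertible_def\<close>)
  ultimately show thesis by (rule that)
qed

text \<open>A change of basis of the ring acts on the coordinates of \<open>\<omega>\<close> and \<open>\<theta>\<close> through its lower right
  block; the order of the entries and the signs are those of \<^const>\<open>pair_act\<close>.\<close>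

definition block :: "'k::comm_ring_1 ^ 3 ^ 3 \<Rightarrow> 'k ^ 2 ^ 2" where
  "block K = vector [vector [K$3$3, - (K$3$2)], vector [- (K$2$3), K$2$2]]"

definition unblock :: "'k::comm_ring_1 ^ 2 ^ 2 \<Rightarrow> 'k ^ 3 ^ 3" where
  "unblock g = vector [vector [1, 0, 0], vector [0, g$2$2, - (g$2$1)], vector [0, - (g$1$2), g$1$1]]"

lemma unblock_simps:
  "block (unblock g) = g" "unblock g *v vone = vone" "unblock (g ** g') = unblock g ** unblock g'"
  "unblock (mat 1) = mat 1"
  by (simp_all add: block_def unblock_def vec_eq_iff forall_2 mat3_simps sum_2 algebra_simps)

lemma vone_column:
  assumes "K *v vone = vone"
  shows "K $ 1 $ 1 = 1" "K $ 2 $ 1 = 0" "K $ 3 $ 1 = 0"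
proof -
  have "(K *v vone) $ i = vone $ i" for i using assms by simp
  from this[of 1] this[of 2] this[of 3] show "K $ 1 $ 1 = 1" "K $ 2 $ 1 = 0" "K $ 3 $ 1 = 0"
    by (simp_all add: matrix_vector_mult_def sum_3)
qed

text \<open>When the first column is that of the identity, the lower right block is multiplicative.
  Reversing its indices and conjugating by diag(1, -1), which produces the shape of
  \<open>block\<close>, preserves this.\<close>

lemma block_mult:
  assumes "K *v vone = vone"
  shows "block (K ** K') = block K ** block K'"
  using vone_column[OF assms] by (simp add: block_def vec_eq_iff forall_2 matrix_matrix_mult_def sum_2 sum_3 algebra_simps)

lemma invertible_block:
  assumes "invertible K" "K *v vone = vone"
  shows "invertible (block K)"
proof -
  obtain K' where K': "K ** K' = mat 1" "K' ** K = mat 1" using assms(1) by (auto simp: invertible_def)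
  then have "K' *v vone = vone" using assms(2) by (metis matrix_vector_mul_assoc matrix_vector_mul_lid)
  then have "block K ** block K' = block (mat 1)" "block K' ** block K = block (mat 1)"
    using assms(2) K' block_mult by metis+
  moreover have "block (mat 1) = (mat 1 :: 'a ^ 2 ^ 2)"
    by (simp add: block_def mat_def vec_eq_iff forall_2)
  ultimately show ?thesis by (auto simp: invertible_def)
qed

lemma invertible_unblock:
  assumes "invertible g"
  shows "invertible (unblock g)"
  using assms unfolding invertible_def by (metis unblock_simps(3,4))

lemma pair_act_block:
  assumes "K *v vone = vone" "\<And>i j. table C' B' A' i j = K *v table C (h ** B ** transpose h) (h ** A ** transpose h) i j"
  shows "(A', B') = pair_act (block K, h) (A, B)"
proof -
  have "A' $ i $ j = (K *v table C (h ** B ** transpose h) (h ** A ** transpose h) i j) $ 3"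
    "B' $ i $ j = (K *v table C (h ** B ** transpose h) (h ** A ** transpose h) i j) $ 2" for i j
    by (simp_all flip: assms(2))
  then show ?thesis
    using vone_column[OF assms(1)]
    by (simp add: pair_act_def Let_def block_def scale_mat_def vec_eq_iff matrix_vector_mult_def sum_3)
qed

text \<open>Only two choices are hidden in \<open>represents\<close>: a basis of the lattice, which
  varies by \<open>h\<close>, and a basis of the ring beginning with 1, which varies by
  \<open>K\<close>. Cancelling \<delta> shows that \<open>K\<close> and \<open>h\<close> transform
  one table into the other.\<close>

lemma represents_unique_orbit:
  assumes "df_mult (ffract f) \<delta> q = vone" "represents f L \<delta> A B" "represents f L \<delta> A' B'"
  obtains g where "g \<in> carrier (GL \<times>\<times> GL)" "(A', B') = pair_act g (A, B)"
proof -
  obtain G \<alpha> C where G: "invertible G" "G *v vone = vone" and \<alpha>: "det \<alpha> \<noteq> 0" "L = row_module \<alpha>"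
    and t: "\<And>i j. df_mult (ffract f) (mfract \<alpha>$i) (mfract \<alpha>$j)
              = df_mult (ffract f) \<delta> (mfract G *v table (mfract C) (mfract B) (mfract A) i j)"
    using assms(2) unfolding represents_def by (auto simp: vfract_matrix_vector vfract_table)
  obtain G' \<alpha>' C' where G': "invertible G'" "G' *v vone = vone" and \<alpha>': "det \<alpha>' \<noteq> 0" "L = row_module \<alpha>'"
    and t': "\<And>i j. df_mult (ffract f) (vfract (\<alpha>'$i)) (vfract (\<alpha>'$j))
              = df_mult (ffract f) \<delta> (vfract (G' *v table C' B' A' i j))"
    using assms(3) unfolding represents_def by blast
  obtain h where h: "invertible h" "\<alpha>' = h ** \<alpha>"
    using row_module_basis_unique[of \<alpha> \<alpha>'] \<alpha> \<alpha>' by auto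
  obtain R where R: "R ** G' = mat 1" "G' ** R = mat 1" using G'(1) by (auto simp: invertible_def)
  define K where "K = R ** G"
  have "R *v vone = vone" using G'(2) R(1) by (metis matrix_vector_mul_assoc matrix_vector_mul_lid)
  then have K1: "K *v vone = vone" by (simp add: K_def G flip: matrix_vector_mul_assoc)
  have K: "invertible K" unfolding K_def using G(1) R by (intro invertible_mult') (auto simp: invertible_def)
  have "table C' B' A' i j = K *v table (h ** C ** transpose h) (h ** B ** transpose h) (h ** A ** transpose h) i j" for i j
  proof -
    have "df_mult (ffract f) \<delta> (vfract (G' *v table C' B' A' i j))
        = df_mult (ffract f) ((mfract h ** mfract \<alpha>)$i) ((mfract h ** mfract \<alpha>)$j)"
      by (simp add: h(2) t'[symmetric] flip: mfract_mult)
    also have "\<dots> = df_mult (ffract f) \<delta>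
        (vfract (G *v table (h ** C ** transpose h) (h ** B ** transpose h) (h ** A ** transpose h) i j))"
      unfolding table_change[OF t] by (simp add: vfract_matrix_vector vfract_table mfract_mult)
    finally have "G' *v table C' B' A' i j
        = G *v table (h ** C ** transpose h) (h ** B ** transpose h) (h ** A ** transpose h) i j"
      using df_mult_cancel[OF assms(1)] vfract_inj by blast
    then have "R *v (G' *v table C' B' A' i j)
        = R *v (G *v table (h ** C ** transpose h) (h ** B ** transpose h) (h ** A ** transpose h) i j)"
      by simp
    then show ?thesis by (simp add: matrix_vector_mul_assoc R K_def)
  qed
  from pair_act_block[OF K1 this] have "(A', B') = pair_act (block K, h) (A, B)" .
  moreover have "(block K, h) \<in> carrier (GL \<times>\<times> GL)"
    using invertible_block[OF K K1] h by (simp add: GL_def)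
  ultimately show thesis using that by blast
qed

text \<open>The matrix \<open>h\<close> is spent on the basis of the lattice. The other factor is
  lifted to \<open>unblock g2\<close>, which acts on the table, and the inverse of this lift is
  absorbed in the ring basis \<open>G\<close>.\<close>

lemma represents_act:
  assumes "represents f L \<delta> A B" "g \<in> carrier (GL \<times>\<times> GL)" "(A', B') = pair_act g (A, B)"
  shows "represents f L \<delta> A' B'"
proof -
  obtain g2 h where g: "g = (g2, h)" "invertible g2" "invertible h"
    using assms(2) by (auto simp: GL_def)
  obtain G \<alpha> C where G: "invertible G" "G *v vone = vone" and \<alpha>: "det \<alpha> \<noteq> 0" "L = row_module \<alpha>"
    and t: "\<And>i j. df_mult (ffract f) (mfract \<alpha>$i) (mfract \<alpha>$j)
              = df_mult (ffract f) \<delta> (mfract G *v table (mfract C) (mfract B) (mfract A) i j)"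
    using assms(1) unfolding represents_def by (auto simp: vfract_matrix_vector vfract_table)
  define K where "K = unblock g2"
  have K1: "K *v vone = vone" by (simp add: K_def unblock_simps)
  obtain R where R: "R ** K = mat 1" "K ** R = mat 1"
    using invertible_unblock[OF g(2)] by (auto simp: K_def invertible_def)
  define C' where "C' = h ** C ** transpose h"
  have tab: "K *v table C' (h ** B ** transpose h) (h ** A ** transpose h) i j = table C' B' A' i j" for i j
  proof -
    have "A' = scale_mat (g2$1$1) (h ** A ** transpose h) - scale_mat (g2$1$2) (h ** B ** transpose h)"
      "B' = - scale_mat (g2$2$1) (h ** A ** transpose h) + scale_mat (g2$2$2) (h ** B ** transpose h)"
      using assms(3) by (simp_all add: g(1) pair_act_def Let_def)
    then have "A' $ i $ j = g2$1$1 * (h ** A ** transpose h) $ i $ j - g2$1$2 * (h ** B ** transpose h) $ i $ j"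
      "B' $ i $ j = - (g2$2$1 * (h ** A ** transpose h) $ i $ j) + g2$2$2 * (h ** B ** transpose h) $ i $ j"
      by (simp_all add: scale_mat_def)
    moreover have "(K *v v) $ 1 = v $ 1" "(K *v v) $ 2 = g2$2$2 * v $ 2 - g2$2$1 * v $ 3"
      "(K *v v) $ 3 = g2$1$1 * v $ 3 - g2$1$2 * v $ 2" for v
      by (simp_all add: K_def unblock_def matrix_vector_mult_def sum_3)
    ultimately show ?thesis
      unfolding vec_eq_iff[of "K *v _"] forall_3 by simp
  qed
  have "df_mult (ffract f) (vfract ((h ** \<alpha>)$i)) (vfract ((h ** \<alpha>)$j))
      = df_mult (ffract f) \<delta> (vfract ((G ** R) *v table C' B' A' i j))" for i j
  proof -
    have "df_mult (ffract f) ((mfract h ** mfract \<alpha>)$i) ((mfract h ** mfract \<alpha>)$j)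
        = df_mult (ffract f) \<delta> (vfract (G *v table C' (h ** B ** transpose h) (h ** A ** transpose h) i j))"
      unfolding table_change[OF t] C'_def by (simp add: vfract_matrix_vector vfract_table mfract_mult)
    also have "G *v table C' (h ** B ** transpose h) (h ** A ** transpose h) i j = (G ** R) *v table C' B' A' i j"
      by (simp add: matrix_vector_mul_assoc R flip: tab matrix_mul_assoc)
    finally show ?thesis by (simp flip: mfract_mult)
  qed
  moreover have "invertible (G ** R)" using G R by (intro invertible_mult') (auto simp: invertible_def)
  moreover have "(G ** R) *v vone = vone"
    using K1 R(1) G(2) by (metis matrix_vector_mul_assoc matrix_vector_mul_lid)
  moreover have "det (h ** \<alpha>) \<noteq> 0"
    using g(3) \<alpha>(1) by (auto simp: det_mul invertible_iff_det_unit)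
  moreover have "L = row_module (h ** \<alpha>)" using g(3) \<alpha>(2) by (simp add: row_module_change)
  ultimately show ?thesis unfolding represents_def by blast
qed

text \<open>Applying \<open>H\<close> and multiplying by \<kappa> carries a basis of
  \<open>L\<close> to one of \<open>L'\<close>. Products acquire the factor \<kappa>^2, which is
  exactly the one contained in \<delta>', so the table is unchanged.\<close>

lemma represents_equiv:
  assumes e: "coord_equiv f L \<delta> f' L' \<delta>'" and q': "df_mult (ffract f') \<delta>' q' = vone"
    and r: "represents f L \<delta> A B"
  shows "represents f' L' \<delta>' A B"
proof -
  obtain H \<kappa> where H: "df_iso f f' H" and L': "vfract ` L' = (\<lambda>x. df_mult (ffract f') \<kappa> (vfract (H *v x))) ` L"
    and \<delta>': "\<delta>' = df_mult (ffract f') (df_mult (ffract f') \<kappa> \<kappa>) (mfract H *v \<delta>)"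
    using e unfolding coord_equiv_def by blast
  obtain G \<alpha> C where G: "invertible G" "G *v vone = vone" and \<alpha>: "det \<alpha> \<noteq> 0" "L = row_module \<alpha>"
    and t: "\<And>i j. df_mult (ffract f) (vfract (\<alpha>$i)) (vfract (\<alpha>$j))
              = df_mult (ffract f) \<delta> (vfract (G *v table C B A i j))"
    using r unfolding represents_def by blast
  note HK = df_isoD(1)[OF df_iso_fract[OF H]]
  \<comment> \<open>\<open>coord_equiv\<close> allows any \<kappa>; it is invertible here because it
    divides the invertible \<delta>'. Otherwise the transported rows might be dependent.\<close>
  have "df_mult (ffract f') \<kappa> (df_mult (ffract f') \<kappa> (df_mult (ffract f') (mfract H *v \<delta>) q')) = vone"
    using q' by (simp add: \<delta>' df_mult_assoc)
  then have n\<kappa>: "df_norm (ffract f') \<kappa> \<noteq> 0"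
    by (metis df_norm_unit mult_zero_left zero_neq_one)
  have mem: "\<alpha> $ i \<in> L" for i
    unfolding \<alpha>(2) row_module_def using row_matrix_mult[of "mat 1" \<alpha> i] by auto
  have "\<forall>i. \<exists>x\<in>L'. vfract x = df_mult (ffract f') \<kappa> (vfract (H *v (\<alpha> $ i)))"
    using L' mem by (metis (no_types, lifting) imageE imageI)
  then obtain x where x: "\<And>i. vfract (x i) = df_mult (ffract f') \<kappa> (vfract (H *v (\<alpha> $ i)))"
    by metis
  define \<beta> where "\<beta> = (\<chi> i. x i)"
  have \<beta>: "vfract (\<beta> $ i) = df_mult (ffract f') \<kappa> (vfract (H *v (\<alpha> $ i)))" for i
    by (simp add: \<beta>_def x)
  have m\<beta>: "mfract \<beta> = (mfract \<alpha> ** transpose (mfract H)) ** transpose (df_mat (ffract f') \<kappa>)"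
    unfolding vec_eq_iff[of "mfract \<beta>"]
    by (simp add: \<beta> row_mult_transpose df_mat_vector vfract_matrix_vector)
  have "to_fract (det \<beta>) \<noteq> 0"
    using \<alpha>(1) n\<kappa> df_isoD(3)[OF H] unfolding det_mfract[symmetric] m\<beta>
    by (auto simp: det_mul det_transpose det_mfract df_norm_def invertible_iff_det_unit)
  then have "det \<beta> \<noteq> 0" by simp
  moreover have "L' = row_module \<beta>"
  proof -
    have "vfract (u v* \<beta>) = df_mult (ffract f') \<kappa> (vfract (H *v (u v* \<alpha>)))" for u
      by (simp add: vfract_vector_matrix m\<beta> vfract_matrix_vector flip: vector_matrix_mul_assoc)
        (simp add: df_mat_vector)
    then have "vfract ` L' = vfract ` row_module \<beta>"
      unfolding L' \<alpha>(2) row_module_def image_image by simp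
    then show ?thesis by (simp add: inj_image_eq_iff inj_def)
  qed
  moreover have "df_mult (ffract f') (vfract (\<beta>$i)) (vfract (\<beta>$j))
      = df_mult (ffract f') \<delta>' (vfract ((H ** G) *v table C B A i j))" for i j
  proof -
    have "df_mult (ffract f') (vfract (\<beta>$i)) (vfract (\<beta>$j)) = df_mult (ffract f') (df_mult (ffract f') \<kappa> \<kappa>)
        (mfract H *v df_mult (ffract f) (vfract (\<alpha>$i)) (vfract (\<alpha>$j)))"
      by (simp only: \<beta> HK vfract_matrix_vector) (simp only: df_mult_ac)
    also have "\<dots> = df_mult (ffract f') \<delta>' (vfract ((H ** G) *v table C B A i j))"
      by (simp add: t HK \<delta>' vfract_matrix_vector mfract_mult df_mult_assoc flip: matrix_vector_mul_assoc)
    finally show ?thesis .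
  qed
  moreover have "invertible (H ** G)" "(H ** G) *v vone = vone"
    using df_isoD[OF H] G by (auto simp: invertible_mult' simp flip: matrix_vector_mul_assoc)
  ultimately show ?thesis unfolding represents_def by blast
qed

section \<open>Triples that represent the same pair\<close>

text \<open>Passing to the ring basis given by \<open>G\<close>, followed by a translation of
  \<omega> and \<theta>, makes \<open>G\<close> disappear. The translation affects only
  \<open>C\<close>, so the table in the new coordinates still has the given \<open>A\<close> and
  \<open>B\<close>, and \<open>form_of_table\<close> identifies the new form.\<close>

lemma represents_normal:
  fixes f :: "'a::idom cubic_form"
  assumes r: "represents f L \<delta> A B" and adm: "admissible f L \<delta>"
  obtains H f1 \<alpha> C u where "df_iso f f1 H" "det \<alpha> \<noteq> 0" "(*v) H ` L = row_module \<alpha>"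
    "has_table (ffract f1) (mfract \<alpha>) (mfract H *v \<delta>) (mfract C) (mfract B) (mfract A)" "u dvd 1"
    "df_norm (ffract f1) (mfract H *v \<delta>) = (to_fract (u * det \<alpha>))\<^sup>2"
    "form_scale (u\<^sup>2) (pair_form A B) = f1"
proof -
  obtain G \<alpha>0 C where G: "invertible G" "G *v vone = vone" and \<alpha>0: "det \<alpha>0 \<noteq> 0" "L = row_module \<alpha>0"
    and t: "\<And>i j. df_mult (ffract f) (vfract (\<alpha>0$i)) (vfract (\<alpha>0$j))
              = df_mult (ffract f) \<delta> (vfract (G *v table C B A i j))"
    using r unfolding represents_def by blast
  obtain \<beta> :: "'a ^ 3 ^ 3" and u where \<beta>: "det \<beta> \<noteq> 0" "L = row_module \<beta>" and u: "u dvd 1"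
    and n: "df_norm (ffract f) \<delta> = (to_fract (u * det \<beta>))\<^sup>2"
    using adm unfolding admissible_def by blast
  obtain h where h: "invertible h" "\<alpha>0 = h ** \<beta>"
    using row_module_basis_unique[of \<beta> \<alpha>0] \<alpha>0 \<beta> by auto
  obtain R where R: "R ** G = mat 1" "G ** R = mat 1" using G(1) by (auto simp: invertible_def)
  have GR: "G *v (R *v x) = x" for x by (simp add: matrix_vector_mul_assoc R)
  define \<mu> where "\<mu> x y = R *v df_mult f (G *v x) (G *v y)" for x y
  have \<mu>: "cubic_product \<mu>"
    unfolding \<mu>_def[abs_def] by (rule cubic_product_transport[OF cubic_product_df R(2,1) G(2)])
  obtain U :: "'a ^ 3 ^ 3" and f1 where U: "invertible U" "U *v vone = vone" "\<And>x. (U *v x) $ 2 = x $ 2" "\<And>x. (U *v x) $ 3 = x $ 3"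
    "\<And>x y. U *v \<mu> x y = df_mult f1 (U *v x) (U *v y)"
    by (rule cubic_product_normalize[OF \<mu>]) blast
  define H where "H = U ** R"
  have R1: "R *v vone = vone" using G(2) R(1) by (metis matrix_vector_mul_assoc matrix_vector_mul_lid)
  have H: "df_iso f f1 H"
    unfolding df_iso_def
  proof (intro conjI allI)
    show "invertible H" unfolding H_def using U(1) R by (intro invertible_mult') (auto simp: invertible_def)
    show "H *v vone = vone" by (simp add: H_def R1 U(2) flip: matrix_vector_mul_assoc)
    show "H *v df_mult f x y = df_mult f1 (H *v x) (H *v y)" for x y
      using U(5)[of "R *v x" "R *v y"] by (simp add: H_def \<mu>_def GR flip: matrix_vector_mul_assoc)
  qed
  define \<alpha> where "\<alpha> = \<alpha>0 ** transpose H"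
  define C1 where "C1 = (\<chi> i j. (U *v table C B A i j) $ 1)"
  have Ut: "H *v (G *v table C B A i j) = table C1 B A i j" for i j
  proof -
    have "H *v (G *v table C B A i j) = U *v table C B A i j"
      by (simp add: H_def matrix_vector_mul_assoc R flip: matrix_mul_assoc)
    then show ?thesis by (simp add: vec_eq_iff[of "U *v _"] forall_3 U C1_def)
  qed
  have tab: "has_table (ffract f1) (mfract \<alpha>) (mfract H *v \<delta>) (mfract C1) (mfract B) (mfract A)"
    unfolding has_table_def
    by (simp add: \<alpha>_def row_mult_transpose vfract_matrix_vector t Ut
        flip: df_isoD(1)[OF df_iso_fract[OF H]] vfract_table)
      (simp add: df_isoD(1)[OF df_iso_fract[OF H]] Ut flip: vfract_matrix_vector)
  obtain e' where e': "det h * det H * e' = 1"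
  proof -
    have "det h * det H dvd 1"
      using invertible_mult'[OF h(1) df_isoD(3)[OF H]] by (simp add: invertible_iff_det_unit det_mul)
    then show thesis using that by (metis dvdE)
  qed
  have d\<alpha>: "det \<alpha> = det h * det H * det \<beta>"
    by (simp add: \<alpha>_def h(2) det_mul det_transpose)
  \<comment> \<open>The new basis has determinant det h det H det \<beta>; the inverse
    \<open>e'\<close> of the unit det h det H compensates for this.\<close>
  define v where "v = u * e'"
  have "e' dvd 1" using e' by (metis dvd_triv_right)
  then have v: "v dvd 1" using u unfolding v_def by (metis mult_dvd_mono mult_1)
  have vd: "v * det \<alpha> = u * det \<beta>"
  proof -
    have "v * det \<alpha> = u * (det h * det H * e') * det \<beta>" by (simp add: v_def d\<alpha>)
    then show ?thesis by (simp add: e')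
  qed
  have nn: "df_norm (ffract f1) (mfract H *v \<delta>) = (to_fract (v * det \<alpha>))\<^sup>2"
    unfolding vd df_iso_norm[OF df_iso_fract[OF H]] by (rule n)
  have "det h * det H \<noteq> 0" using e' by auto
  then have det: "det \<alpha> \<noteq> 0" using \<beta>(1) by (simp add: d\<alpha>)
  have L: "(*v) H ` L = row_module \<alpha>" by (simp add: \<alpha>0(2) row_module_image \<alpha>_def)
  show thesis
    by (rule that[OF H det L tab v nn form_of_table[OF tab det v nn]])
qed

text \<open>Replacing \<omega> and \<theta> by E \<omega> and E \<theta> multiplies the form by E,
  and coordinates change by the inverse e.\<close>

lemma df_iso_form_scale:
  assumes "E * e = 1"
  shows "df_iso f (form_scale E f) (vector [vector [1, 0, 0], vector [0, e, 0], vector [0, 0, e]])"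
proof -
  let ?D = "vector [vector [1, 0, 0], vector [0, e, 0], vector [0, 0, e]] :: 'a ^ 3 ^ 3"
  obtain a b c d where f: "f = (a, b, c, d)" by (cases f)
  have D: "(?D *v x) $ 1 = x $ 1" "(?D *v x) $ 2 = e * x $ 2" "(?D *v x) $ 3 = e * x $ 3" for x
    by (simp_all add: matrix_vector_mult_def sum_3)
  have E: "E * (e * x) = x" "e * (E * x) = x" for x
    using assms by (simp_all add: mult.commute[of e E] flip: mult.assoc)
  have "invertible ?D"
    using assms by (simp add: invertible_iff_det_unit det_3) (metis dvd_triv_right mult_dvd_mono mult_1)
  moreover have "?D *v vone = vone" by (simp add: vec_eq_iff forall_3 D)
  moreover have "?D *v df_mult f x y = df_mult (form_scale E f) (?D *v x) (?D *v y)" for x y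
  proof -
    have [simp]: "E * p * (E * q) * (e * r) * (e * s) = p * q * r * s" for p q r s
    proof -
      have "E * p * (E * q) * (e * r) * (e * s) = (E * e) * (E * e) * (p * q * r * s)" by (simp only: ac_simps)
      then show ?thesis by (simp add: assms)
    qed
    have 2: "E * p * (e * r) * (e * s) = e * (p * r * s)" for p r s
    proof -
      have "E * p * (e * r) * (e * s) = (E * e) * (e * (p * r * s))" by (simp only: ac_simps)
      then show ?thesis by (simp add: assms)
    qed
    have 3: "E * p * (E * q) * (e * r * (e * s) + e * r' * (e * s')) = p * q * (r * s + r' * s')" for p q r s r' s'
    proof -
      have "E * p * (E * q) * (e * r * (e * s) + e * r' * (e * s')) = (E * e) * (E * e) * (p * q * (r * s + r' * s'))"
        by (simp only: ring_distribs ac_simps)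
      then show ?thesis by (simp add: assms)
    qed
    show ?thesis
      unfolding vec_eq_iff forall_3 D f
      by (simp add: df_mult_def form_scale_def D 2 3) (simp add: algebra_simps)
  qed
  ultimately show ?thesis by (simp add: df_iso_def)
qed

lemma table_row_module:
  fixes \<alpha> \<alpha>' :: "'a::idom ^ 3 ^ 3"
  assumes "\<And>i. vfract (\<alpha>' $ i) = df_mult f \<gamma> (vfract (D *v (\<alpha> $ i)))"
  shows "vfract (u v* \<alpha>') = df_mult f \<gamma> (vfract (D *v (u v* \<alpha>)))"
proof -
  have "D *v (u v* \<alpha>) = u$1 *s (D *v (\<alpha>$1)) + u$2 *s (D *v (\<alpha>$2)) + u$3 *s (D *v (\<alpha>$3))"
    by (simp add: vector_matrix_rows matrix_vector_right_distrib matrix_vector_scale)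
  then show ?thesis
    by (simp add: vector_matrix_rows assms df_mult_add df_mult_scale)
qed

text \<open>The two rings have forms that differ by the square of a unit \<open>w\<close>; rescaling \<open>\<omega>\<close> and \<open>\<theta>\<close> by
  \<open>w\<^sup>2\<close> identifies them and multiplies \<open>\<delta>\<close> by a unit square, which is absorbed in \<open>\<kappa>\<close>.\<close>

lemma represents_equiv_unique:
  fixes f f' :: "'a::idom cubic_form"
  assumes r: "represents f L \<delta> A B" "admissible f L \<delta>" and r': "represents f' L' \<delta>' A B" "admissible f' L' \<delta>'"
    and disc: "pair_disc (A, B) \<noteq> 0"
  shows "coord_equiv f L \<delta> f' L' \<delta>'"
proof -
  obtain H f1 \<alpha> C u where H: "df_iso f f1 H" and \<alpha>: "det \<alpha> \<noteq> 0" and L: "(*v) H ` L = row_module \<alpha>"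
    and t: "has_table (ffract f1) (mfract \<alpha>) (mfract H *v \<delta>) (mfract C) (mfract B) (mfract A)"
    and u: "u dvd 1" and n: "df_norm (ffract f1) (mfract H *v \<delta>) = (to_fract (u * det \<alpha>))\<^sup>2"
    and f1: "form_scale (u\<^sup>2) (pair_form A B) = f1"
    using represents_normal[OF r] .
  obtain H' f2 \<alpha>' C' u' where H': "df_iso f' f2 H'" and \<alpha>': "det \<alpha>' \<noteq> 0" and L': "(*v) H' ` L' = row_module \<alpha>'"
    and t': "has_table (ffract f2) (mfract \<alpha>') (mfract H' *v \<delta>') (mfract C') (mfract B) (mfract A)"
    and u': "u' dvd 1" and n': "df_norm (ffract f2) (mfract H' *v \<delta>') = (to_fract (u' * det \<alpha>'))\<^sup>2"
    and f2: "form_scale (u'\<^sup>2) (pair_form A B) = f2"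
    using represents_normal[OF r'] .
  obtain v v' where v: "u * v = 1" "u' * v' = 1" using u u' by (metis dvdE)
  define w w' where "w = u' * v" and "w' = u * v'"
  have ww: "w * w' = 1"
  proof -
    have "w * w' = (u * v) * (u' * v')" by (simp add: w_def w'_def ac_simps)
    then show ?thesis by (simp add: v)
  qed
  have f12: "f2 = form_scale (w\<^sup>2) f1"
  proof -
    have "w\<^sup>2 * u\<^sup>2 = u'\<^sup>2 * (u * v)\<^sup>2" by (simp add: w_def power_mult_distrib)
    then show ?thesis by (simp add: v form_scale_scale flip: f1 f2)
  qed
  define D :: "'a ^ 3 ^ 3" where "D = vector [vector [1, 0, 0], vector [0, w'\<^sup>2, 0], vector [0, 0, w'\<^sup>2]]"
  have "w\<^sup>2 * w'\<^sup>2 = 1" using ww by (simp flip: power_mult_distrib)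
  then have D: "df_iso f1 f2 D"
    unfolding f12 D_def by (rule df_iso_form_scale)
  note DK = df_iso_fract[OF D]
  define e where "e = to_fract (w'\<^sup>2)"
  have ee: "to_fract (w\<^sup>2) * e = 1" using \<open>w\<^sup>2 * w'\<^sup>2 = 1\<close> by (simp add: e_def flip: to_fract_mult)
  then have e0: "e \<noteq> 0" and ee': "e * to_fract (w\<^sup>2) = 1" by (auto simp: mult.commute)
  let ?d = "mfract H *v \<delta>" and ?d' = "mfract H' *v \<delta>'"
  \<comment> \<open>\<open>D\<close> turns (C, B, A) into (C, e B, e A). Pulling out e moves it into
    \<delta>, restores \<open>B\<close> and \<open>A\<close>, and multiplies \<open>C\<close> by
    w^2, the inverse of w'^2.\<close>
  let ?C = "\<chi> i j. w\<^sup>2 * C $ i $ j"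
  have tD: "has_table (ffract f2) (mfract (\<alpha> ** transpose D)) (e *s (mfract D *v ?d)) (mfract ?C) (mfract B) (mfract A)"
    unfolding has_table_def
  proof (intro allI)
    fix i j
    have "mfract D *v table (mfract C) (mfract B) (mfract A) i j = e *s table (mfract ?C) (mfract B) (mfract A) i j"
      using ee ee' by (simp add: vec_eq_iff forall_3 matrix_vector_mult_def sum_3 D_def e_def mult.left_commute flip: mult.assoc)
    then have "mfract D *v df_mult (ffract f1) ?d (table (mfract C) (mfract B) (mfract A) i j)
        = df_mult (ffract f2) (e *s (mfract D *v ?d)) (table (mfract ?C) (mfract B) (mfract A) i j)"
      by (simp only: df_isoD(1)[OF DK] df_mult_scale)
    moreover have "df_mult (ffract f2) (mfract (\<alpha> ** transpose D) $ i) (mfract (\<alpha> ** transpose D) $ j)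
        = mfract D *v df_mult (ffract f1) (mfract \<alpha> $ i) (mfract \<alpha> $ j)"
      by (simp add: row_mult_transpose vfract_matrix_vector df_isoD(1)[OF DK])
    ultimately show "df_mult (ffract f2) (mfract (\<alpha> ** transpose D) $ i) (mfract (\<alpha> ** transpose D) $ j)
        = df_mult (ffract f2) (e *s (mfract D *v ?d)) (table (mfract ?C) (mfract B) (mfract A) i j)"
      using t unfolding has_table_def by metis
  qed
  have nz: "to_fract (u * det \<alpha>) \<noteq> 0" "to_fract (u' * det \<alpha>') \<noteq> 0"
    using v \<alpha> \<alpha>' by auto
  have "df_norm (ffract f2) (e *s (mfract D *v ?d)) \<noteq> 0"
    using n nz(1) e0 by (simp add: df_norm_scale df_iso_norm[OF DK])
  then obtain q where q: "df_mult (ffract f2) (e *s (mfract D *v ?d)) q = vone" by (rule df_inverse)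
  have "df_norm (ffract f2) ?d' \<noteq> 0" using n' nz(2) by simp
  then obtain q' where q': "df_mult (ffract f2) ?d' q' = vone" by (rule df_inverse)
  have "det (\<alpha> ** transpose D) \<noteq> 0"
    using \<alpha> df_isoD(3)[OF D] by (auto simp: det_mul det_transpose invertible_iff_det_unit)
  then have det: "det (mfract (\<alpha> ** transpose D)) \<noteq> 0" "det (mfract \<alpha>') \<noteq> 0"
    using \<alpha>' by (simp_all add: det_mfract)
  have "pair_form A B \<noteq> (0, 0, 0, 0)"
    using disc by (auto simp: pair_disc_eq df_disc_def)
  then have "pair_form (mfract A) (mfract B) \<noteq> (0, 0, 0, 0)"
    by (cases "pair_form A B") (auto simp: pair_form_mfract ffract_def)
  then obtain \<gamma> where \<gamma>: "\<And>i. mfract \<alpha>' $ i = df_mult (ffract f2) \<gamma> (mfract (\<alpha> ** transpose D) $ i)"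
      "?d' = df_mult (ffract f2) \<gamma> (df_mult (ffract f2) \<gamma> (e *s (mfract D *v ?d)))"
    using table_unique[OF tD q det(1) t' q' det(2)] by blast
  have row: "vfract (x v* \<alpha>') = df_mult (ffract f2) \<gamma> (vfract (D *v (x v* \<alpha>)))" for x
    by (rule table_row_module) (use \<gamma>(1) in \<open>simp add: row_mult_transpose\<close>)
  define \<kappa> where "\<kappa> = to_fract w' *s \<gamma>"
  have "vfract ` row_module \<alpha>' = (\<lambda>x. df_mult (ffract f2) \<kappa> (vfract (D *v x))) ` row_module \<alpha>"
  proof -
    have s: "df_mult (ffract f2) \<kappa> (vfract (D *v (x v* \<alpha>))) = vfract ((w' *s x) v* \<alpha>')" for x
      by (simp add: row vector_matrix_linear matrix_vector_scale df_mult_scale \<kappa>_def)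
    have "row_module \<alpha>' = (\<lambda>x. (w' *s x) v* \<alpha>') ` UNIV"
    proof -
      have "x v* \<alpha>' = (w' *s (w *s x)) v* \<alpha>'" for x
        using ww by (simp add: vector_matrix_linear vec_eq_iff mult.commute[of w'] flip: mult.assoc)
      then show ?thesis unfolding row_module_def by (auto simp: image_iff)
    qed
    then show ?thesis
      unfolding row_module_def[of \<alpha>] by (simp add: image_image s)
  qed
  moreover have "?d' = df_mult (ffract f2) (df_mult (ffract f2) \<kappa> \<kappa>) (mfract D *v ?d)"
    unfolding \<gamma>(2) by (simp add: \<kappa>_def df_mult_scale df_mult_assoc e_def power2_eq_square)
  ultimately have mid: "coord_equiv f1 (row_module \<alpha>) ?d f2 (row_module \<alpha>') ?d'"
    using D unfolding coord_equiv_def by blast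
  obtain R where R: "H' ** R = mat 1" "R ** H' = mat 1"
    using df_isoD(3)[OF H'] by (auto simp: invertible_def)
  have "coord_equiv f2 (row_module \<alpha>') ?d' f' ((*v) R ` row_module \<alpha>') (mfract R *v ?d')"
    by (rule coord_equiv_iso[OF df_iso_inverse[OF H' R]])
  moreover have "(*v) R ` row_module \<alpha>' = L'"
    by (simp add: image_image matrix_vector_mul_assoc R flip: L')
  moreover have "mfract R *v ?d' = \<delta>'"
    by (simp add: matrix_vector_mul_assoc R flip: mfract_mult)
  ultimately have "coord_equiv f2 (row_module \<alpha>') ?d' f' L' \<delta>'" by simp
  then show ?thesis
    using coord_equiv_iso[OF H, of L \<delta>] mid coord_equiv_trans unfolding L by metis
qed

section \<open>Every nondegenerate pair is represented\<close>

lemma row_module_ideal: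
  fixes \<alpha> :: "'k::comm_ring_1 ^ 3 ^ 3"
  assumes "\<And>i. df_mult f (axis 2 1) (\<alpha> $ i) = W $ i v* \<alpha>" "\<And>i. df_mult f (axis 3 1) (\<alpha> $ i) = Z $ i v* \<alpha>"
  shows "df_mult f y (x v* \<alpha>) = act W Z y x v* \<alpha>"
proof -
  have y: "y = y$1 *s vone + y$2 *s axis 2 1 + y$3 *s axis 3 1"
    by (simp add: vec_eq_iff forall_3)
  have "df_mult f (axis 2 1) (x v* \<alpha>) = (x v* W) v* \<alpha>" "df_mult f (axis 3 1) (x v* \<alpha>) = (x v* Z) v* \<alpha>"
    by (simp_all add: df_mult_commute[of f "axis _ _"] df_mult_rows)
      (simp_all add: df_mult_commute[of f _ "axis _ _"] assms vector_matrix_rows[of x] vector_matrix_linear)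
  then show ?thesis
    by (subst y) (simp add: df_mult_add df_mult_scale act_def vector_matrix_linear)
qed

lemma pair_represented:
  fixes A B :: "'a::idom ^ 3 ^ 3"
  assumes v: "(A, B) \<in> nondegenerate_pairs" and S: "has_cofinal_cubes S"
  obtains f \<alpha> \<delta> m C where "df_disc f \<noteq> 0" "det \<alpha> = m ^ 3" "m \<noteq> 0" "m ^ 3 \<in> S"
    "df_norm (ffract f) \<delta> = (to_fract (m ^ 3))\<^sup>2"
    "has_table (ffract f) (mfract \<alpha>) \<delta> (mfract C) (mfract B) (mfract A)"
    "\<And>x y. x \<in> row_module \<alpha> \<Longrightarrow> df_mult f y x \<in> row_module \<alpha>"
proof -
  define f where "f = pair_form A B"
  have sym: "transpose A = A" "transpose B = B" and disc: "df_disc f \<noteq> 0"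
    using v by (auto simp: nondegenerate_pairs_def V_space_def pair_disc_eq f_def)
  have symK: "transpose (mfract A) = mfract A" "transpose (mfract B) = mfract B"
    using sym by (simp_all flip: mfract_simps)
  have fK: "pair_form (mfract A) (mfract B) = ffract f" by (simp add: pair_form_mfract f_def)
  define W Z C where "W = - (B ** adj3 A)" and "Z = - (A ** adj3 B)" and "C = A ** mix3 A B ** B"
  have WZ: "mfract W = - (mfract B ** adj3 (mfract A))" "mfract Z = - (mfract A ** adj3 (mfract B))"
    "mfract C = mfract A ** mix3 (mfract A) (mfract B) ** mfract B"
    by (simp_all add: W_def Z_def C_def mfract_mult mfract_adj3 mfract_mix3)
  obtain \<alpha>0 \<delta>0 where t: "has_table (ffract f) \<alpha>0 \<delta>0 (mfract C) (mfract B) (mfract A)" and det0: "det \<alpha>0 \<noteq> 0"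
    and n0: "df_norm (ffract f) \<delta>0 = (det \<alpha>0)\<^sup>2"
    and a0: "\<And>i. df_mult (ffract f) (axis 2 1) (\<alpha>0 $ i) = mfract W $ i v* \<alpha>0"
      "\<And>i. df_mult (ffract f) (axis 3 1) (\<alpha>0 $ i) = mfract Z $ i v* \<alpha>0"
    using table_exists[OF symK] disc unfolding fK WZ[symmetric] df_disc_ffract to_fract_eq_0_iff by metis
  define n where "n = det \<alpha>0"
  \<comment> \<open>\<open>s\<close> clears the denominators of the rows of \<delta>0 \<alpha>0 / n,
    so any multiple m of \<open>s\<close> makes the rows of \<kappa> \<alpha>0 integral.\<close>
  obtain s M where s: "s \<noteq> 0" and M: "\<And>i. to_fract s *s ((1 / n) *s df_mult (ffract f) \<delta>0 (\<alpha>0 $ i)) = vfract (M $ i)"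
    using common_denominator_matrix[of "\<chi> i. (1 / n) *s df_mult (ffract f) \<delta>0 (\<alpha>0 $ i)"] by auto
  obtain m where m: "m \<noteq> 0" "s dvd m" "m ^ 3 \<in> S"
    using S s unfolding has_cofinal_cubes_def by blast
  then obtain r where r: "m = s * r" by (auto elim: dvdE)
  define \<kappa> where "\<kappa> = (to_fract m / n) *s \<delta>0"
  define \<alpha> where "\<alpha> = (\<chi> i. r *s M $ i)"
  define \<delta> where "\<delta> = df_mult (ffract f) (df_mult (ffract f) \<kappa> \<kappa>) \<delta>0"
  have \<alpha>: "mfract \<alpha> $ i = df_mult (ffract f) \<kappa> (\<alpha>0 $ i)" for i
  proof -
    have "mfract \<alpha> $ i = to_fract r *s vfract (M $ i)" by (simp add: \<alpha>_def)
    then show ?thesis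
      unfolding M[symmetric] by (simp add: \<kappa>_def df_mult_scale r vec_eq_iff)
  qed
  have m\<alpha>: "mfract \<alpha> = \<alpha>0 ** transpose (df_mat (ffract f) \<kappa>)"
    unfolding vec_eq_iff[of "mfract \<alpha>"] by (simp only: \<alpha> row_mult_transpose df_mat_vector) simp
  have N\<kappa>: "df_norm (ffract f) \<kappa> = to_fract (m ^ 3) / n"
    using det0 by (simp add: \<kappa>_def df_norm_scale n0 n_def to_fract_power power_divide power2_eq_square power3_eq_cube)
  have "to_fract (det \<alpha>) = n * df_norm (ffract f) \<kappa>"
    unfolding det_mfract[symmetric] m\<alpha> by (simp add: det_mul det_transpose n_def df_norm_def)
  then have "to_fract (det \<alpha>) = to_fract (m ^ 3)"
    using det0 by (simp add: N\<kappa> n_def)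
  then have det: "det \<alpha> = m ^ 3" by simp
  have norm: "df_norm (ffract f) \<delta> = (to_fract (m ^ 3))\<^sup>2"
    using det0 by (simp add: \<delta>_def df_norm_mult N\<kappa> n0 n_def power2_eq_square)
  have tab: "has_table (ffract f) (mfract \<alpha>) \<delta> (mfract C) (mfract B) (mfract A)"
    unfolding has_table_def
  proof (intro allI)
    fix i j
    have "df_mult (ffract f) (mfract \<alpha> $ i) (mfract \<alpha> $ j)
        = df_mult (ffract f) (df_mult (ffract f) \<kappa> \<kappa>) (df_mult (ffract f) (\<alpha>0 $ i) (\<alpha>0 $ j))"
      unfolding \<alpha> by (simp only: df_mult_ac)
    then show "df_mult (ffract f) (mfract \<alpha> $ i) (mfract \<alpha> $ j)
        = df_mult (ffract f) \<delta> (table (mfract C) (mfract B) (mfract A) i j)"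
      using t by (simp only: has_table_def \<delta>_def df_mult_assoc)
  qed
  \<comment> \<open>\<alpha>0 lives over the fraction field, but \<open>W\<close> and
    \<open>Z\<close> have entries in T and scaling by \<kappa> does not change them. This makes the
    integral lattice an ideal.\<close>
  have act: "df_mult f (axis 2 1) (\<alpha> $ i) = W $ i v* \<alpha>" "df_mult f (axis 3 1) (\<alpha> $ i) = Z $ i v* \<alpha>" for i
  proof -
    have k: "vfract (x v* \<alpha>) = df_mult (ffract f) \<kappa> (vfract x v* \<alpha>0)" for x
      unfolding vfract_vector_matrix m\<alpha>
      by (simp flip: vector_matrix_mul_assoc df_mat_vector)
    have "vfract (df_mult f (axis 2 1) (\<alpha> $ i)) = df_mult (ffract f) \<kappa> (df_mult (ffract f) (axis 2 1) (\<alpha>0 $ i))"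
      "vfract (df_mult f (axis 3 1) (\<alpha> $ i)) = df_mult (ffract f) \<kappa> (df_mult (ffract f) (axis 3 1) (\<alpha>0 $ i))"
      using \<alpha>[of i] by (simp_all add: vfract_df_mult df_mult_left_commute)
    then have "vfract (df_mult f (axis 2 1) (\<alpha> $ i)) = vfract (W $ i v* \<alpha>)"
      "vfract (df_mult f (axis 3 1) (\<alpha> $ i)) = vfract (Z $ i v* \<alpha>)"
      by (simp_all add: a0 k)
    then show "df_mult f (axis 2 1) (\<alpha> $ i) = W $ i v* \<alpha>" "df_mult f (axis 3 1) (\<alpha> $ i) = Z $ i v* \<alpha>"
      by simp_all
  qed
  have "df_mult f y x \<in> row_module \<alpha>" if "x \<in> row_module \<alpha>" for x y
    using that row_module_ideal[OF act] by (auto simp: row_module_def)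
  then show thesis using that[OF disc det m(1,3) norm tab] by blast
qed

section \<open>Coordinates on cubic algebras\<close>

definition coordinates :: "('k::comm_ring_1, 'c) module \<Rightarrow> 'k cubic_form \<Rightarrow> ('k ^ 3 \<Rightarrow> 'c) \<Rightarrow> bool" where
  "coordinates R f e \<longleftrightarrow> inj e \<and> carrier R = range e \<and> \<one>\<^bsub>R\<^esub> = e vone \<and> \<zero>\<^bsub>R\<^esub> = e 0 \<and>
     (\<forall>x y. e x \<oplus>\<^bsub>R\<^esub> e y = e (x + y)) \<and> (\<forall>x y. e x \<otimes>\<^bsub>R\<^esub> e y = e (df_mult f x y)) \<and>
     (\<forall>k x. k \<odot>\<^bsub>R\<^esub> e x = e (k *s x))"

lemma coordinatesD:
  assumes "coordinates R f e"
  shows "inj e" "carrier R = range e" "\<one>\<^bsub>R\<^esub> = e vone" "\<zero>\<^bsub>R\<^esub> = e 0"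
    "e x \<oplus>\<^bsub>R\<^esub> e y = e (x + y)" "e x \<otimes>\<^bsub>R\<^esub> e y = e (df_mult f x y)" "k \<odot>\<^bsub>R\<^esub> e x = e (k *s x)"
  using assms by (auto simp: coordinates_def)

lemma coordinates_inj: "coordinates R f e \<Longrightarrow> e x = e y \<longleftrightarrow> x = y"
  using coordinatesD(1) by (metis injD)

lemma coordinates_algebra:
  fixes R :: "('k::comm_ring_1, 'c) module"
  assumes c: "coordinates R f e"
  shows "Module.algebra (ring_of_type_algebra :: 'k ring) R"
proof -
  note D = coordinatesD[OF c]
  have inv: "\<exists>z. e (x + z) = e 0" for x
    by (rule exI[of _ "- x"]) simp
  have "abelian_group R"
    by (rule abelian_groupI) (auto simp: D(2-) inv ac_simps)
  moreover have "comm_monoid R"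
    by (rule comm_monoidI) (auto simp: D(2-) df_mult_assoc df_mult_commute[of f])
  ultimately have cr: "cring R"
    by (rule cringI) (auto simp: D(2-) df_mult_add)
  show ?thesis
    by (rule algebraI[OF cring_from_type_algebra cr])
      (auto simp: D(2-) df_mult_scale ring_of_type_algebra_def vec_eq_iff algebra_simps
        intro!: arg_cong[of _ _ e])
qed

lemma lincomb_coordinates:
  fixes R :: "('k::comm_ring_1, 'c) module"
  assumes c: "coordinates R f e"
  shows "lincomb R (\<lambda>i. e (\<beta> $ i)) u = e (u v* \<beta>)"
proof -
  note D = coordinatesD[OF c]
  interpret Module.algebra "ring_of_type_algebra :: 'k ring" R by (rule coordinates_algebra[OF c])
  have "lincomb R (\<lambda>i. e (\<beta> $ i)) u = e (u$1 *s \<beta>$1) \<oplus>\<^bsub>R\<^esub> (e (u$2 *s \<beta>$2) \<oplus>\<^bsub>R\<^esub> (e (u$3 *s \<beta>$3) \<oplus>\<^bsub>R\<^esub> \<zero>\<^bsub>R\<^esub>))"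
    unfolding lincomb_def D(7) UNIV_3 by (subst M.finsum_insert; (simp add: D(2))?)+
  then show ?thesis by (simp add: D(4,5) vector_matrix_rows add.assoc)
qed

lemma family_coordinates:
  assumes "coordinates R f e" "range b \<subseteq> carrier R"
  obtains \<beta> where "b = (\<lambda>i. e (\<beta> $ i))"
proof -
  have "\<forall>i. \<exists>x. b i = e x" using assms(2) by (auto simp: coordinatesD(2)[OF assms(1)])
  then obtain x where "\<And>i. b i = e (x i)" by metis
  then have "b = (\<lambda>i. e ((\<chi> i. x i) $ i))" by auto
  then show thesis by (rule that)
qed

lemma is_basis_row_module:
  fixes R :: "('k::idom, 'c) module"
  assumes c: "coordinates R f e" and d: "det \<beta> \<noteq> 0"
  shows "is_basis R (e ` row_module \<beta>) (\<lambda>i. e (\<beta> $ i))"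
proof -
  have "inj (\<lambda>u. e (u v* \<beta>))"
    using vector_matrix_cancel[OF d] coordinates_inj[OF c] by (auto intro: injI)
  moreover have "\<beta> $ i \<in> row_module \<beta>" for i
    unfolding row_module_def using row_matrix_mult[of "mat 1" \<beta> i] by auto
  moreover have "lincomb R (\<lambda>i. e (\<beta> $ i)) = (\<lambda>u. e (u v* \<beta>))"
    using lincomb_coordinates[OF c] by auto
  ultimately show ?thesis
    by (auto simp: is_basis_def bij_betw_def row_module_def)
qed

text \<open>A kernel vector over the fraction field becomes one over T after clearing denominators,
  so linear algebra over the field applies.\<close>

lemma row_injective_det:
  fixes \<beta> :: "'a::idom ^ 3 ^ 3"
  assumes "\<And>u. u v* \<beta> = 0 \<Longrightarrow> u = 0"
  shows "det \<beta> \<noteq> 0"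
proof -
  have ker: "x = 0" if "x v* mfract \<beta> = 0" for x
  proof -
    obtain t u where t: "t \<noteq> 0" "to_fract t *s x = vfract u" using common_denominator .
    have "vfract (u v* \<beta>) = to_fract t *s (x v* mfract \<beta>)"
      by (simp add: vfract_vector_matrix vector_matrix_linear flip: t(2))
    then have "vfract (u v* \<beta>) = vfract 0" using that by (simp del: vfract_simps)  (simp add: vec_eq_iff)
    then have "u = 0" using assms vfract_inj by blast
    then show ?thesis using t by (simp add: vec_eq_iff)
  qed
  have "inj ((*v) (transpose (mfract \<beta>)))"
  proof (rule injI)
    fix x y assume "transpose (mfract \<beta>) *v x = transpose (mfract \<beta>) *v y"
    then have "(x - y) v* mfract \<beta> = 0" by (simp add: vector_matrix_linear)
    then show "x = y" using ker by fastforce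
  qed
  then obtain N where "N ** transpose (mfract \<beta>) = mat 1"
    using matrix_left_invertible_injective by blast
  then have "det N * to_fract (det \<beta>) = 1" by (metis det_I det_mul det_transpose det_mfract)
  then show ?thesis by auto
qed

lemma is_basis_coordinates:
  fixes R :: "('k::idom, 'c) module"
  assumes c: "coordinates R f e" and b: "is_basis R M (\<lambda>i. e (\<beta> $ i))"
  shows "M = e ` row_module \<beta>" "det \<beta> \<noteq> 0"
proof -
  have l: "lincomb R (\<lambda>i. e (\<beta> $ i)) = (\<lambda>u. e (u v* \<beta>))"
    using lincomb_coordinates[OF c] by auto
  have bij: "bij_betw (\<lambda>u. e (u v* \<beta>)) UNIV M" using b by (simp add: is_basis_def l)
  then show "M = e ` row_module \<beta>" by (auto simp: bij_betw_def row_module_def)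
  show "det \<beta> \<noteq> 0"
  proof (rule row_injective_det)
    fix u assume "u v* \<beta> = 0"
    then have "e (u v* \<beta>) = e (0 v* \<beta>)" by (simp add: vector_matrix_linear)
    then show "u = 0" using bij by (metis UNIV_I bij_betw_def inj_onD)
  qed
qed

lemma is_basis_carrier:
  fixes R :: "('k::idom, 'c) module"
  assumes c: "coordinates R f e" and b: "is_basis R (carrier R) b"
  obtains \<beta> \<gamma> where "b = (\<lambda>i. e (\<beta> $ i))" "\<beta> ** \<gamma> = mat 1" "\<gamma> ** \<beta> = mat 1"
    "\<And>y. coords R b (e y) = y v* \<gamma>" "\<And>x. mult_matrix R b (e x) = transpose \<gamma> ** df_mat f x ** transpose \<beta>"
proof -
  obtain \<beta> where \<beta>: "b = (\<lambda>i. e (\<beta> $ i))"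
    using family_coordinates[OF c] b by (metis is_basis_def)
  have "e ` UNIV = e ` row_module \<beta>"
    using is_basis_coordinates(1)[OF c b[unfolded \<beta>]] coordinatesD(2)[OF c] by simp
  then have "row_module \<beta> = row_module (mat 1)"
    by (simp add: inj_image_eq_iff[OF coordinatesD(1)[OF c]] row_module_def)
  then obtain h where "invertible h" "\<beta> = h ** mat 1"
    using row_module_basis_unique[of "mat 1" \<beta>] by (metis det_I zero_neq_one)
  then obtain \<gamma> where \<gamma>: "\<beta> ** \<gamma> = mat 1" "\<gamma> ** \<beta> = mat 1"
    by (auto simp: invertible_def)
  have co: "coords R b (e y) = y v* \<gamma>" for y
  proof -
    have "lincomb R b (y v* \<gamma>) = e y"
      by (simp add: \<beta> lincomb_coordinates[OF c] vector_matrix_mul_assoc \<gamma>)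
    moreover have "inj (lincomb R b)" using b by (simp add: is_basis_def bij_betw_def)
    ultimately show ?thesis by (metis coords_def inv_f_f)
  qed
  have "mult_matrix R b (e x) = transpose \<gamma> ** df_mat f x ** transpose \<beta>" for x
  proof -
    have "mult_matrix R b (e x) $ i $ j = (transpose \<gamma> ** (df_mat f x ** transpose \<beta>)) $ i $ j" for i j
    proof -
      have "mult_matrix R b (e x) $ i $ j = (transpose \<gamma> *v (df_mat f x *v (\<beta> $ j))) $ i"
        by (simp add: mult_matrix_def \<beta>[THEN fun_cong] coordinatesD(6)[OF c] co df_mat_vector)
      then show ?thesis
        by (simp add: matrix_matrix_mult_def matrix_vector_mult_def transpose_def sum_3)
    qed
    then show ?thesis by (simp add: vec_eq_iff matrix_mul_assoc)
  qed
  then show thesis using that \<beta> \<gamma> co by blast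
qed

lemma axis_basis:
  fixes R :: "('k::idom, 'c) module"
  assumes c: "coordinates R f e"
  shows "is_basis R (carrier R) (\<lambda>i. e (axis i 1))"
proof -
  have "is_basis R (e ` row_module (mat 1)) (\<lambda>i. e (mat 1 $ i))"
    by (rule is_basis_row_module[OF c]) simp
  moreover have "(mat 1 :: 'k ^ 3 ^ 3) $ i = axis i 1" for i
    by (simp add: mat_def axis_def vec_eq_iff)
  ultimately show ?thesis by (simp add: row_module_def coordinatesD(2)[OF c])
qed

text \<open>Multiplication matrices in different bases are conjugate, so the definite description in
  \<open>alg_norm\<close> has a unique candidate.\<close>

lemma alg_norm_coordinates:
  fixes R :: "('k::idom, 'c) module"
  assumes c: "coordinates R f e"
  shows "alg_norm R (e x) = df_norm f x"
proof -
  have "det (mult_matrix R b (e x)) = df_norm f x" if b: "is_basis R (carrier R) b" for b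
  proof -
    obtain \<beta> \<gamma> where "\<beta> ** \<gamma> = mat 1" "mult_matrix R b (e x) = transpose \<gamma> ** df_mat f x ** transpose \<beta>"
      using is_basis_carrier[OF c b] by metis
    then have "det (mult_matrix R b (e x)) = (det \<beta> * det \<gamma>) * df_norm f x"
      by (simp add: det_mul det_transpose df_norm_def)
    moreover have "det \<beta> * det \<gamma> = 1" using \<open>\<beta> ** \<gamma> = mat 1\<close> by (metis det_I det_mul)
    ultimately show ?thesis by simp
  qed
  then show ?thesis
    unfolding alg_norm_def using axis_basis[OF c] by (intro the_equality) auto
qed

lemma basis_disc_coordinates:
  fixes R :: "('k::idom, 'c) module"
  assumes c: "coordinates R f e" and b: "is_basis R (carrier R) b"
  shows "\<exists>u. u dvd 1 \<and> basis_disc R b = u * df_disc f"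
proof -
  obtain \<beta> \<gamma> where \<beta>: "b = (\<lambda>i. e (\<beta> $ i))" "\<beta> ** \<gamma> = mat 1" "\<gamma> ** \<beta> = mat 1"
    and m: "\<And>x. mult_matrix R b (e x) = transpose \<gamma> ** df_mat f x ** transpose \<beta>"
    using is_basis_carrier[OF c b] by metis
  have tr: "trace (mult_matrix R b (e x)) = df_trace f x" for x
  proof -
    have "trace (mult_matrix R b (e x)) = trace (df_mat f x ** (transpose \<beta> ** transpose \<gamma>))"
      unfolding m by (subst matrix_mul_assoc[symmetric], subst trace_mul_sym) (simp add: matrix_mul_assoc)
    also have "transpose \<beta> ** transpose \<gamma> = mat 1"
      by (simp add: \<beta>(3) transpose_mat flip: matrix_transpose_mul)
    finally show ?thesis by (simp add: df_trace_def)
  qed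
  have "(\<chi> i j. trace (mult_matrix R b (b i \<otimes>\<^bsub>R\<^esub> b j))) = \<beta> ** df_gram f ** transpose \<beta>"
    unfolding vec_eq_iff
    by (simp add: \<beta>(1)[THEN fun_cong] coordinatesD(6)[OF c] tr df_trace_mult)
      (simp add: matrix_matrix_mult_def matrix_vector_mult_def transpose_def sum_3 algebra_simps)
  then have "basis_disc R b = (det \<beta> * det \<beta>) * df_disc f"
    by (simp add: basis_disc_def det_mul det_transpose det_df_gram)
  moreover have "det \<beta> * det \<beta> dvd 1"
  proof -
    have "det \<beta> * det \<gamma> = 1" using \<beta>(2) by (metis det_I det_mul)
    then have "det \<beta> dvd 1" by (metis dvdI)
    then show ?thesis using mult_dvd_mono[of "det \<beta>" 1 "det \<beta>" 1] by simp
  qed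
  ultimately show ?thesis by blast
qed

lemma nondegenerate_coordinates:
  fixes R :: "('k::idom, 'c) module"
  assumes c: "coordinates R f e"
  shows "nondegenerate_cubic_ring R \<longleftrightarrow> df_disc f \<noteq> 0"
proof
  assume "nondegenerate_cubic_ring R"
  then show "df_disc f \<noteq> 0"
    unfolding nondegenerate_cubic_ring_def using basis_disc_coordinates[OF c] by fastforce
next
  assume d: "df_disc f \<noteq> 0"
  obtain u where "u dvd 1" "basis_disc R (\<lambda>i. e (axis i 1)) = u * df_disc f"
    using basis_disc_coordinates[OF c axis_basis[OF c]] by blast
  then have "basis_disc R (\<lambda>i. e (axis i 1)) \<noteq> 0" using d by auto
  then show "nondegenerate_cubic_ring R"
    unfolding nondegenerate_cubic_ring_def cubic_ring_def
    using axis_basis[OF c] coordinates_algebra[OF c] by blast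
qed

text \<open>Whatever bases are taken, the determinant is a unit times det \<alpha>, so the
  description selects the representative of one fixed class. The last claim serves lattices built
  with determinant in \<open>S\<close>.\<close>

lemma ideal_norm_rep_coordinates:
  fixes R :: "('k::idom, 'c) module"
  assumes c: "coordinates R f e" and d: "det \<alpha> \<noteq> 0" and S: "unit_orbit_reps S"
  shows "ideal_norm_rep S R (e ` row_module \<alpha>) \<in> S"
    "\<exists>u. u dvd 1 \<and> ideal_norm_rep S R (e ` row_module \<alpha>) = u * det \<alpha>"
    "s \<in> S \<Longrightarrow> s = det \<alpha> \<Longrightarrow> ideal_norm_rep S R (e ` row_module \<alpha>) = s"
proof -
  have assoc: "s dvd x \<and> x dvd s \<longleftrightarrow> (\<exists>u. u dvd 1 \<and> s = u * x)" if "x \<noteq> 0" for s x :: 'k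
  proof
    assume "s dvd x \<and> x dvd s"
    then obtain p q where p: "x = s * p" and q: "s = x * q" by (metis dvdE)
    then have "x * (q * p) = x * 1" by (metis mult.assoc mult_1_right)
    then have "q * p = 1" using that by (metis mult_cancel_left)
    then have "q dvd 1" by (metis dvdI)
    then show "\<exists>u. u dvd 1 \<and> s = u * x" using q by (metis mult.commute)
  next
    assume "\<exists>u. u dvd 1 \<and> s = u * x"
    then obtain u v where "s = u * x" "u * v = 1" by (metis dvdE)
    then have "x = s * v" by (metis mult.assoc mult.commute mult_1)
    then have "s dvd x" by (metis dvdI)
    then show "s dvd x \<and> x dvd s" using \<open>s = u * x\<close> by simp
  qed
  let ?P = "\<lambda>s. s \<in> S \<and> (\<exists>b c. is_basis R (carrier R) b \<and> is_basis R (e ` row_module \<alpha>) c \<and>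
           (let d = det (\<chi> i j. coords R b (c j) $ i) in s dvd d \<and> d dvd s))"
  have det: "\<exists>v. v dvd 1 \<and> det (\<chi> i j. coords R b (c' j) $ i) = v * det \<alpha>"
    if b: "is_basis R (carrier R) b" and c': "is_basis R (e ` row_module \<alpha>) c'" for b c'
  proof -
    obtain \<beta> \<gamma> where \<gamma>: "\<beta> ** \<gamma> = mat 1" "\<And>y. coords R b (e y) = y v* \<gamma>"
      using is_basis_carrier[OF c b] by metis
    have "range c' \<subseteq> carrier R"
      using c' coordinatesD(2)[OF c] unfolding is_basis_def by blast
    then obtain \<alpha>' where \<alpha>': "c' = (\<lambda>i. e (\<alpha>' $ i))" using family_coordinates[OF c] by metis
    have "row_module \<alpha> = row_module \<alpha>'"
      using is_basis_coordinates(1)[OF c c'[unfolded \<alpha>']] by (simp add: inj_image_eq_iff[OF coordinatesD(1)[OF c]])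
    then obtain h where h: "invertible h" "\<alpha>' = h ** \<alpha>"
      using row_module_basis_unique[of \<alpha> \<alpha>'] d by metis
    have "(\<chi> i j. coords R b (c' j) $ i) = transpose (\<alpha>' ** \<gamma>)"
      by (simp add: vec_eq_iff \<alpha>' \<gamma> transpose_def row_matrix_mult)
    then have "det (\<chi> i j. coords R b (c' j) $ i) = (det h * det \<gamma>) * det \<alpha>"
      by (simp add: det_transpose h det_mul)
    moreover have "det \<gamma> dvd 1" using \<gamma>(1) by (metis det_I det_mul dvd_triv_right)
    then have "det h * det \<gamma> dvd 1"
      using h(1) mult_dvd_mono[of "det h" 1 "det \<gamma>" 1] by (simp add: invertible_iff_det_unit)
    ultimately show ?thesis by blast
  qed
  have P: "?P s \<longleftrightarrow> s \<in> S \<and> (\<exists>u. u dvd 1 \<and> s = u * det \<alpha>)" for s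
  proof -
    have "s dvd v * det \<alpha> \<and> v * det \<alpha> dvd s \<longleftrightarrow> s dvd det \<alpha> \<and> det \<alpha> dvd s" if v: "v dvd 1" for v
    proof -
      obtain w where "1 = v * w" using v by (rule dvdE)
      then have w: "v * w = 1" by simp
      have "v * det \<alpha> * w = (v * w) * det \<alpha>" by (simp only: ac_simps)
      then have "det \<alpha> = (v * det \<alpha>) * w" by (simp add: w)
      then have "v * det \<alpha> dvd det \<alpha>" by (rule dvdI)
      moreover have "det \<alpha> dvd v * det \<alpha>" by simp
      ultimately show ?thesis by (meson dvd_trans)
    qed
    note assoc' = this
    have "(\<exists>b c. is_basis R (carrier R) b \<and> is_basis R (e ` row_module \<alpha>) c \<and>
           (let d = det (\<chi> i j. coords R b (c j) $ i) in s dvd d \<and> d dvd s)) \<longleftrightarrow> s dvd det \<alpha> \<and> det \<alpha> dvd s"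
    proof
      assume "\<exists>b c. is_basis R (carrier R) b \<and> is_basis R (e ` row_module \<alpha>) c \<and>
           (let d = det (\<chi> i j. coords R b (c j) $ i) in s dvd d \<and> d dvd s)"
      then obtain b c where bc: "is_basis R (carrier R) b" "is_basis R (e ` row_module \<alpha>) c"
        and s: "s dvd det (\<chi> i j. coords R b (c j) $ i) \<and> det (\<chi> i j. coords R b (c j) $ i) dvd s"
        by (auto simp: Let_def)
      obtain v where "v dvd 1" "det (\<chi> i j. coords R b (c j) $ i) = v * det \<alpha>"
        using det[OF bc] by blast
      then show "s dvd det \<alpha> \<and> det \<alpha> dvd s" using assoc' s by simp
    next
      assume s: "s dvd det \<alpha> \<and> det \<alpha> dvd s"
      let ?b = "\<lambda>i. e (axis i 1)" and ?c = "\<lambda>i. e (\<alpha> $ i)"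
      obtain v where "v dvd 1" "det (\<chi> i j. coords R ?b (?c j) $ i) = v * det \<alpha>"
        using det[OF axis_basis[OF c] is_basis_row_module[OF c d]] by blast
      then have "let d = det (\<chi> i j. coords R ?b (?c j) $ i) in s dvd d \<and> d dvd s"
        using assoc' s by (simp add: Let_def)
      then show "\<exists>b c. is_basis R (carrier R) b \<and> is_basis R (e ` row_module \<alpha>) c \<and>
           (let d = det (\<chi> i j. coords R b (c j) $ i) in s dvd d \<and> d dvd s)"
        using axis_basis[OF c] is_basis_row_module[OF c d] by blast
    qed
    then show ?thesis using assoc[OF d] by simp
  qed
  have ex: "\<exists>!s. s \<in> S \<and> (\<exists>u. u dvd 1 \<and> s = u * det \<alpha>)"
    using S d unfolding unit_orbit_reps_def by blast
  have rep: "ideal_norm_rep S R (e ` row_module \<alpha>) = (THE s. s \<in> S \<and> (\<exists>u. u dvd 1 \<and> s = u * det \<alpha>))"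
    unfolding ideal_norm_rep_def P ..
  show "ideal_norm_rep S R (e ` row_module \<alpha>) \<in> S"
    "\<exists>u. u dvd 1 \<and> ideal_norm_rep S R (e ` row_module \<alpha>) = u * det \<alpha>"
    using theI'[OF ex] unfolding rep by blast+
  assume "s \<in> S" "s = det \<alpha>"
  then have "s \<in> S \<and> (\<exists>u. u dvd 1 \<and> s = u * det \<alpha>)" by (metis dvd_refl mult_1)
  then show "ideal_norm_rep S R (e ` row_module \<alpha>) = s"
    unfolding rep by (rule the1_equality[OF ex])
qed

section \<open>Coordinates on the extension of scalars\<close>

text \<open>The class of all \<open>e x / t\<close> with value \<open>z\<close>.\<close>

definition frac_coord :: "('a::idom ^ 3 \<Rightarrow> 'c) \<Rightarrow> 'a fract ^ 3 \<Rightarrow> ('c \<times> 'a) set" where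
  "frac_coord e z = {(e x, t) | x t. t \<noteq> 0 \<and> vfract x = to_fract t *s z}"

context
  fixes R :: "('a::idom, 'c) module" and f e
  assumes c: "coordinates R f e"
begin

lemma frac_of_coord:
  assumes "t \<noteq> 0" "vfract x = to_fract t *s z"
  shows "frac_of R (e x) t = frac_coord e z"
proof -
  note D = coordinatesD[OF c] coordinates_inj[OF c]
  have "t' *s x = t *s x' \<longleftrightarrow> vfract x' = to_fract t' *s z" if "t' \<noteq> 0" for x' t'
  proof -
    have "t' *s x = t *s x' \<longleftrightarrow> to_fract t' *s vfract x = to_fract t *s vfract x'"
      using vfract_inj[of "t' *s x" "t *s x'"] by simp
    also have "\<dots> \<longleftrightarrow> to_fract t *s (to_fract t' *s z) = to_fract t *s vfract x'"
      by (simp add: assms(2) mult.commute)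
    also have "\<dots> \<longleftrightarrow> to_fract t' *s z = vfract x'"
      using assms(1) by (simp add: vec_eq_iff)
    finally show ?thesis by auto
  qed
  then show ?thesis
    using assms(1) by (auto simp: frac_of_def frac_rel_def frac_coord_def D)
qed

lemma frac_coord_nonempty: "frac_coord e z \<noteq> {}"
proof -
  obtain t x where "t \<noteq> 0" "to_fract t *s z = vfract x" using common_denominator .
  then have "(e x, t) \<in> frac_coord e z" by (auto simp: frac_coord_def)
  then show ?thesis by blast
qed

lemma frac_coord_inj: "inj (frac_coord e)"
proof (rule injI)
  fix z z' assume eq: "frac_coord e z = frac_coord e z'"
  obtain t x where t: "t \<noteq> 0" "to_fract t *s z = vfract x" using common_denominator .
  then have "(e x, t) \<in> frac_coord e z" by (auto simp: frac_coord_def)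
  then have "(e x, t) \<in> frac_coord e z'" by (simp only: eq)
  then have "to_fract t *s z = to_fract t *s z'"
    using t(2) by (auto simp: frac_coord_def coordinates_inj[OF c])
  then show "z = z'" using t(1) by (simp add: vec_eq_iff)
qed

text \<open>The operations of \<open>frac_alg\<close> are unions over representatives. The family is
  constant and nonempty, so the union is its common value.\<close>

lemma UN_frac_coord:
  assumes "\<And>x t. t \<noteq> 0 \<Longrightarrow> vfract x = to_fract t *s z \<Longrightarrow> F (e x) t = Y"
  shows "(\<Union>(r, t)\<in>frac_coord e z. F r t) = Y"
proof -
  have "(\<Union>(r, t)\<in>frac_coord e z. F r t) = (\<Union>p\<in>frac_coord e z. Y)"
    using assms by (auto simp: frac_coord_def)
  then show ?thesis using frac_coord_nonempty by auto
qed

lemma frac_emb_coord: "frac_emb R (e x) = frac_coord e (vfract x)"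
  unfolding frac_emb_def by (rule frac_of_coord) simp_all

text \<open>Common denominators let every class be named by a vector over the fraction field. With
  this, all results on \<open>coordinates\<close>, the norm formula included, apply to
  \<open>frac_alg R\<close>.\<close>

lemma coordinates_frac: "coordinates (frac_alg R) (ffract f) (frac_coord e)"
proof -
  note D = coordinatesD[OF c]
  have "carrier (frac_alg R) = range (frac_coord e)"
  proof -
    have "carrier (frac_alg R) = {frac_of R (e x) t | x t. t \<noteq> 0}"
      by (auto simp: frac_alg_def quotient_def frac_of_def D(2))
    also have "\<dots> = range (frac_coord e)"
    proof safe
      fix x t assume t: "t \<noteq> (0::'a)"
      have "vfract x = to_fract t *s ((1 / to_fract t) *s vfract x)" using t by (simp add: vec_eq_iff)
      then show "frac_of R (e x) t \<in> range (frac_coord e)" using frac_of_coord[OF t] by blast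
    next
      fix z :: "'a fract ^ 3"
      obtain t x where t: "t \<noteq> 0" "to_fract t *s z = vfract x" using common_denominator .
      then have "frac_coord e z = frac_of R (e x) t" using frac_of_coord[OF t(1) t(2)[symmetric]] by simp
      then show "\<exists>x t. frac_coord e z = frac_of R (e x) t \<and> t \<noteq> 0" using t(1) by blast
    qed
    finally show ?thesis .
  qed
  moreover have "\<one>\<^bsub>frac_alg R\<^esub> = frac_coord e vone"
    using frac_of_coord[of 1 vone vone] by (simp add: frac_alg_def D(3))
  moreover have "\<zero>\<^bsub>frac_alg R\<^esub> = frac_coord e 0"
    using frac_of_coord[of 1 0 0] by (simp add: frac_alg_def D(4))
  moreover have "frac_coord e y \<oplus>\<^bsub>frac_alg R\<^esub> frac_coord e z = frac_coord e (y + z)" for y z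
  proof -
    have "(\<Union>(r, t)\<in>frac_coord e y. \<Union>(r', t')\<in>frac_coord e z.
        frac_of R (t' \<odot>\<^bsub>R\<^esub> r \<oplus>\<^bsub>R\<^esub> t \<odot>\<^bsub>R\<^esub> r') (t * t')) = frac_coord e (y + z)"
    proof (intro UN_frac_coord)
      fix x t x' t' assume t: "t \<noteq> 0" "vfract x = to_fract t *s y" and t': "t' \<noteq> 0" "vfract x' = to_fract t' *s z"
      have "vfract (t' *s x + t *s x') = to_fract (t * t') *s (y + z)"
        by (simp only: vfract_simps t t') (simp add: vec_eq_iff algebra_simps)
      then show "frac_of R (t' \<odot>\<^bsub>R\<^esub> e x \<oplus>\<^bsub>R\<^esub> t \<odot>\<^bsub>R\<^esub> e x') (t * t') = frac_coord e (y + z)"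
        using frac_of_coord t(1) t'(1) by (simp only: D mult_eq_0_iff de_Morgan_disj not_False_eq_True simp_thms)
    qed
    then show ?thesis by (simp only: frac_alg_def ring_record_simps)
  qed
  moreover have "frac_coord e y \<otimes>\<^bsub>frac_alg R\<^esub> frac_coord e z = frac_coord e (df_mult (ffract f) y z)" for y z
  proof -
    have "(\<Union>(r, t)\<in>frac_coord e y. \<Union>(r', t')\<in>frac_coord e z.
        frac_of R (r \<otimes>\<^bsub>R\<^esub> r') (t * t')) = frac_coord e (df_mult (ffract f) y z)"
    proof (intro UN_frac_coord)
      fix x t x' t' assume t: "t \<noteq> 0" "vfract x = to_fract t *s y" and t': "t' \<noteq> 0" "vfract x' = to_fract t' *s z"
      have "vfract (df_mult f x x') = to_fract (t * t') *s df_mult (ffract f) y z"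
        by (simp only: vfract_df_mult t t' df_mult_scale) (simp add: vec_eq_iff algebra_simps)
      then show "frac_of R (e x \<otimes>\<^bsub>R\<^esub> e x') (t * t') = frac_coord e (df_mult (ffract f) y z)"
        using frac_of_coord t(1) t'(1) by (simp only: D mult_eq_0_iff de_Morgan_disj not_False_eq_True simp_thms)
    qed
    then show ?thesis by (simp only: frac_alg_def monoid.simps)
  qed
  moreover have "k \<odot>\<^bsub>frac_alg R\<^esub> frac_coord e z = frac_coord e (k *s z)" for k z
  proof -
    have *: "(\<Union>(r, t)\<in>frac_coord e z. frac_of R (a \<odot>\<^bsub>R\<^esub> r) (s * t)) = frac_coord e (k *s z)"
      if "s \<noteq> 0" "Fraction_Field.Fract a s = k" for a s
    proof (rule UN_frac_coord)
      fix x t assume t: "t \<noteq> 0" "vfract x = to_fract t *s z"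
      have k: "k = to_fract a / to_fract s" using that by (simp add: Fract_conv_to_fract)
      show "frac_of R (a \<odot>\<^bsub>R\<^esub> e x) (s * t) = frac_coord e (k *s z)"
        unfolding D(7) by (rule frac_of_coord) (use that(1) t in \<open>simp_all add: k vec_eq_iff\<close>)
    qed
    let ?K = "{(a, s). s \<noteq> 0 \<and> Fraction_Field.Fract a s = k}"
    obtain a s where "s \<noteq> 0" "Fraction_Field.Fract a s = k" by (cases k rule: Fract_cases) auto
    then have "?K \<noteq> {}" by blast
    moreover have "(\<Union>(a, s)\<in>?K. \<Union>(r, t)\<in>frac_coord e z. frac_of R (a \<odot>\<^bsub>R\<^esub> r) (s * t))
        = (\<Union>p\<in>?K. frac_coord e (k *s z))"
    proof (rule SUP_cong[OF refl])
      fix p assume "p \<in> ?K"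
      then obtain a s where p: "p = (a, s)" and "s \<noteq> 0" "Fraction_Field.Fract a s = k" by auto
      then have "(\<Union>(r, t)\<in>frac_coord e z. frac_of R (a \<odot>\<^bsub>R\<^esub> r) (s * t)) = frac_coord e (k *s z)"
        by (intro *)
      then show "(case p of (a, s) \<Rightarrow> \<Union>(r, t)\<in>frac_coord e z. frac_of R (a \<odot>\<^bsub>R\<^esub> r) (s * t))
          = frac_coord e (k *s z)" by (simp only: p prod.case)
    qed
    ultimately have "(\<Union>(a, s)\<in>?K. \<Union>(r, t)\<in>frac_coord e z. frac_of R (a \<odot>\<^bsub>R\<^esub> r) (s * t))
        = frac_coord e (k *s z)" by (simp only: UN_constant if_False)
    then show ?thesis by (simp only: frac_alg_def module.simps)
  qed
  ultimately show ?thesis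
    unfolding coordinates_def using frac_coord_inj by blast
qed

lemma Units_frac:
  "frac_coord e d \<in> Units (frac_alg R) \<longleftrightarrow> (\<exists>q. df_mult (ffract f) d q = vone)"
proof -
  note D = coordinatesD[OF coordinates_frac] coordinates_inj[OF coordinates_frac]
  show ?thesis by (auto simp: Units_def D df_mult_commute[of _ d])
qed

end

lemma frac_map_coord:
  fixes R R' :: "('a::idom, 'c) module"
  assumes c: "coordinates R f e" and c': "coordinates R' f' e'" and \<phi>: "\<And>x. \<phi> (e x) = e' (H *v x)"
  shows "frac_map R' \<phi> (frac_coord e z) = frac_coord e' (mfract H *v z)"
  unfolding frac_map_def
  by (rule UN_frac_coord[OF c], unfold \<phi>, rule frac_of_coord[OF c'])
    (simp_all add: vfract_matrix_vector matrix_vector_scale)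

section \<open>Existence of coordinates over a principal ideal domain\<close>

lemma principal_bezout:
  fixes x y :: "'a::idom"
  assumes "principal_domain (ring_of_type_algebra :: 'a ring)"
  obtains g s t a b where "x = g * a" "y = g * b" "g = s * x + t * y" "s * a + t * b = 1"
proof -
  define R where "R = (ring_of_type_algebra :: 'a ring)"
  interpret principal_domain R using assms by (simp add: R_def)
  have R: "carrier R = UNIV" "\<And>p q. p \<otimes>\<^bsub>R\<^esub> q = p * q" "\<And>p q. p \<oplus>\<^bsub>R\<^esub> q = p + q"
    by (simp_all add: R_def ring_of_type_algebra_def)
  have P: "PIdl\<^bsub>R\<^esub> p = {q * p | q. True}" for p
    by (simp add: cgenideal_def R)
  have "ideal (PIdl\<^bsub>R\<^esub> x <+>\<^bsub>R\<^esub> PIdl\<^bsub>R\<^esub> y) R"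
    by (rule add_ideals; rule cgenideal_ideal) (simp_all add: R)
  then obtain g where "PIdl\<^bsub>R\<^esub> x <+>\<^bsub>R\<^esub> PIdl\<^bsub>R\<^esub> y = PIdl\<^bsub>R\<^esub> g"
    using exists_gen by blast
  then have J: "{p * x + q * y | p q. True} = {r * g | r. True}"
    by (auto simp: set_add_def' P R)
  have "1 * x + 0 * y \<in> {p * x + q * y | p q. True}" by blast
  then obtain a where a: "x = a * g" unfolding J by auto
  have "0 * x + 1 * y \<in> {p * x + q * y | p q. True}" by blast
  then obtain b where b: "y = b * g" unfolding J by auto
  have "1 * g \<in> {r * g | r. True}" by blast
  then obtain s t where g: "g = s * x + t * y" unfolding J[symmetric] by auto
  note * = a[unfolded mult.commute[of a]] b[unfolded mult.commute[of b]] g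
  show thesis
  proof (cases "g = 0")
    case True
    then have "x = 0" "y = 0" unfolding *(1,2) by simp_all
    \<comment> \<open>Even for x = y = 0 the cofactors have to satisfy s a + t b = 1, so s = a = 1
      is taken instead of zeros.\<close>
    then show thesis by (intro that[of 0 1 0 1 0]) simp_all
  next
    case False
    have "g * (s * a + t * b) = s * (g * a) + t * (g * b)" by (simp add: algebra_simps)
    also have "\<dots> = g * 1" by (simp only: *(1,2)[symmetric] *(3)[symmetric] mult_1_right)
    finally have "s * a + t * b = 1" using False by (metis mult_cancel_left)
    then show thesis using * that by blast
  qed
qed

text \<open>Two Bezout steps give h, the gcd of the three entries, which is a unit by primitivity.
  In \<open>P\<close> the second column completes (a, b) and the third completes (g, w_3), so that
  the determinant is h.\<close>

lemma unimodular_completion: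
  fixes w :: "'a::idom ^ 3"
  assumes pid: "principal_domain (ring_of_type_algebra :: 'a ring)"
    and primitive: "\<And>h r. w = h *s r \<Longrightarrow> h dvd 1"
  obtains P where "invertible P" "P *v vone = w"
proof -
  obtain g s t a b where 1: "w$1 = g * a" "w$2 = g * b" "g = s * w$1 + t * w$2" "s * a + t * b = 1"
    using principal_bezout[OF pid] .
  obtain h u v c d where 2: "g = h * c" "w$3 = h * d" "h = u * g + v * w$3" "u * c + v * d = 1"
    using principal_bezout[OF pid] .
  have "w = h *s vector [c * a, c * b, d]"
    by (simp add: vec_eq_iff forall_3 1(1,2) 2(1,2))
  then have "h dvd 1" by (rule primitive)
  define P :: "'a ^ 3 ^ 3"
    where "P = vector [vector [w$1, - t, - (v * a)], vector [w$2, s, - (v * b)], vector [w$3, 0, u]]"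
  have "det P = (s * a + t * b) * (u * g + v * w$3)"
    by (simp add: P_def det_3 1(1,2) algebra_simps)
  then have "det P = h" by (simp only: 1(4) 2(3)[symmetric] mult_1)
  then have "invertible P" using \<open>h dvd 1\<close> by (simp add: invertible_iff_det_unit)
  moreover have "(P *v vone) $ i = w $ i" for i
    using exhaust_3[of i] by (auto simp: P_def matrix_vector_mult_def sum_3)
  then have "P *v vone = w" using vec_eq_iff by blast
  ultimately show thesis by (rule that)
qed

text \<open>The unit element has coprime coordinates: if \<open>1 = h r\<close>, then every element of the algebra is
  divisible by \<open>h\<close>, in particular the elements of a basis.\<close>

lemma coordinates_exist:
  fixes R :: "('a::idom, 'c) module"
  assumes pid: "principal_domain (ring_of_type_algebra :: 'a ring)" and cub: "cubic_ring R"
  obtains f e where "coordinates R f e"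
proof -
  let ?T = "ring_of_type_algebra :: 'a ring"
  have alg: "Module.algebra ?T R" using cub by (simp add: cubic_ring_def)
  have mod: "Module.module ?T R" by (rule algebra.module[OF alg])
  interpret cring R by (rule algebra.M_cring[OF alg])
  have T: "carrier ?T = UNIV" "p \<oplus>\<^bsub>?T\<^esub> q = p + q" "p \<otimes>\<^bsub>?T\<^esub> q = p * q" "\<zero>\<^bsub>?T\<^esub> = 0" for p q
    by (simp_all add: ring_of_type_algebra_def)
  note smult = module.smult_closed[OF mod, unfolded T, OF UNIV_I]
    module.smult_l_distr[OF mod, unfolded T, OF UNIV_I UNIV_I]
    module.smult_assoc1[OF mod, unfolded T, OF UNIV_I UNIV_I]
    algebra.smult_assoc2[OF alg, unfolded T, OF UNIV_I] module.smult_l_null[OF mod, unfolded T]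
  obtain b where b: "is_basis R (carrier R) b" using cub by (auto simp: cubic_ring_def)
  have bc: "b i \<in> carrier R" for i using b by (auto simp: is_basis_def)
  define e0 where "e0 = lincomb R b"
  have bij: "inj e0" "carrier R = range e0"
    using b by (auto simp: is_basis_def bij_betw_def e0_def)
  have mem: "e0 x \<in> carrier R" for x using bij by blast
  have add: "e0 (x + y) = e0 x \<oplus>\<^bsub>R\<^esub> e0 y" for x y
    unfolding e0_def lincomb_def by (simp add: smult bc finsum_addf)
  have scale: "e0 (k *s x) = k \<odot>\<^bsub>R\<^esub> e0 x" for k x
  proof -
    have "k \<odot>\<^bsub>R\<^esub> e0 x = (\<Oplus>\<^bsub>R\<^esub>i\<in>UNIV. k \<odot>\<^bsub>R\<^esub> (x $ i \<odot>\<^bsub>R\<^esub> b i))"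
      unfolding e0_def lincomb_def by (rule module.finsum_smult_ldistr[OF mod]) (simp_all add: T smult bc)
    then show ?thesis by (simp add: e0_def lincomb_def smult bc)
  qed
  obtain w where w: "e0 w = \<one>\<^bsub>R\<^esub>" using bij(2) one_closed by (metis imageE)
  have "h dvd 1" if "w = h *s r" for h r
  proof -
    obtain y where y: "e0 y = e0 r \<otimes>\<^bsub>R\<^esub> e0 vone" using bij(2) m_closed[OF mem mem] by (metis imageE)
    have "e0 vone = (h \<odot>\<^bsub>R\<^esub> e0 r) \<otimes>\<^bsub>R\<^esub> e0 vone"
      using w mem by (simp add: that scale)
    also have "\<dots> = e0 (h *s y)" by (simp add: smult mem y scale)
    finally have "vone = h *s y" using bij(1) by (metis injD)
    then have "1 = h * y $ 1" by (metis axis3_simps(1) vector_smult_component)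
    then show ?thesis by (rule dvdI)
  qed
  then obtain P where P: "invertible P" "P *v vone = w"
    using unimodular_completion[OF pid] by blast
  obtain Q where Q: "P ** Q = mat 1" "Q ** P = mat 1" using P(1) by (auto simp: invertible_def)
  define e1 where "e1 x = e0 (P *v x)" for x
  have e1: "inj e1" "carrier R = range e1" "e1 vone = \<one>\<^bsub>R\<^esub>"
  proof -
    have PQ: "P *v (Q *v x) = x" "Q *v (P *v x) = x" for x
      by (simp_all add: matrix_vector_mul_assoc Q)
    show "inj e1"
    proof (rule injI)
      fix x y assume "e1 x = e1 y"
      then have "P *v x = P *v y" unfolding e1_def by (rule injD[OF bij(1)])
      then show "x = y" by (metis PQ(2))
    qed
    have "e0 x = e1 (Q *v x)" for x by (simp add: e1_def PQ)
    then show "carrier R = range e1"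
      unfolding bij(2) by (auto simp: e1_def)
    show "e1 vone = \<one>\<^bsub>R\<^esub>" by (simp add: e1_def P w)
  qed
  have mem1: "e1 x \<in> carrier R" for x by (simp add: e1_def mem)
  have add1: "e1 (x + y) = e1 x \<oplus>\<^bsub>R\<^esub> e1 y" and scale1: "e1 (k *s x) = k \<odot>\<^bsub>R\<^esub> e1 x" for x y k
    by (simp_all add: e1_def matrix_vector_right_distrib matrix_vector_scale add scale)
  define \<mu> where "\<mu> x y = inv_into UNIV e1 (e1 x \<otimes>\<^bsub>R\<^esub> e1 y)" for x y
  have \<mu>: "e1 (\<mu> x y) = e1 x \<otimes>\<^bsub>R\<^esub> e1 y" for x y
    unfolding \<mu>_def using m_closed[OF mem1 mem1] e1(2) by (metis f_inv_into_f)
  have "cubic_product \<mu>"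
    unfolding cubic_product_def
  proof (intro conjI allI)
    fix x y z and k :: 'a
    have "e1 (\<mu> (x + y) z) = e1 (\<mu> x z + \<mu> y z)" "e1 (\<mu> (k *s x) y) = e1 (k *s \<mu> x y)"
      "e1 (\<mu> (\<mu> x y) z) = e1 (\<mu> x (\<mu> y z))" "e1 (\<mu> vone x) = e1 x"
      by (simp_all add: \<mu> add1 scale1 e1(3) mem1 l_distr smult m_assoc)
    moreover have "e1 (\<mu> x y) = e1 (\<mu> y x)"
      unfolding \<mu> by (rule m_comm[OF mem1 mem1])
    ultimately show "\<mu> (x + y) z = \<mu> x z + \<mu> y z" "\<mu> (k *s x) y = k *s \<mu> x y" "\<mu> x y = \<mu> y x"
      "\<mu> (\<mu> x y) z = \<mu> x (\<mu> y z)" "\<mu> vone x = x"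
      using e1(1) by (simp_all only: inj_eq)
  qed
  then obtain U f where U: "invertible U" "U *v vone = vone"
    "\<And>x y. U *v \<mu> x y = df_mult f (U *v x) (U *v y)"
    by (rule cubic_product_normalize) blast
  obtain V where V: "U ** V = mat 1" "V ** U = mat 1" using U(1) by (auto simp: invertible_def)
  have UV: "U *v (V *v x) = x" "V *v (U *v x) = x" for x by (simp_all add: matrix_vector_mul_assoc V)
  define e where "e x = e1 (V *v x)" for x
  have "coordinates R f e"
    unfolding coordinates_def
  proof (intro conjI allI)
    show "inj e"
    proof (rule injI)
      fix x y assume "e x = e y"
      then have "V *v x = V *v y" unfolding e_def by (rule injD[OF e1(1)])
      then show "x = y" by (metis UV(1))
    qed
    have "e1 x = e (U *v x)" for x by (simp add: e_def UV)
    then show "carrier R = range e" unfolding e1(2) by (auto simp: e_def)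
    show "\<one>\<^bsub>R\<^esub> = e vone" using U(2) UV(2)[of vone] e1(3) by (simp add: e_def)
    show "\<zero>\<^bsub>R\<^esub> = e 0"
      using scale1[of 0 "V *v 0"] mem1 by (simp add: e_def smult)
    show "e x \<oplus>\<^bsub>R\<^esub> e y = e (x + y)" for x y by (simp add: e_def add1 matrix_vector_right_distrib)
    show "k \<odot>\<^bsub>R\<^esub> e x = e (k *s x)" for k x by (simp add: e_def scale1 matrix_vector_scale)
    show "e x \<otimes>\<^bsub>R\<^esub> e y = e (df_mult f x y)" for x y
    proof -
      have "V *v df_mult f x y = \<mu> (V *v x) (V *v y)"
        using U(3)[of "V *v x" "V *v y"] UV by metis
      then show ?thesis by (simp add: e_def \<mu>)
    qed
  qed
  then show thesis by (rule that)
qed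

section \<open>Triples in coordinates\<close>

text \<open>The unit between \<open>ideal_norm_rep\<close> and det \<alpha> is the one allowed for
  in \<open>admissible\<close>, and the condition on I^2 is read off on products of basis
  elements.\<close>

lemma triple_coordinates:
  fixes S :: "'a::idom set" and R :: "('a, 'c) module"
  assumes pid: "principal_domain (ring_of_type_algebra :: 'a ring)" and S: "unit_orbit_reps S"
    and t: "(R, I, \<delta>) \<in> triples S"
  obtains f e L d where "coordinates R f e" "I = e ` L" "\<delta> = frac_coord e d" "admissible f L d"
proof -
  have nd: "nondegenerate_cubic_ring R" and I: "ideal I R" and \<delta>: "\<delta> \<in> Units (frac_alg R)"
    and sub: "frac_emb R ` (I \<cdot>\<^bsub>R\<^esub> I) \<subseteq> (\<lambda>r. \<delta> \<otimes>\<^bsub>frac_alg R\<^esub> frac_emb R r) ` carrier R"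
    and n: "(to_fract (ideal_norm_rep S R I))\<^sup>2 = alg_norm (frac_alg R) \<delta>"
    and "\<exists>b. is_basis R I b"
    using t by (auto simp: triples_def)
  then obtain b where b: "is_basis R I b" by blast
  obtain f e where c: "coordinates R f e"
    using coordinates_exist[OF pid] nd unfolding nondegenerate_cubic_ring_def by blast
  note D = coordinatesD[OF c] and K = coordinatesD[OF coordinates_frac[OF c]]
  have "range b \<subseteq> carrier R"
    using b I ideal.axioms(1) additive_subgroup.a_subset unfolding is_basis_def by blast
  then obtain \<alpha> where \<alpha>: "b = (\<lambda>i. e (\<alpha> $ i))" using family_coordinates[OF c] by metis
  have I\<alpha>: "I = e ` row_module \<alpha>" and det: "det \<alpha> \<noteq> 0"
    using is_basis_coordinates[OF c b[unfolded \<alpha>]] by blast+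
  obtain d where d: "\<delta> = frac_coord e d"
    using \<delta> K(2) by (auto simp: Units_def)
  obtain u where u: "u dvd 1" "ideal_norm_rep S R I = u * det \<alpha>"
    using ideal_norm_rep_coordinates(2)[OF c det S] I\<alpha> by blast
  have "df_norm (ffract f) d = (to_fract (u * det \<alpha>))\<^sup>2"
    using n unfolding d alg_norm_coordinates[OF coordinates_frac[OF c]] u(2) by simp
  moreover have "\<exists>z. df_mult (ffract f) (vfract (\<alpha>$i)) (vfract (\<alpha>$j)) = df_mult (ffract f) d (vfract z)" for i j
  proof -
    have "b i \<in> I" "b j \<in> I" using b by (auto simp: is_basis_def)
    then have "b i \<otimes>\<^bsub>R\<^esub> b j \<in> I \<cdot>\<^bsub>R\<^esub> I" by (rule ideal_prod.prod)
    then have "frac_emb R (b i \<otimes>\<^bsub>R\<^esub> b j) \<in> (\<lambda>r. \<delta> \<otimes>\<^bsub>frac_alg R\<^esub> frac_emb R r) ` carrier R"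
      using sub by blast
    then obtain z where "frac_emb R (b i \<otimes>\<^bsub>R\<^esub> b j) = \<delta> \<otimes>\<^bsub>frac_alg R\<^esub> frac_emb R (e z)"
      by (auto simp: D(2))
    then have "vfract (df_mult f (\<alpha>$i) (\<alpha>$j)) = df_mult (ffract f) d (vfract z)"
      by (simp add: \<alpha> d D(6) frac_emb_coord[OF c] K(6) coordinates_inj[OF coordinates_frac[OF c]])
    then show ?thesis by (auto simp: vfract_df_mult)
  qed
  ultimately have "admissible f (row_module \<alpha>) d"
    using nondegenerate_coordinates[OF c] nd det u(1) unfolding admissible_def by blast
  then show thesis using that c I\<alpha> d by blast
qed

section \<open>Isomorphisms and equivalence of triples in coordinates\<close>

lemma alg_iso_matrix:
  fixes R R' :: "('a::idom, 'c) module"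
  assumes c: "coordinates R f e" and c': "coordinates R' f' e'" and \<phi>: "alg_iso R R' \<phi>"
  obtains H where "df_iso f f' H" "\<And>x. \<phi> (e x) = e' (H *v x)"
proof -
  note D = coordinatesD[OF c] and D' = coordinatesD[OF c'] and i' = coordinates_inj[OF c']
  have hom: "\<phi> \<in> ring_hom R R'" and bij: "bij_betw \<phi> (carrier R) (carrier R')"
    and lin: "\<And>t x. x \<in> carrier R \<Longrightarrow> \<phi> (t \<odot>\<^bsub>R\<^esub> x) = t \<odot>\<^bsub>R'\<^esub> \<phi> x"
    using \<phi> by (auto simp: alg_iso_def ring_iso_def)
  have mem: "e x \<in> carrier R" for x by (simp add: D(2))
  have "\<exists>y. \<phi> (e x) = e' y" for x
    using ring_hom_closed[OF hom mem] by (auto simp: D'(2))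
  then obtain h where h: "\<And>x. \<phi> (e x) = e' (h x)" by metis
  have add: "h (x + y) = h x + h y" for x y
    using ring_hom_add[OF hom mem mem, of x y] by (simp add: D(5) h D'(5) i')
  have scale: "h (k *s x) = k *s h x" for k x
    using lin[OF mem, of k x] by (simp add: D(7) h D'(7) i')
  have mult: "h (df_mult f x y) = df_mult f' (h x) (h y)" for x y
    using ring_hom_mult[OF hom mem mem, of x y] by (simp add: D(6) h D'(6) i')
  have one: "h vone = vone"
    using ring_hom_one[OF hom] by (simp add: D(3) h D'(3) i')
  have surj: "\<exists>x. h x = y" for y
  proof -
    have "e' y \<in> \<phi> ` carrier R" using bij by (simp add: bij_betw_def D'(2))
    then show ?thesis by (auto simp: D(2) h i')
  qed
  define H where "H = (\<chi> i j. h (axis j 1) $ i)"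
  have H: "H *v x = h x" for x
  proof -
    have "x = x$1 *s axis 1 1 + x$2 *s axis 2 1 + x$3 *s axis 3 1"
      by (simp add: vec_eq_iff forall_3)
    then have "h x = x$1 *s h (axis 1 1) + x$2 *s h (axis 2 1) + x$3 *s h (axis 3 1)"
      by (metis add scale)
    then show ?thesis
      by (simp add: H_def matrix_vector_mult_def vec_eq_iff sum_3 mult.commute)
  qed
  obtain g where g: "\<And>y. h (g y) = y" using surj by metis
  define G where "G = transpose (\<chi> j. g (axis j 1))"
  have "H ** G = mat 1"
  proof -
    have "(H ** G) $ i $ j = (H *v g (axis j 1)) $ i" for i j
      by (simp add: G_def matrix_matrix_mult_def matrix_vector_mult_def transpose_def)
    then show ?thesis by (simp add: vec_eq_iff H g mat_def axis_def)
  qed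
  \<comment> \<open>A right inverse built from preimages is enough, since it already makes det H a
    unit.\<close>
  then have "det H * det G = 1" by (metis det_I det_mul)
  then have "invertible H" by (metis dvdI invertible_iff_det_unit)
  then have "df_iso f f' H" using one mult by (simp add: df_iso_def H)
  then show thesis using that h H by simp
qed

lemma matrix_alg_iso:
  fixes R R' :: "('a::idom, 'c) module"
  assumes c: "coordinates R f e" and c': "coordinates R' f' e'" and H: "df_iso f f' H"
  obtains \<phi> where "alg_iso R R' \<phi>" "\<And>x. \<phi> (e x) = e' (H *v x)"
proof -
  note D = coordinatesD[OF c] and D' = coordinatesD[OF c'] and i' = coordinates_inj[OF c']
  define \<phi> where "\<phi> r = e' (H *v inv_into UNIV e r)" for r
  have \<phi>: "\<phi> (e x) = e' (H *v x)" for x by (simp add: \<phi>_def inv_f_f[OF D(1)])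
  obtain G where G: "H ** G = mat 1" "G ** H = mat 1" using df_isoD(3)[OF H] by (auto simp: invertible_def)
  have HG: "H *v (G *v x) = x" "G *v (H *v x) = x" for x by (simp_all add: matrix_vector_mul_assoc G)
  have "\<phi> \<in> ring_hom R R'"
    by (rule ring_hom_memI)
      (auto simp: D(2-) \<phi> D'(2-) df_isoD[OF H] matrix_vector_right_distrib)
  moreover have "bij_betw \<phi> (carrier R) (carrier R')"
  proof -
    have "inj_on \<phi> (range e)" by (auto simp: inj_on_def \<phi> i') (metis HG(2))
    moreover have "\<phi> ` range e = range e'"
      by (auto simp: \<phi> image_image) (metis HG(1) range_eqI)
    ultimately show ?thesis by (simp add: bij_betw_def D(2) D'(2))
  qed
  moreover have "\<phi> (t \<odot>\<^bsub>R\<^esub> x) = t \<odot>\<^bsub>R'\<^esub> \<phi> x" if "x \<in> carrier R" for t x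
    using that by (auto simp: D(2,7) \<phi> D'(7) matrix_vector_scale)
  ultimately have "alg_iso R R' \<phi>" by (simp add: alg_iso_def ring_iso_def)
  then show thesis using that \<phi> by blast
qed

text \<open>In coordinates both sides of each condition are images under the injective
  \<open>frac_coord e'\<close>, which can be cancelled.\<close>

lemma triple_equiv_coordinates:
  fixes S :: "'a::idom set" and R R' :: "('a, 'c) module"
  assumes t: "(R, e ` L, frac_coord e d) \<in> triples S" and t': "(R', e' ` L', frac_coord e' d') \<in> triples S"
    and c: "coordinates R f e" and c': "coordinates R' f' e'"
  shows "((R, e ` L, frac_coord e d), (R', e' ` L', frac_coord e' d')) \<in> triple_equiv S \<longleftrightarrow> coord_equiv f L d f' L' d'"
proof -
  note K' = coordinatesD[OF coordinates_frac[OF c']] and ki' = coordinates_inj[OF coordinates_frac[OF c']]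
  have key: "frac_emb R' ` e' ` L' = (\<lambda>x. frac_coord e' k \<otimes>\<^bsub>frac_alg R'\<^esub> frac_emb R' (\<phi> x)) ` e ` L
        \<and> frac_coord e' d' = frac_coord e' k \<otimes>\<^bsub>frac_alg R'\<^esub> frac_coord e' k \<otimes>\<^bsub>frac_alg R'\<^esub> frac_map R' \<phi> (frac_coord e d)
      \<longleftrightarrow> vfract ` L' = (\<lambda>x. df_mult (ffract f') k (vfract (H *v x))) ` L
        \<and> d' = df_mult (ffract f') (df_mult (ffract f') k k) (mfract H *v d)"
    if \<phi>: "\<And>x. \<phi> (e x) = e' (H *v x)" for \<phi> H k
  proof -
    have "frac_emb R' ` e' ` L' = frac_coord e' ` vfract ` L'"
      by (simp add: image_image frac_emb_coord[OF c'])
    moreover have "(\<lambda>x. frac_coord e' k \<otimes>\<^bsub>frac_alg R'\<^esub> frac_emb R' (\<phi> x)) ` e ` L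
        = frac_coord e' ` (\<lambda>x. df_mult (ffract f') k (vfract (H *v x))) ` L"
      by (simp add: image_image \<phi> frac_emb_coord[OF c'] K'(6))
    ultimately show ?thesis
      by (simp add: inj_image_eq_iff[OF K'(1)] frac_map_coord[OF c c' \<phi>] K'(6) ki')
  qed
  show ?thesis
  proof
    assume "((R, e ` L, frac_coord e d), (R', e' ` L', frac_coord e' d')) \<in> triple_equiv S"
    then have "\<exists>\<phi> \<kappa>. alg_iso R R' \<phi> \<and> \<kappa> \<in> carrier (frac_alg R') \<and>
        frac_emb R' ` e' ` L' = (\<lambda>x. \<kappa> \<otimes>\<^bsub>frac_alg R'\<^esub> frac_emb R' (\<phi> x)) ` e ` L
        \<and> frac_coord e' d' = \<kappa> \<otimes>\<^bsub>frac_alg R'\<^esub> \<kappa> \<otimes>\<^bsub>frac_alg R'\<^esub> frac_map R' \<phi> (frac_coord e d)"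
      unfolding triple_equiv_def mem_Collect_eq prod.case by (elim conjE)
    then obtain \<phi> \<kappa> where \<phi>: "alg_iso R R' \<phi>" and \<kappa>: "\<kappa> \<in> carrier (frac_alg R')"
      and eq: "frac_emb R' ` e' ` L' = (\<lambda>x. \<kappa> \<otimes>\<^bsub>frac_alg R'\<^esub> frac_emb R' (\<phi> x)) ` e ` L
        \<and> frac_coord e' d' = \<kappa> \<otimes>\<^bsub>frac_alg R'\<^esub> \<kappa> \<otimes>\<^bsub>frac_alg R'\<^esub> frac_map R' \<phi> (frac_coord e d)"
      by (elim exE conjE) (rule that, assumption+, rule conjI)
    obtain H where H: "df_iso f f' H" "\<And>x. \<phi> (e x) = e' (H *v x)"
      using alg_iso_matrix[OF c c' \<phi>] by blast
    obtain k where k: "\<kappa> = frac_coord e' k" using \<kappa> by (auto simp: K'(2))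
    note eq' = key[OF H(2), THEN iffD1, OF eq[unfolded k]]
    show "coord_equiv f L d f' L' d'"
      unfolding coord_equiv_def
      by (intro exI[of _ H] exI[of _ k] conjI H(1) eq'[THEN conjunct1] eq'[THEN conjunct2])
  next
    assume "coord_equiv f L d f' L' d'"
    then obtain H k where H: "df_iso f f' H"
      and eq: "vfract ` L' = (\<lambda>x. df_mult (ffract f') k (vfract (H *v x))) ` L
        \<and> d' = df_mult (ffract f') (df_mult (ffract f') k k) (mfract H *v d)"
      unfolding coord_equiv_def by blast
    obtain \<phi> where \<phi>: "alg_iso R R' \<phi>" "\<And>x. \<phi> (e x) = e' (H *v x)"
      using matrix_alg_iso[OF c c' H] by blast
    have mem: "frac_coord e' k \<in> carrier (frac_alg R')" by (simp add: K'(2))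
    note eq' = key[OF \<phi>(2), THEN iffD2, OF eq]
    show "((R, e ` L, frac_coord e d), (R', e' ` L', frac_coord e' d')) \<in> triple_equiv S"
      unfolding triple_equiv_def mem_Collect_eq prod.case
      by (intro conjI t t' exI[of _ \<phi>] exI[of _ "frac_coord e' k"] \<phi>(1) mem
          eq'[THEN conjunct1] eq'[THEN conjunct2])
  qed
qed

lemma coordinates_a_inv:
  fixes R :: "('k::comm_ring_1, 'c) module"
  assumes c: "coordinates R f e"
  shows "inv\<^bsub>add_monoid R\<^esub> (e x) = e (- x)"
proof -
  interpret cring R by (rule algebra.M_cring[OF coordinates_algebra[OF c]])
  have "\<ominus>\<^bsub>R\<^esub> (e x) = e (- x)"
    by (rule minus_equality) (simp_all add: coordinatesD[OF c])
  then show ?thesis by (simp add: a_inv_def)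
qed

text \<open>For surjectivity: as det \<alpha> itself lies in \<open>S\<close>, the unit in
  \<open>admissible\<close> can be 1, and the standard basis of the ring serves in
  \<open>represents\<close>.\<close>

lemma triple_of_coordinates:
  fixes S :: "'a::idom set" and R :: "('a, 'c) module"
  assumes c: "coordinates R f e" and disc: "df_disc f \<noteq> 0" and det: "det \<alpha> \<noteq> 0" "det \<alpha> \<in> S"
    and S: "unit_orbit_reps S" and n: "df_norm (ffract f) d = (to_fract (det \<alpha>))\<^sup>2"
    and t: "has_table (ffract f) (mfract \<alpha>) d (mfract C) (mfract B) (mfract A)"
    and closed: "\<And>x y. x \<in> row_module \<alpha> \<Longrightarrow> df_mult f y x \<in> row_module \<alpha>"
  shows "(R, e ` row_module \<alpha>, frac_coord e d) \<in> triples S" "admissible f (row_module \<alpha>) d"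
    "represents f (row_module \<alpha>) d A B"
proof -
  interpret cring R by (rule algebra.M_cring[OF coordinates_algebra[OF c]])
  note D = coordinatesD[OF c] and K = coordinatesD[OF coordinates_frac[OF c]]
  have tab: "df_mult (ffract f) (vfract (\<alpha>$i)) (vfract (\<alpha>$j)) = df_mult (ffract f) d (vfract (table C B A i j))" for i j
    using t by (simp add: has_table_def vfract_table)
  have "u v* \<alpha> + u' v* \<alpha> = (u + u') v* \<alpha>" "- (u v* \<alpha>) = (- u) v* \<alpha>" for u u'
    by (simp_all add: vec_eq_iff vector_matrix_mult_def sum_3 algebra_simps)
  then have add: "x + y \<in> row_module \<alpha>" "- x \<in> row_module \<alpha>" if "x \<in> row_module \<alpha>" "y \<in> row_module \<alpha>" for x y
    using that unfolding row_module_def by auto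
  have "0 \<in> row_module \<alpha>" unfolding row_module_def by (metis rangeI vector_matrix_linear(8))
  have "subgroup (e ` row_module \<alpha>) (add_monoid R)"
  proof (rule subgroup.intro)
    show "inv\<^bsub>add_monoid R\<^esub> x \<in> e ` row_module \<alpha>" if x: "x \<in> e ` row_module \<alpha>" for x
    proof -
      obtain y where "x = e y" "y \<in> row_module \<alpha>" using x by blast
      then show ?thesis using coordinates_a_inv[OF c] add(2) by (metis imageI)
    qed
  qed (use \<open>0 \<in> row_module \<alpha>\<close> add(1) in \<open>auto simp: D(2-)\<close>)
  then have I: "ideal (e ` row_module \<alpha>) R"
    by (intro idealI ring_axioms) (auto simp: D(2-) closed, metis closed df_mult_commute imageI)
  have prod_exists: "\<exists>z. df_mult (ffract f) (vfract x) (vfract y) = df_mult (ffract f) d (vfract z)"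
    if xy: "x \<in> row_module \<alpha>" "y \<in> row_module \<alpha>" for x y
  proof -
    obtain u v where "x = u v* \<alpha>" "y = v v* \<alpha>" using xy by (auto simp: row_module_def)
    then have "df_mult (ffract f) (vfract x) (vfract y)
        = (\<Sum>i\<in>UNIV. \<Sum>j\<in>UNIV. to_fract (u$i * v$j) *s df_mult (ffract f) (vfract (\<alpha>$i)) (vfract (\<alpha>$j)))"
      by (simp add: vector_matrix_rows df_mult_add df_mult_scale sum_3) (simp add: vec_eq_iff algebra_simps)
    also have "\<dots> = df_mult (ffract f) d (vfract (\<Sum>i\<in>UNIV. \<Sum>j\<in>UNIV. (u$i * v$j) *s table C B A i j))"
      by (simp add: tab df_mult_add df_mult_scale sum_3)
    finally show ?thesis by blast
  qed
  have emb: "frac_emb R ` (e ` row_module \<alpha> \<cdot>\<^bsub>R\<^esub> e ` row_module \<alpha>)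
      \<subseteq> (\<lambda>r. frac_coord e d \<otimes>\<^bsub>frac_alg R\<^esub> frac_emb R r) ` carrier R"
  proof -
    have "\<exists>x z. s = e x \<and> vfract x = df_mult (ffract f) d (vfract z)"
      if "s \<in> e ` row_module \<alpha> \<cdot>\<^bsub>R\<^esub> e ` row_module \<alpha>" for s
      using that
    proof induction
      case (prod i j)
      then obtain x y where "x \<in> row_module \<alpha>" "y \<in> row_module \<alpha>" "i = e x" "j = e y" by blast
      moreover then obtain z where "df_mult (ffract f) (vfract x) (vfract y) = df_mult (ffract f) d (vfract z)"
        using prod_exists by blast
      ultimately have "i \<otimes>\<^bsub>R\<^esub> j = e (df_mult f x y)" "vfract (df_mult f x y) = df_mult (ffract f) d (vfract z)"
        by (simp_all add: D(6) vfract_df_mult)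
      then show ?case by blast
    next
      case (sum s1 s2)
      then obtain x z x' z' where "s1 = e x" "vfract x = df_mult (ffract f) d (vfract z)"
        "s2 = e x'" "vfract x' = df_mult (ffract f) d (vfract z')" by blast
      then have "s1 \<oplus>\<^bsub>R\<^esub> s2 = e (x + x')" "vfract (x + x') = df_mult (ffract f) d (vfract (z + z'))"
        by (simp_all add: D(5) df_mult_add)
      then show ?case by blast
    qed
    then have "\<exists>z. frac_emb R s = frac_coord e d \<otimes>\<^bsub>frac_alg R\<^esub> frac_emb R (e z)"
      if "s \<in> e ` row_module \<alpha> \<cdot>\<^bsub>R\<^esub> e ` row_module \<alpha>" for s
      using that frac_emb_coord[OF c] K(6) by metis
    then show ?thesis unfolding D(2) by blast
  qed
  have "df_norm (ffract f) d \<noteq> 0" using n det by simp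
  then have unit: "frac_coord e d \<in> Units (frac_alg R)"
    unfolding Units_frac[OF c] using df_inverse by metis
  have "(to_fract (ideal_norm_rep S R (e ` row_module \<alpha>)))\<^sup>2 = alg_norm (frac_alg R) (frac_coord e d)"
    unfolding alg_norm_coordinates[OF coordinates_frac[OF c]] n
    using ideal_norm_rep_coordinates(3)[OF c det(1) S det(2) refl] by simp
  then show "(R, e ` row_module \<alpha>, frac_coord e d) \<in> triples S"
    using I unit emb nondegenerate_coordinates[OF c] disc is_basis_row_module[OF c det(1)]
    unfolding triples_def by blast
  show "admissible f (row_module \<alpha>) d"
    unfolding admissible_def using disc det(1) n tab
    by (intro conjI exI[of _ \<alpha>] exI[of _ 1]) auto
  have "invertible (mat 1 :: 'a ^ 3 ^ 3)" by (auto simp: invertible_def)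
  then show "represents f (row_module \<alpha>) d A B"
    unfolding represents_def using det(1) tab
    by (intro exI[of _ "mat 1"] exI[of _ \<alpha>] exI[of _ C]) simp
qed

text \<open>Transports the ring of \<open>f\<close> along an injection of \<open>T^3\<close>, so
  that it has a copy in any carrier type that is large enough.\<close>

definition coord_module :: "'a::idom cubic_form \<Rightarrow> ('a ^ 3 \<Rightarrow> 'c) \<Rightarrow> ('a, 'c) module" where
  "coord_module f e = \<lparr>carrier = range e,
     mult = (\<lambda>x y. e (df_mult f (inv_into UNIV e x) (inv_into UNIV e y))), one = e vone, ring.zero = e 0,
     add = (\<lambda>x y. e (inv_into UNIV e x + inv_into UNIV e y)),
     module.smult = (\<lambda>k x. e (k *s inv_into UNIV e x))\<rparr>"

lemma coordinates_coord_module: "inj e \<Longrightarrow> coordinates (coord_module f e) f e"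
  by (simp add: coordinates_def coord_module_def)

section \<open>Orbits\<close>

text \<open>The scalar l multiplies both forms by l^2, and m^2 undoes this. Hence all members of a
  coset act alike.\<close>

lemma pair_act_trivial:
  assumes "l * m = (1::'a::idom)"
  shows "pair_act (mat (m\<^sup>2) ** g, mat l ** h) v = pair_act (g, h) v"
proof -
  obtain A B where v: "v = (A, B)" by (cases v)
  have h: "(mat l ** h) ** M ** transpose (mat l ** h) = mat (l * l) ** (h ** M ** transpose h)" for M
  proof -
    have "(mat l ** h) ** M ** transpose (mat l ** h) = mat l ** (h ** M ** transpose h) ** mat l"
      by (simp add: matrix_transpose_mul transpose_mat matrix_mul_assoc)
    also have "\<dots> = mat l ** (mat l ** (h ** M ** transpose h))"
      by (metis mat_mult_commute matrix_mul_assoc)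
    finally show ?thesis by (simp add: mat_mat matrix_mul_assoc)
  qed
  have g: "(mat (m\<^sup>2) ** g) $ i $ j = m\<^sup>2 * g $ i $ j" for i j
    using exhaust_2[of i] by (auto simp: matrix_matrix_mult_def mat_def sum_2)
  have ml: "m\<^sup>2 * p * (l * l * x) = p * x" for p x
  proof -
    have "m\<^sup>2 * p * (l * l * x) = (l * m) * (l * m) * (p * x)" by (simp only: power2_eq_square ac_simps)
    then show ?thesis by (simp add: assms)
  qed
  show ?thesis
    by (simp add: v pair_act_def Let_def h g scale_mat_def vec_eq_iff mat_mult_nth ml)
qed

text \<open>Each coset is nonempty and acts through a single value, so the quotient group has the
  same orbits as the product of the two linear groups.\<close>

lemma orbit_G_act: "orbit G_group G_act v = {pair_act g v | g. g \<in> carrier (GL \<times>\<times> GL)}"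
proof -
  have "G_act (trivial_subgroup #>\<^bsub>GL \<times>\<times> GL\<^esub> g) v = pair_act g v" for g
  proof -
    let ?P = "trivial_subgroup #>\<^bsub>GL \<times>\<times> GL\<^esub> g"
    obtain g2 h where g: "g = (g2, h)" by (cases g)
    have "pair_act k v = pair_act g v" if "k \<in> ?P" for k
      using that by (auto simp: r_coset_def trivial_subgroup_def g GL_def DirProd_def pair_act_trivial)
    then have "(\<lambda>k. pair_act k v) ` ?P = (\<lambda>k. pair_act g v) ` ?P"
      by (rule image_cong[OF refl])
    moreover have "(mat (1\<^sup>2), mat 1) \<in> (trivial_subgroup :: (('a ^ 2 ^ 2) \<times> ('a ^ 3 ^ 3)) set)"
      unfolding trivial_subgroup_def by (metis (mono_tags, lifting) mem_Collect_eq mult_1)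
    then have "?P \<noteq> {}" by (auto simp: r_coset_def)
    ultimately have "(\<lambda>k. pair_act k v) ` ?P = {pair_act g v}" by auto
    then show ?thesis by (simp add: G_act_def)
  qed
  moreover have "carrier G_group = (\<lambda>g. trivial_subgroup #>\<^bsub>GL \<times>\<times> GL\<^esub> g) ` carrier (GL \<times>\<times> GL)"
    by (auto simp: G_group_def FactGroup_def RCOSETS_def)
  then have "orbit G_group G_act v
      = (\<lambda>g. G_act (trivial_subgroup #>\<^bsub>GL \<times>\<times> GL\<^esub> g) v) ` carrier (GL \<times>\<times> GL)"
    by (auto simp: orbit_def)
  ultimately have "orbit G_group G_act v = (\<lambda>g. pair_act g v) ` carrier (GL \<times>\<times> GL)"
    by (simp only:)
  then show ?thesis by blast
qed

section \<open>Orbits as sets of represented pairs, and the bijection\<close>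

lemma represents_orbit:
  assumes "df_mult (ffract f) d q = vone" "represents f L d A B"
  shows "{(A', B'). represents f L d A' B'} = orbit G_group G_act (A, B)"
proof (intro equalityI subsetI)
  fix v assume "v \<in> {(A', B'). represents f L d A' B'}"
  then obtain A' B' where v: "v = (A', B')" "represents f L d A' B'" by blast
  then show "v \<in> orbit G_group G_act (A, B)"
    unfolding orbit_G_act using represents_unique_orbit[OF assms(1,2) v(2)] by blast
next
  fix v assume "v \<in> orbit G_group G_act (A, B)"
  then obtain g where "g \<in> carrier (GL \<times>\<times> GL)" "v = pair_act g (A, B)" unfolding orbit_G_act by blast
  then show "v \<in> {(A', B'). represents f L d A' B'}"
    using represents_act[OF assms(2)] by (cases v) auto
qed

text \<open>The relation is the kernel of h, so its classes are the fibres of h. The bijection sends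
  a value, later an orbit, to its fibre.\<close>

lemma bij_betw_quotient:
  assumes "\<And>x y. (x, y) \<in> E \<longleftrightarrow> x \<in> M \<and> y \<in> M \<and> h x = h y"
  shows "bij_betw (\<lambda>z. {x \<in> M. h x = z}) (h ` M) (M // E)"
proof -
  have "E `` {x} = {y \<in> M. h y = h x}" if "x \<in> M" for x using that assms by auto
  then have "M // E = (\<lambda>z. {x \<in> M. h x = z}) ` h ` M"
    by (auto simp: quotient_def image_image)
  moreover have "inj_on (\<lambda>z. {x \<in> M. h x = z}) (h ` M)"
    by (rule inj_onI) blast
  ultimately show ?thesis by (simp add: bij_betw_def)
qed

theorem theorem11:
  fixes S :: "'a::idom set" and \<iota> :: "'a ^ 3 \<Rightarrow> 'c"
  assumes "principal_domain (ring_of_type_algebra :: 'a ring)"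
    and "unit_orbit_reps S"
    and "has_cofinal_cubes S"
    and "inj \<iota>"
  shows "\<exists>F. bij_betw F
           (orbits G_group (nondegenerate_pairs :: 'a sym_pair set) G_act)
           ((triples S :: ('a, 'c) triple set) // triple_equiv S)"
proof -
  let ?T = "triples S :: ('a, 'c) triple set"
  define is_coord where "is_coord t p = (case t of (R, I, \<delta>) \<Rightarrow> case p of (f, e, L, d) \<Rightarrow>
      coordinates R f e \<and> I = e ` L \<and> \<delta> = frac_coord e d \<and> admissible f L d)"
    for t :: "('a, 'c) triple" and p :: "'a cubic_form \<times> ('a ^ 3 \<Rightarrow> 'c) \<times> ('a ^ 3) set \<times> ('a fract ^ 3)"
  define orb where "orb p = (case p of (f, e, L, d) \<Rightarrow> {(A, B). represents f L d A B})"
    for p :: "'a cubic_form \<times> ('a ^ 3 \<Rightarrow> 'c) \<times> ('a ^ 3) set \<times> ('a fract ^ 3)"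
  have "\<exists>p. is_coord t p" if t: "t \<in> ?T" for t
  proof -
    obtain R I \<delta> where R: "t = (R, I, \<delta>)" by (cases t)
    obtain f e L d where "coordinates R f e" "I = e ` L" "\<delta> = frac_coord e d" "admissible f L d"
      using triple_coordinates[OF assms(1,2) t[unfolded R]] .
    then have "is_coord t (f, e, L, d)" by (simp add: is_coord_def R)
    then show ?thesis ..
  qed
  then obtain p where p: "\<And>t. t \<in> ?T \<Longrightarrow> is_coord t (p t)" by metis
  have orb: "\<exists>v\<in>nondegenerate_pairs. orb q = orbit G_group G_act v" if "is_coord t q" for t q
  proof -
    obtain f e L d where q: "q = (f, e, L, d)" by (cases q)
    then have adm: "admissible f L d" using that by (auto simp: is_coord_def)
    obtain A B where AB: "(A, B) \<in> nondegenerate_pairs" "represents f L d A B"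
      using admissible_represents[OF adm] .
    obtain r where "df_mult (ffract f) d r = vone" using admissible_unit[OF adm] .
    then have "orb q = orbit G_group G_act (A, B)"
      using represents_orbit AB(2) by (simp add: orb_def q)
    then show ?thesis using AB(1) by blast
  qed
  \<comment> \<open>Coordinates of a triple are not unique. Allowing arbitrary ones on both sides
    makes the orbit independent of the choice \<open>p\<close>.\<close>
  have equiv: "(t, t') \<in> triple_equiv S \<longleftrightarrow> orb q = orb q'"
    if t: "t \<in> ?T" "is_coord t q" and t': "t' \<in> ?T" "is_coord t' q'" for t t' q q'
  proof -
    obtain f e L d where q: "q = (f, e, L, d)" by (cases q)
    obtain f' e' L' d' where q': "q' = (f', e', L', d')" by (cases q')
    obtain R where R: "t = (R, e ` L, frac_coord e d)" "coordinates R f e" "admissible f L d"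
      using t(2) by (auto simp: is_coord_def q split: prod.splits)
    obtain R' where R': "t' = (R', e' ` L', frac_coord e' d')" "coordinates R' f' e'" "admissible f' L' d'"
      using t'(2) by (auto simp: is_coord_def q' split: prod.splits)
    obtain r' where r': "df_mult (ffract f') d' r' = vone" using admissible_unit[OF R'(3)] .
    have "(t, t') \<in> triple_equiv S \<longleftrightarrow> coord_equiv f L d f' L' d'"
      unfolding R(1) R'(1)
      by (rule triple_equiv_coordinates[OF t(1)[unfolded R(1)] t'(1)[unfolded R'(1)] R(2) R'(2)])
    also have "\<dots> \<longleftrightarrow> orb q = orb q'"
    proof
      assume ce: "coord_equiv f L d f' L' d'"
      obtain A B where AB: "represents f L d A B" using admissible_represents[OF R(3)] by blast
      obtain r where r: "df_mult (ffract f) d r = vone" using admissible_unit[OF R(3)] .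
      have "represents f' L' d' A B" by (rule represents_equiv[OF ce r' AB])
      then show "orb q = orb q'"
        using represents_orbit[OF r AB] represents_orbit[OF r'] by (simp add: orb_def q q')
    next
      assume eq: "orb q = orb q'"
      obtain A B where AB: "(A, B) \<in> nondegenerate_pairs" "represents f L d A B"
        using admissible_represents[OF R(3)] .
      then have "represents f' L' d' A B" using eq by (auto simp: orb_def q q')
      then show "coord_equiv f L d f' L' d'"
        using represents_equiv_unique[OF AB(2) R(3) _ R'(3)] AB(1) by (auto simp: nondegenerate_pairs_def)
    qed
    finally show ?thesis .
  qed
  have surj: "\<exists>t\<in>?T. orb (p t) = orbit G_group G_act v" if v: "v \<in> nondegenerate_pairs" for v
  proof -
    obtain A B where AB: "v = (A, B)" by (cases v)
    obtain f \<alpha> \<delta> m C where *: "df_disc f \<noteq> 0" "det \<alpha> = m ^ 3" "m \<noteq> 0" "m ^ 3 \<in> S"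
      "df_norm (ffract f) \<delta> = (to_fract (m ^ 3))\<^sup>2"
      "has_table (ffract f) (mfract \<alpha>) \<delta> (mfract C) (mfract B) (mfract A)"
      "\<And>x y. x \<in> row_module \<alpha> \<Longrightarrow> df_mult f y x \<in> row_module \<alpha>"
      using pair_represented[OF v[unfolded AB] assms(3)] by metis
    have c: "coordinates (coord_module f \<iota>) f \<iota>" by (rule coordinates_coord_module[OF assms(4)])
    have det: "det \<alpha> \<noteq> 0" "det \<alpha> \<in> S" "df_norm (ffract f) \<delta> = (to_fract (det \<alpha>))\<^sup>2" using * by simp_all
    define t where "t = (coord_module f \<iota>, \<iota> ` row_module \<alpha>, frac_coord \<iota> \<delta>)"
    note toc = triple_of_coordinates[OF c *(1) det(1,2) assms(2) det(3) *(6,7)]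
    have t: "t \<in> ?T" using toc(1) by (simp add: t_def)
    have ic: "is_coord t (f, \<iota>, row_module \<alpha>, \<delta>)"
      using c toc(2) by (simp add: is_coord_def t_def)
    \<comment> \<open>The coordinates chosen by \<open>p\<close> may differ from the ones just
      constructed. Comparing the constructed ones with themselves shows that t is equivalent to t,
      and comparing them with \<open>p t\<close> then equates the orbits.\<close>
    have "orb (p t) = orb (f, \<iota>, row_module \<alpha>, \<delta>)"
      using equiv[OF t ic t ic] equiv[OF t p[OF t] t ic] by simp
    also obtain r where r: "df_mult (ffract f) \<delta> r = vone" using admissible_unit[OF toc(2)] .
    have "orb (f, \<iota>, row_module \<alpha>, \<delta>) = orbit G_group G_act v"
      using represents_orbit[OF r toc(3)] by (simp add: orb_def AB)
    finally show ?thesis using t by blast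
  qed
  have "(\<lambda>t. orb (p t)) ` ?T = orbits G_group nondegenerate_pairs G_act"
  proof (intro equalityI subsetI)
    fix z :: "'a sym_pair set" assume "z \<in> (\<lambda>t. orb (p t)) ` ?T"
    then show "z \<in> orbits G_group nondegenerate_pairs G_act"
      using orb p unfolding orbits_def by blast
  next
    fix z :: "'a sym_pair set" assume "z \<in> orbits G_group nondegenerate_pairs G_act"
    then obtain v where "v \<in> nondegenerate_pairs" "z = orbit G_group G_act v" unfolding orbits_def by blast
    then show "z \<in> (\<lambda>t. orb (p t)) ` ?T" using surj by (metis imageI)
  qed
  moreover have "(t, t') \<in> triple_equiv S \<longleftrightarrow> t \<in> ?T \<and> t' \<in> ?T \<and> orb (p t) = orb (p t')" for t t'
  proof -
    have "t \<in> ?T \<and> t' \<in> ?T" if "(t, t') \<in> triple_equiv S" using that by (auto simp: triple_equiv_def)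
    then show ?thesis using equiv p by blast
  qed
  ultimately show ?thesis using bij_betw_quotient[of "triple_equiv S" ?T "\<lambda>t. orb (p t)"] by auto
qed

end
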